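(* Let $f$ be an admissible function, and assume that $\operatorname{supp}\widehat f\subseteq[-\alpha,\alpha]$ with $\alpha>0$. If $m$ is a positive integer with $m<2/\alpha$, then the $m$-th moment of $W_f^{osc}$ satisfies $$\lim_{q\to\infty}\left\langle\left(W_f^{osc}\right)^m\right\rangle_q=\begin{cases}\dfrac{m!}{2^{m/2}(m/2)!}\,\sigma(f)^m,& m\text{ even},\\[2mm] 0,& m\text{ odd},\end{cases}$$ where $q$ runs through odd primes and $\sigma(f)^2=\int_{-1}^1|u|\,\widehat f(u)^2\,du$ (with $\sigma(f)\ge 0$).
   Context: The Fourier transform is $\widehat f(u)=\int_{-\infty}^\infty f(x)e^{-2\pi i xu}\,dx$. A function $f$ is admissible if it is a real, even function (on $\mathbb R$) whose Fourier transform $\widehat f$ is compactly supported and which satisfies $f(r)\ll(1+|r|)^{-1-\delta}$ for real $r$ and some $\delta>0$. Let $q$ be an odd prime. For a non-trivial Dirichlet character $\chi$ modulo $q$ define $$W_f^{osc}(\chi)=-\frac1{\log q}\sum_{n\ge1}\frac{\Lambda(n)}{\sqrt n}\,\widehat f\left(\frac{\log n}{\log q}\right)\left(\chi(n)+\overline{\chi}(n)\right),$$ where $\Lambda$ is the von Mangoldt function ($\Lambda(n)=\log p$ if $n=p^k$ is a prime power, $k\geq 1$, and $0$ otherwise). (This is the oscillatory part of the linear statistic $W_f(\chi)=\sum_j f(\frac{\log q}{2\pi}\gamma_{\chi,j})$ over the non-trivial zeros $\frac12+i\gamma_{\chi,j}$ of $L(s,\chi)$.) For a function $X(\chi)$ of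 characters modulo $q$, $\langle X\rangle_q=\frac1{q-2}\sum_{\chi\ne\chi_0}X(\chi)$, the sum over all $q-2$ non-trivial characters modulo $q$ ($\chi_0$ being the trivial one). *)

theory Defs
  imports "HOL-Analysis.Analysis" "HOL-Number_Theory.Number_Theory"
begin

definition fourier_transform :: "(real \<Rightarrow> real) \<Rightarrow> real \<Rightarrow> complex" where
  "fourier_transform f u =
     (LINT x|lebesgue. complex_of_real (f x) * exp (- 2 * of_real pi * \<i> * of_real x * of_real u))"

definition fun_support :: "(real \<Rightarrow> complex) \<Rightarrow> real set" where
  "fun_support g = closure {u. g u \<noteq> 0}"

(* Measurability is implicit in the formation of the Fourier integral; together with the
   decay condition it makes f integrable. *)
definition admissible :: "(real \<Rightarrow> real) \<Rightarrow> bool" where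
  "admissible f \<longleftrightarrow>
     f \<in> borel_measurable lebesgue \<and>
     (\<forall>x. f (- x) = f x) \<and>
     compact (fun_support (fourier_transform f)) \<and>
     (\<exists>\<delta>>0. \<exists>C. \<forall>r. \<bar>f r\<bar> \<le> C * (1 + \<bar>r\<bar>) powr (- 1 - \<delta>))"

(* Characters are represented by their values on the natural numbers, which determine
   them by periodicity. *)
definition dirichlet_characters :: "nat \<Rightarrow> (nat \<Rightarrow> complex) set" where
  "dirichlet_characters q =
     {\<psi>. (\<forall>n. \<psi> (n + q) = \<psi> n) \<and>
          (\<forall>m n. \<psi> (m * n) = \<psi> m * \<psi> n) \<and>
          (\<forall>n. \<psi> n \<noteq> 0 \<longleftrightarrow> coprime n q)}"

definition trivial_character :: "nat \<Rightarrow> nat \<Rightarrow> complex" where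
  "trivial_character q n = (if coprime n q then 1 else 0)"

definition W_osc :: "(real \<Rightarrow> real) \<Rightarrow> nat \<Rightarrow> (nat \<Rightarrow> complex) \<Rightarrow> complex" where
  "W_osc f q \<psi> =
     - (1 / of_real (ln (real q))) *
       (\<Sum>\<^sub>\<infinity>n\<in>{1..}. mangoldt n / of_real (sqrt (real n)) *
          fourier_transform f (ln (real n) / ln (real q)) * (\<psi> n + cnj (\<psi> n)))"

definition character_average :: "nat \<Rightarrow> ((nat \<Rightarrow> complex) \<Rightarrow> complex) \<Rightarrow> complex" where
  "character_average q X =
     1 / (of_nat q - 2) * (\<Sum>\<psi>\<in>dirichlet_characters q - {trivial_character q}. X \<psi>)"

(* The Fourier transform of an even real function is real, see fourier_transform_even_real
   below, so taking the real part here loses nothing. *)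
definition sigma_osc :: "(real \<Rightarrow> real) \<Rightarrow> real" where
  "sigma_osc f = sqrt (LINT u:{-1..1}|lebesgue. \<bar>u\<bar> * (Re (fourier_transform f u))\<^sup>2)"

lemma fourier_transform_even_real:
  assumes "\<And>x. f (- x) = f x"
  shows "fourier_transform f u \<in> \<real>"
proof -
  let ?g = "\<lambda>x. complex_of_real (f x) * exp (- 2 * of_real pi * \<i> * of_real x * of_real u)"
  have "cnj (fourier_transform f u) = (LINT x|lebesgue. cnj (?g x))"
    unfolding fourier_transform_def by (rule Bochner_Integration.integral_cnj [symmetric])
  also have "\<dots> = (LINT x|lebesgue. ?g (0 + (-1) * x))"
    by (rule Bochner_Integration.integral_cong) (simp_all add: assms exp_cnj)
  also have "\<dots> = fourier_transform f u"
    using lebesgue_integral_real_affine [of "-1" ?g 0]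
    unfolding fourier_transform_def by simp
  finally show ?thesis
    by (simp add: Reals_cnj_iff)
qed

lemma trivial_character_in: "trivial_character q \<in> dirichlet_characters q"
proof -
  have "coprime (n + q) q \<longleftrightarrow> coprime n q" for n
    by (simp only: coprime_iff_gcd_eq_1 gcd_add1)
  then show ?thesis
    by (simp add: dirichlet_characters_def trivial_character_def)
qed

(* Without finiteness the sum in character_average would be 0 by convention. *)
lemma finite_dirichlet_characters:
  assumes "q > 0"
  shows "finite (dirichlet_characters q)"
proof -
  let ?R = "insert 0 {z::complex. z ^ totient q = 1}"
  have per: "\<psi> (n mod q) = \<psi> n" if "\<psi> \<in> dirichlet_characters q" for \<psi> n
  proof -
    have "\<psi> (r + k * q) = \<psi> r" for r k
    proof (induction k)
      case (Suc k)
      have "\<psi> (r + Suc k * q) = \<psi> ((r + k * q) + q)"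
        by (simp add: algebra_simps)
      with Suc that show ?case
        by (simp only: dirichlet_characters_def mem_Collect_eq)
    qed simp
    from this [of "n mod q" "n div q"] show ?thesis by simp
  qed
  have val: "\<psi> n \<in> ?R" if c: "\<psi> \<in> dirichlet_characters q" for \<psi> n
  proof (cases "coprime n q")
    case True
    have one: "\<psi> 1 = 1"
    proof -
      have "\<psi> (1 * 1) = \<psi> 1 * \<psi> 1" "\<psi> 1 \<noteq> 0"
        using c unfolding dirichlet_characters_def by (blast, simp)
      then show ?thesis by simp
    qed
    have pow: "\<psi> (n ^ k) = \<psi> n ^ k" for k
      using c one by (induction k) (simp_all add: dirichlet_characters_def)
    have "\<psi> (n ^ totient q) = \<psi> 1"
      using euler_theorem [OF True] per [OF c, of "n ^ totient q"] per [OF c, of 1]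
      by (simp add: cong_def)
    then show ?thesis using pow one by simp
  next
    case False
    then show ?thesis using c by (auto simp: dirichlet_characters_def)
  qed
  have "finite ?R"
    using assms by (simp add: finite_roots_unity totient_gt_0_iff Suc_leI)
  then have "finite (PiE {..<q} (\<lambda>_. ?R))"
    by (intro finite_PiE) simp_all
  moreover have "(\<lambda>\<psi>. restrict \<psi> {..<q}) ` dirichlet_characters q \<subseteq> PiE {..<q} (\<lambda>_. ?R)"
    using val by (intro image_subsetI restrict_PiE_iff [THEN iffD2] ballI)
  moreover have "inj_on (\<lambda>\<psi>. restrict \<psi> {..<q}) (dirichlet_characters q)"
  proof (rule inj_onI, rule ext)
    fix \<psi> \<rho> n
    assume c: "\<psi> \<in> dirichlet_characters q" "\<rho> \<in> dirichlet_characters q"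
      and eq: "restrict \<psi> {..<q} = restrict \<rho> {..<q}"
    have "\<psi> (n mod q) = \<rho> (n mod q)"
      using fun_cong [OF eq, of "n mod q"] assms by simp
    then show "\<psi> n = \<rho> n" using per c by metis
  qed
  ultimately show ?thesis
    using finite_imageD finite_subset by blast
qed

end

theory Submission
  imports Defs "HOL-Computational_Algebra.Computational_Algebra" "HOL-Real_Asymp.Real_Asymp"
begin

text \<open>
  The \<open>m\<close>-th power of \<open>W_osc f q \<psi>\<close> is a combination of terms \<open>\<psi> a * cnj (\<psi> b)\<close> with
  \<open>a * b \<le> q powr (m * \<alpha>)\<close>, and averaging over \<open>\<psi>\<close> leaves those with \<open>a\<close> congruent to \<open>b\<close> modulo \<open>q\<close>.
  As \<open>m * \<alpha> < 2\<close>, the terms with \<open>a \<noteq> b\<close> and the contribution of the trivial character are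
  negligible. What remains, the terms with \<open>a = b\<close>, is exactly the \<open>m\<close>-th moment of the statistic
  in which \<open>\<psi> p\<close> is replaced by independent random roots of unity of large order, one for each
  prime \<open>p\<close>. That statistic is a sum of independent centred variables of size \<open>O(1 / ln q)\<close>, so
  its moments converge to Gaussian ones; its variance is computed from Mertens' first theorem.
\<close>

section \<open>Moments of sums of independent variables\<close>

unbundle no vec_syntax

text \<open>The limit could be found by classifying which products of prime powers coincide when
  \<open>a = b\<close>. The random model replaces that bookkeeping: the diagonal form is by itself a
  moment of a sum of independent variables. For this the identification has to be exact, so the
  roots of unity get order \<open>Suc (q\<^sup>2)\<close>, which is larger than any exponent of a
  prime in a number up to \<open>q\<^sup>2\<close>. They then separate exponents as uniform points
  of the circle would, while every expectation remains a finite average. The Gaussian limit becomes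
  a statement about coefficients of formal power series, where convergence of the series is no
  issue. The bound 2 on \<open>m * \<alpha>\<close> comes from two errors of the same size
  \<open>q powr (m * \<alpha> / 2 - 1)\<close> up to logarithms. One is the sum over congruent
  \<open>a \<noteq> b\<close>. The other is the trivial character, where the statistic can be as
  large as about \<open>q powr (\<alpha> / 2)\<close>. The case \<open>m = 1\<close> stands apart:
  \<open>\<alpha>\<close> may then be 1 or more, which puts the second moment out of reach, but the
  diagonal form vanishes identically.\<close>

definition product_mean :: "'p set \<Rightarrow> nat \<Rightarrow> (('p \<Rightarrow> nat) \<Rightarrow> 'a :: real_field) \<Rightarrow> 'a" where
  "product_mean P N g = (\<Sum>\<omega>\<in>PiE P (\<lambda>_. {..<N}). g \<omega>) / of_nat N ^ card P"

lemma product_mean_prod: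
  assumes "finite P"
  shows "product_mean P N (\<lambda>\<omega>. \<Prod>p\<in>P. h p (\<omega> p)) = (\<Prod>p\<in>P. (\<Sum>w<N. h p w) / of_nat N)"
proof -
  have "(\<Prod>p\<in>P. \<Sum>w<N. h p w) = (\<Sum>\<omega>\<in>PiE P (\<lambda>_. {..<N}). \<Prod>p\<in>P. h p (\<omega> p))"
    using assms by (intro prod_sum_PiE) auto
  then show ?thesis
    by (simp add: product_mean_def prod_dividef)
qed

section \<open>Logarithmic derivatives of formal power series\<close>

lemma fps_deriv_prod_logderiv:
  fixes A G :: "'p \<Rightarrow> real fps"
  assumes "finite P" "\<And>p. p \<in> P \<Longrightarrow> fps_deriv (A p) = A p * G p"
  shows "fps_deriv (\<Prod>p\<in>P. A p) = (\<Prod>p\<in>P. A p) * (\<Sum>p\<in>P. G p)"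
  using assms
proof (induction P rule: finite_induct)
  case (insert p P)
  then show ?case by (simp add: algebra_simps)
qed simp

text \<open>This makes the recursion in \<open>fps_logderiv_bound\<close> close with base 3:
  \<open>j + 1\<close> comes from the differentiated coefficient, the geometric sum from the
  convolution.\<close>

lemma sum_powers_of_3_le: "j > 0 \<Longrightarrow> j + 1 + (\<Sum>i<j. 3 ^ i) \<le> (3 :: real) ^ j"
proof (induction j rule: nat_induct_non_zero)
  case (Suc j)
  then have "(3::real) ^ 1 \<le> 3 ^ j" by (intro power_increasing) auto
  with Suc show ?case by auto
qed auto

text \<open>Here \<open>A\<close> stands for the moment generating function of one centred variable
  of size at most \<open>y\<close> and variance \<open>v\<close>, and \<open>G\<close> is the
  derivative of its cumulant generating function. The bound keeps a factor \<open>v\<close> because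
  it will be summed over many variables: the variances add up to a bounded total, and the remaining
  power of \<open>y\<close> tends to 0. A bound in \<open>y\<close> alone would not survive that
  sum.\<close>

lemma fps_logderiv_bound:
  fixes A G :: "real fps"
  assumes A: "A $ 0 = 1" "A $ 1 = 0" "\<And>j. j \<ge> 2 \<Longrightarrow> \<bar>A $ j\<bar> \<le> v * y ^ (j - 2)"
    and G: "fps_deriv A = A * G"
    and vy: "0 \<le> v" "v \<le> y\<^sup>2" "0 \<le> y"
  shows "G $ 0 = 0" "G $ 1 = 2 * A $ 2" "j \<ge> 1 \<Longrightarrow> \<bar>G $ j\<bar> \<le> 3 ^ j * v * y ^ (j - 1)"
proof -
  have rec: "real (j + 1) * A $ (j + 1) = (\<Sum>i=0..j. A $ i * G $ (j - i))" for j
    using arg_cong[OF G, of "\<lambda>F. F $ j"] by (simp add: fps_mult_nth)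
  show G0: "G $ 0 = 0"
    using rec[of 0] A by simp
  show G1: "G $ 1 = 2 * A $ 2"
    using rec[of 1] A G0 by (simp add: numeral_2_eq_2)
  \<comment> \<open>In the convolution, \<open>i = 1\<close> drops out since
    \<open>A $ 1 = 0\<close>, and \<open>i = j\<close> since \<open>G $ 0 = 0\<close>; the term
    \<open>i = 0\<close> is the coefficient to be solved for.\<close>
  have Grec: "G $ j = real (j + 1) * A $ (j + 1) - (\<Sum>i\<in>{2..<j}. A $ i * G $ (j - i))" if "j \<ge> 1" for j
  proof -
    have "(\<Sum>i=0..j. A $ i * G $ (j - i)) = (\<Sum>i\<in>insert 0 {2..<j}. A $ i * G $ (j - i))"
    proof (rule sum.mono_neutral_right)
      show "\<forall>i\<in>{0..j} - insert 0 {2..<j}. A $ i * G $ (j - i) = 0"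
      proof
        fix i assume "i \<in> {0..j} - insert 0 {2..<j}"
        then have "i = 1 \<or> i = j" by auto
        then show "A $ i * G $ (j - i) = 0" using A G0 by auto
      qed
    qed (use that in auto)
    also have "\<dots> = G $ j + (\<Sum>i\<in>{2..<j}. A $ i * G $ (j - i))"
      using A by simp
    finally show ?thesis using rec[of j] by simp
  qed
  show "j \<ge> 1 \<Longrightarrow> \<bar>G $ j\<bar> \<le> 3 ^ j * v * y ^ (j - 1)"
  proof (induction j rule: less_induct)
    case (less j)
    have t1: "\<bar>real (j + 1) * A $ (j + 1)\<bar> \<le> real (j + 1) * (v * y ^ (j - 1))"
      using A(3)[of "j + 1"] less.prems by (simp add: abs_mult mult_left_mono)
    have t2: "\<bar>A $ i * G $ (j - i)\<bar> \<le> 3 ^ (j - i) * (v * y ^ (j - 1))" if i: "i \<in> {2..<j}" for i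
    proof -
      have "\<bar>A $ i * G $ (j - i)\<bar> \<le> (v * y ^ (i - 2)) * (3 ^ (j - i) * v * y ^ (j - i - 1))"
        unfolding abs_mult using i vy by (intro mult_mono A(3) less.IH) auto
      also have "\<dots> = 3 ^ (j - i) * v * y ^ (i - 2 + (j - i - 1)) * v"
        by (simp add: power_add)
      \<comment> \<open>One of the two factors \<open>v\<close> is traded for
        \<open>y\<^sup>2\<close>: the bound stays linear in \<open>v\<close> and the exponent of
        \<open>y\<close> becomes \<open>j - 1\<close>.\<close>
      also have "\<dots> \<le> 3 ^ (j - i) * v * y ^ (i - 2 + (j - i - 1)) * y\<^sup>2"
        using vy by (intro mult_left_mono) auto
      also have "\<dots> = 3 ^ (j - i) * v * y ^ (i - 2 + (j - i - 1) + 2)"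
        by (simp only: power_add mult.assoc)
      also have "i - 2 + (j - i - 1) + 2 = j - 1" using i by auto
      finally show ?thesis by simp
    qed
    have "\<bar>G $ j\<bar> \<le> \<bar>real (j + 1) * A $ (j + 1)\<bar> + \<bar>\<Sum>i\<in>{2..<j}. A $ i * G $ (j - i)\<bar>"
      using Grec[OF less.prems] by simp
    also have "\<dots> \<le> real (j + 1) * (v * y ^ (j - 1)) + (\<Sum>i\<in>{2..<j}. 3 ^ (j - i) * (v * y ^ (j - 1)))"
      by (intro add_mono t1 order_trans[OF sum_abs] sum_mono t2)
    also have "\<dots> = (real (j + 1) + (\<Sum>i\<in>{2..<j}. 3 ^ (j - i))) * (v * y ^ (j - 1))"
      by (simp add: algebra_simps sum_distrib_left)
    also have "(\<Sum>i\<in>{2..<j}. 3 ^ (j - i)) = (\<Sum>i\<in>{1..<j - 1}. (3::real) ^ i)"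
      by (rule sum.reindex_bij_witness[of _ "\<lambda>i. j - i" "\<lambda>i. j - i"]) auto
    also have "(real (j + 1) + (\<Sum>i\<in>{1..<j - 1}. 3 ^ i)) * (v * y ^ (j - 1)) \<le> 3 ^ j * (v * y ^ (j - 1))"
    proof (rule mult_right_mono)
      have "(\<Sum>i\<in>{1..<j - 1}. (3::real) ^ i) \<le> (\<Sum>i<j. 3 ^ i)"
        by (rule sum_mono2) auto
      then show "real (j + 1) + (\<Sum>i\<in>{1..<j - 1}. 3 ^ i) \<le> 3 ^ j"
        using sum_powers_of_3_le[of j] less.prems
        by (cases "j = 1") auto
    qed (use vy in auto)
    finally show ?case by (simp add: mult.assoc)
  qed
qed

text \<open>Comparing coefficients in the differential equation expresses
  \<open>\<Phi> q $ Suc k\<close> through earlier coefficients and those of \<open>L q\<close>. In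
  the limit only the linear coefficient of \<open>L q\<close> is left, and the recursion becomes
  that of \<open>exp (s * x\<^sup>2 / 2)\<close>.\<close>

lemma fps_nth_tendsto_gaussian:
  fixes \<Phi> L :: "'q \<Rightarrow> real fps"
  assumes ev: "eventually (\<lambda>q. fps_deriv (\<Phi> q) = \<Phi> q * L q \<and> \<Phi> q $ 0 = 1) F"
    and L: "\<And>j. ((\<lambda>q. L q $ j) \<longlongrightarrow> (if j = 1 then s else 0)) F"
  shows "((\<lambda>q. \<Phi> q $ n) \<longlongrightarrow> (if even n then (s / 2) ^ (n div 2) / fact (n div 2) else 0)) F"
proof (induction n rule: less_induct)
  case (less n)
  define e :: "nat \<Rightarrow> real" where "e n = (if even n then (s / 2) ^ (n div 2) / fact (n div 2) else 0)" for n
  have IH: "((\<lambda>q. \<Phi> q $ i) \<longlongrightarrow> e i) F" if "i < n" for i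
    using less.IH[OF that] by (simp add: e_def)
  show ?case unfolding e_def[symmetric]
  proof (cases n)
    case 0
    have "eventually (\<lambda>q. 1 = \<Phi> q $ 0) F" using ev by eventually_elim auto
    then show "((\<lambda>q. \<Phi> q $ n) \<longlongrightarrow> e n) F"
      unfolding 0 by (rule Lim_transform_eventually[rotated]) (simp add: e_def)
  next
    case (Suc k)
    have "((\<lambda>q. (\<Sum>i=0..k. \<Phi> q $ i * L q $ (k - i)) / real (k + 1)) \<longlongrightarrow>
             (\<Sum>i=0..k. e i * (if k - i = 1 then s else 0)) / real (k + 1)) F"
      by (intro tendsto_intros IH L) (use Suc in auto)
    also have "(\<Sum>i=0..k. e i * (if k - i = 1 then s else 0)) / real (k + 1) = e n"
    proof (cases k)
      case 0
      then show ?thesis by (simp add: e_def Suc)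
    next
      case (Suc l)
      have "(\<Sum>i=0..k. e i * (if k - i = 1 then s else 0)) = (\<Sum>i=0..k. if i = l then e l * s else 0)"
        by (intro sum.cong) (auto simp: Suc)
      also have "\<dots> = e l * s" by (simp add: Suc)
      finally have *: "(\<Sum>i=0..k. e i * (if k - i = 1 then s else 0)) = e l * s" .
      have "e l * s = e n * real (k + 1)"
      proof (cases "even l")
        case True
        then obtain b where "l = 2 * b" by (rule evenE)
        then show ?thesis using \<open>n = Suc k\<close> Suc
          by (simp add: e_def divide_simps)
      qed (use \<open>n = Suc k\<close> Suc in \<open>simp add: e_def\<close>)
      then show ?thesis unfolding * by simp
    qed
    finally have "((\<lambda>q. (\<Sum>i=0..k. \<Phi> q $ i * L q $ (k - i)) / real (k + 1)) \<longlongrightarrow> e n) F" .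
    moreover have "eventually (\<lambda>q. (\<Sum>i=0..k. \<Phi> q $ i * L q $ (k - i)) / real (k + 1) = \<Phi> q $ n) F"
      using ev
    proof eventually_elim
      case (elim q)
      then have "fps_deriv (\<Phi> q) $ k = (\<Phi> q * L q) $ k" by simp
      then have "real (k + 1) * \<Phi> q $ n = (\<Sum>i=0..k. \<Phi> q $ i * L q $ (k - i))"
        by (simp only: fps_mult_nth fps_deriv_nth Suc Suc_eq_plus1)
      then show ?case by (metis nonzero_mult_div_cancel_left of_nat_0_neq add_is_0 one_neq_zero of_nat_eq_0_iff)
    qed
    ultimately show "((\<lambda>q. \<Phi> q $ n) \<longlongrightarrow> e n) F"
      by (rule Lim_transform_eventually)
  qed
qed

lemma fps_exp_sum: "finite P \<Longrightarrow> fps_exp (\<Sum>p\<in>P. f p :: real) = (\<Prod>p\<in>P. fps_exp (f p))"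
  by (induction P rule: finite_induct) (auto simp: fps_exp_add_mult)

text \<open>Independence in generating function form: expanding the product over \<open>P\<close> of
  local averages yields the average over all \<open>\<omega>\<close> of a single
  exponential.\<close>

lemma fps_prod_mean_exp:
  fixes Y :: "'p \<Rightarrow> nat \<Rightarrow> real"
  assumes "finite P"
  shows "(\<Prod>p\<in>P. fps_const (1 / real N) * (\<Sum>w<N. fps_exp (Y p w))) $ n =
           product_mean P N (\<lambda>\<omega>. (\<Sum>p\<in>P. Y p (\<omega> p)) ^ n) / fact n"
proof -
  have "(\<Prod>p\<in>P. fps_const (1 / real N) * (\<Sum>w<N. fps_exp (Y p w))) =
          fps_const ((1 / real N) ^ card P) * (\<Prod>p\<in>P. \<Sum>w<N. fps_exp (Y p w))"
    by (simp add: prod.distrib fps_const_power)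
  also have "(\<Prod>p\<in>P. \<Sum>w<N. fps_exp (Y p w)) = (\<Sum>\<omega>\<in>PiE P (\<lambda>_. {..<N}). fps_exp (\<Sum>p\<in>P. Y p (\<omega> p)))"
    using assms by (subst prod_sum_PiE) (auto simp: fps_exp_sum)
  finally show ?thesis
    by (simp add: fps_sum_nth product_mean_def sum_divide_distrib field_simps)
qed

text \<open>The generating function of the moments of a sum of independent variables is a product; its
  logarithmic derivative is a sum, in which only the linear term survives in the limit.\<close>

lemma moments_tendsto_gaussian:
  fixes Y :: "'q \<Rightarrow> 'p \<Rightarrow> nat \<Rightarrow> real" and P :: "'q \<Rightarrow> 'p set"
  assumes ev: "eventually (\<lambda>q. finite (P q) \<and> N q > 0 \<and> 
      (\<forall>p\<in>P q. (\<forall>w<N q. \<bar>Y q p w\<bar> \<le> y q) \<and> (\<Sum>w<N q. Y q p w) = 0)) F"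
    and y: "(y \<longlongrightarrow> 0) F"
    and s: "((\<lambda>q. product_mean (P q) (N q) (\<lambda>\<omega>. (\<Sum>p\<in>P q. Y q p (\<omega> p))\<^sup>2)) \<longlongrightarrow> s) F"
  shows "((\<lambda>q. product_mean (P q) (N q) (\<lambda>\<omega>. (\<Sum>p\<in>P q. Y q p (\<omega> p)) ^ m)) \<longlongrightarrow>
           (if even m then fact m / (2 ^ (m div 2) * fact (m div 2)) * s ^ (m div 2) else 0)) F"
proof -
  \<comment> \<open>\<open>A q p\<close> generates the moments of one variable divided by
    factorials, and \<open>G q p\<close> is its logarithmic derivative; \<open>\<Phi> q\<close> and
    \<open>L q\<close> are the same two series for the whole sum.\<close>
  define A where "A q p = fps_const (1 / real (N q)) * (\<Sum>w<N q. fps_exp (Y q p w))" for q p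
  define G where "G q p = fps_deriv (A q p) * inverse (A q p)" for q p
  define \<Phi> where "\<Phi> q = (\<Prod>p\<in>P q. A q p)" for q
  define L where "L q = (\<Sum>p\<in>P q. G q p)" for q
  define v where "v q p = (\<Sum>w<N q. (Y q p w)\<^sup>2) / N q" for q p
  define V where "V q = product_mean (P q) (N q) (\<lambda>\<omega>. (\<Sum>p\<in>P q. Y q p (\<omega> p))\<^sup>2)" for q
  have nth: "\<Phi> q $ n = product_mean (P q) (N q) (\<lambda>\<omega>. (\<Sum>p\<in>P q. Y q p (\<omega> p)) ^ n) / fact n"
    if "finite (P q)" for q n
    unfolding \<Phi>_def A_def by (rule fps_prod_mean_exp[OF that])
  have key: "eventually (\<lambda>q. fps_deriv (\<Phi> q) = \<Phi> q * L q \<and> \<Phi> q $ 0 = 1 \<and> L q $ 0 = 0 \<and> L q $ 1 = V q \<and>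
      (\<forall>j\<ge>2. \<bar>L q $ j\<bar> \<le> 3 ^ j * V q * \<bar>y q\<bar> ^ (j - 1))) F"
    using ev
  proof eventually_elim
    case (elim q)
    then have fin: "finite (P q)" and N: "N q > 0" by auto
    note bd = elim[THEN conjunct2, THEN conjunct2, rule_format]
    have Anth: "A q p $ j = (\<Sum>w<N q. Y q p w ^ j) / (real (N q) * fact j)" for p j
      by (simp add: A_def fps_sum_nth sum_divide_distrib mult.commute)
    have A0: "A q p $ 0 = 1" for p using N by (simp add: Anth)
    have A1: "A q p $ 1 = 0" if "p \<in> P q" for p using bd[OF that] by (simp add: Anth)
    have A2: "A q p $ 2 = v q p / 2" for p by (simp add: Anth v_def)
    have v0: "0 \<le> v q p" for p by (auto simp: v_def intro!: sum_nonneg divide_nonneg_nonneg)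
    have vy: "v q p \<le> \<bar>y q\<bar>\<^sup>2" if "p \<in> P q" for p
    proof -
      have "(\<Sum>w<N q. (Y q p w)\<^sup>2) \<le> (\<Sum>w<N q. \<bar>y q\<bar>\<^sup>2)"
        using bd[OF that] by (intro sum_mono) (auto simp: abs_le_square_iff[symmetric])
      then show ?thesis using N by (simp add: v_def field_simps)
    qed
    have Aj: "\<bar>A q p $ j\<bar> \<le> v q p * \<bar>y q\<bar> ^ (j - 2)" if p: "p \<in> P q" and j: "j \<ge> 2" for p j
    proof -
      have "\<bar>\<Sum>w<N q. Y q p w ^ j\<bar> \<le> (\<Sum>w<N q. (Y q p w)\<^sup>2 * \<bar>y q\<bar> ^ (j - 2))"
      proof (intro order_trans[OF sum_abs] sum_mono)
        fix w assume "w \<in> {..<N q}"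
        then have "\<bar>Y q p w\<bar> \<le> \<bar>y q\<bar>" using bd[OF p] by force
        then have "\<bar>Y q p w\<bar> ^ 2 * \<bar>Y q p w\<bar> ^ (j - 2) \<le> \<bar>Y q p w\<bar> ^ 2 * \<bar>y q\<bar> ^ (j - 2)"
          by (intro mult_left_mono power_mono) auto
        moreover have "\<bar>Y q p w\<bar> ^ 2 * \<bar>Y q p w\<bar> ^ (j - 2) = \<bar>Y q p w ^ j\<bar>"
          using j by (simp only: power_add[symmetric] power_abs le_add_diff_inverse)
        ultimately show "\<bar>Y q p w ^ j\<bar> \<le> (Y q p w)\<^sup>2 * \<bar>y q\<bar> ^ (j - 2)" by simp
      qed
      also have "\<dots> = v q p * \<bar>y q\<bar> ^ (j - 2) * N q"
        using N by (simp add: v_def sum_distrib_right[symmetric])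
      finally have "\<bar>\<Sum>w<N q. Y q p w ^ j\<bar> / N q \<le> v q p * \<bar>y q\<bar> ^ (j - 2)"
        using N by (simp add: field_simps)
      moreover have "\<bar>A q p $ j\<bar> \<le> \<bar>\<Sum>w<N q. Y q p w ^ j\<bar> / N q"
        using N mult_right_mono[of 1 "fact j" "\<bar>\<Sum>w<N q. Y q p w ^ j\<bar>"]
        by (simp add: Anth abs_mult field_simps)
      ultimately show ?thesis by linarith
    qed
    have dA: "fps_deriv (A q p) = A q p * G q p" for p
    proof -
      have "A q p * G q p = fps_deriv (A q p) * (inverse (A q p) * A q p)" by (simp add: G_def mult_ac)
      also have "inverse (A q p) * A q p = 1" by (rule inverse_mult_eq_1) (simp add: A0)
      finally show ?thesis by simp
    qed
    note G = fps_logderiv_bound[OF A0 A1 Aj dA v0 vy abs_ge_zero]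
    have d\<Phi>: "fps_deriv (\<Phi> q) = \<Phi> q * L q"
      unfolding \<Phi>_def L_def by (rule fps_deriv_prod_logderiv[OF fin dA])
    have \<Phi>0: "\<Phi> q $ 0 = 1" 
      using fin by (simp add: \<Phi>_def fps_prod_nth' A0)
    have L0: "L q $ 0 = 0" using G(1) by (simp add: L_def fps_sum_nth)
    have L1: "L q $ 1 = (\<Sum>p\<in>P q. v q p)" using G(2) by (simp add: L_def fps_sum_nth A2)
    \<comment> \<open>Comparing coefficients identifies the sum of the local variances with the
      second moment of the whole sum. Thus the limit of the second moment is the only information on
      the variances that has to be supplied.\<close>
    have "fps_deriv (\<Phi> q) $ 1 = (\<Phi> q * L q) $ 1" "fps_deriv (\<Phi> q) $ 0 = (\<Phi> q * L q) $ 0" using d\<Phi> by simp_all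
    then have "L q $ 1 = V q"
      using nth[OF fin, of 2] L0 \<Phi>0 by (simp add: fps_mult_nth V_def numeral_2_eq_2)
    moreover have "\<bar>L q $ j\<bar> \<le> 3 ^ j * (\<Sum>p\<in>P q. v q p) * \<bar>y q\<bar> ^ (j - 1)" if "j \<ge> 2" for j
    proof -
      have "\<bar>L q $ j\<bar> \<le> (\<Sum>p\<in>P q. 3 ^ j * v q p * \<bar>y q\<bar> ^ (j - 1))"
        unfolding L_def fps_sum_nth using that by (intro order_trans[OF sum_abs] sum_mono G(3)) auto
      then show ?thesis by (simp add: sum_distrib_left sum_distrib_right)
    qed
    ultimately show ?case using d\<Phi> \<Phi>0 L0 L1 by simp
  qed
  have "((\<lambda>q. \<Phi> q $ m) \<longlongrightarrow> (if even m then (s / 2) ^ (m div 2) / fact (m div 2) else 0)) F"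
  proof (rule fps_nth_tendsto_gaussian)
    show "eventually (\<lambda>q. fps_deriv (\<Phi> q) = \<Phi> q * L q \<and> \<Phi> q $ 0 = 1) F"
      using key by eventually_elim auto
    fix j :: nat
    consider "j = 0" | "j = 1" | "j \<ge> 2" by linarith
    then show "((\<lambda>q. L q $ j) \<longlongrightarrow> (if j = 1 then s else 0)) F"
    proof cases
      case 1
      have "eventually (\<lambda>q. L q $ j = 0) F" using key by eventually_elim (auto simp: 1)
      then have "((\<lambda>q. L q $ j) \<longlongrightarrow> 0) F" by (rule tendsto_eventually)
      then show ?thesis using 1 by simp
    next
      case 2
      have "eventually (\<lambda>q. V q = L q $ j) F" using key by eventually_elim (auto simp: 2)
      with s[folded V_def] have "((\<lambda>q. L q $ j) \<longlongrightarrow> s) F" by (rule Lim_transform_eventually)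
      then show ?thesis using 2 by simp
    next
      case 3
      have "((\<lambda>q. 3 ^ j * V q * \<bar>y q\<bar> ^ (j - 1)) \<longlongrightarrow> 3 ^ j * s * \<bar>0\<bar> ^ (j - 1)) F"
        by (intro tendsto_intros y s[folded V_def])
      then have lim: "((\<lambda>q. 3 ^ j * V q * \<bar>y q\<bar> ^ (j - 1)) \<longlongrightarrow> 0) F" using 3 by (simp add: power_0_left)
      have "((\<lambda>q. L q $ j) \<longlongrightarrow> 0) F"
      proof (rule Lim_null_comparison[OF _ lim])
        show "eventually (\<lambda>q. norm (L q $ j) \<le> 3 ^ j * V q * \<bar>y q\<bar> ^ (j - 1)) F"
          using key by eventually_elim (use 3 in auto)
      qed
      then show ?thesis using 3 by simp
    qed
  qed
  then have "((\<lambda>q. \<Phi> q $ m * fact m) \<longlongrightarrow> (if even m then (s / 2) ^ (m div 2) / fact (m div 2) else 0) * fact m) F"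
    by (intro tendsto_intros)
  also have "(if even m then (s / 2) ^ (m div 2) / fact (m div 2) else 0) * fact m = 
      (if even m then fact m / (2 ^ (m div 2) * fact (m div 2)) * s ^ (m div 2) else 0)"
    by (simp add: power_divide)
  finally show ?thesis
  proof (rule Lim_transform_eventually)
    show "eventually (\<lambda>q. \<Phi> q $ m * fact m = product_mean (P q) (N q) (\<lambda>\<omega>. (\<Sum>p\<in>P q. Y q p (\<omega> p)) ^ m)) F"
      using ev by eventually_elim (simp add: nth)
  qed
qed

section \<open>Roots of unity\<close>

definition unity_root :: "nat \<Rightarrow> nat \<Rightarrow> complex" where
  "unity_root N k = cis (2 * pi * real k / real N)"

lemma norm_unity_root [simp]: "norm (unity_root N k) = 1"
  by (simp add: unity_root_def)

lemma bij_betw_unity_root: "N > 0 \<Longrightarrow> bij_betw (unity_root N) {..<N} {z. z ^ N = 1}"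
  unfolding unity_root_def by (rule Complex.bij_betw_roots_unity)

text \<open>The symmetry in \<open>k\<close> and \<open>i\<close> turns a sum over the base of a
  power into a geometric sum with fixed ratio.\<close>

lemma unity_root_power_swap: "unity_root N k ^ i = unity_root N i ^ k"
  unfolding unity_root_def Complex.DeMoivre by (simp add: mult_ac)

lemma sum_unity_root_orthogonal:
  assumes "i < N" "j < N"
  shows "(\<Sum>k<N. unity_root N k ^ i * cnj (unity_root N k ^ j)) = (if i = j then of_nat N else 0)"
proof -
  define w where "w = unity_root N i * cnj (unity_root N j)"
  have N: "N > 0" using assms by simp
  have nj: "unity_root N j * cnj (unity_root N j) = 1"
    by (simp add: complex_norm_square[symmetric])
  have "(\<Sum>k<N. unity_root N k ^ i * cnj (unity_root N k ^ j)) = (\<Sum>k<N. w ^ k)"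
    by (simp add: w_def unity_root_power_swap[of N _ i] unity_root_power_swap[of N _ j] power_mult_distrib)
  also have "\<dots> = (if i = j then of_nat N else 0)"
  proof (cases "i = j")
    case True
    then show ?thesis using nj by (simp add: w_def)
  next
    case False
    have "w \<noteq> 1"
    proof
      assume "w = 1"
      then have "unity_root N i * (cnj (unity_root N j) * unity_root N j) = unity_root N j"
        by (simp add: w_def)
      then have "unity_root N i = unity_root N j" using nj by (simp add: mult.commute)
      then show False
        using bij_betw_unity_root[OF N] False assms by (auto simp: bij_betw_def inj_on_def)
    qed
    moreover have "w ^ N = 1"
    proof -
      have "unity_root N l ^ N = 1" if "l < N" for l
        using bij_betw_unity_root[OF N] that unfolding bij_betw_def by blast
      then have "unity_root N i ^ N = 1" "cnj (unity_root N j ^ N) = 1" using assms by simp_all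
      then show ?thesis unfolding w_def power_mult_distrib complex_cnj_power by simp
    qed
    ultimately show ?thesis using False by (simp add: geometric_sum)
  qed
  finally show ?thesis .
qed

lemma sum_unity_root: "0 < i \<Longrightarrow> i < N \<Longrightarrow> (\<Sum>k<N. unity_root N k ^ i) = 0"
  using sum_unity_root_orthogonal[of i N 0] by simp

section \<open>A random model for the characters\<close>

text \<open>On positive integers this is the completely multiplicative function that sends
  \<open>p\<close> in \<open>P\<close> to an independent uniform root of unity and all other primes
  to 1: a Steinhaus random function with the circle replaced by the roots of unity of order
  \<open>N\<close>.\<close>

definition random_character :: "nat set \<Rightarrow> nat \<Rightarrow> (nat \<Rightarrow> nat) \<Rightarrow> nat \<Rightarrow> complex" where
  "random_character P N \<omega> n = (\<Prod>p\<in>P. unity_root N (\<omega> p) ^ multiplicity p n)"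

lemma random_character_mult:
  assumes "\<And>p. p \<in> P \<Longrightarrow> prime p" "a > 0" "b > 0"
  shows "random_character P N \<omega> (a * b) = random_character P N \<omega> a * random_character P N \<omega> b"
  using assms by (simp add: random_character_def prod.distrib[symmetric] power_add[symmetric]
      prime_elem_multiplicity_mult_distrib)

lemma random_character_1 [simp]: "random_character P N \<omega> (Suc 0) = 1"
  by (simp add: random_character_def)

lemma random_character_prime_power:
  assumes "finite P" "\<And>p. p \<in> P \<Longrightarrow> prime p" "p \<in> P"
  shows "random_character P N \<omega> (p ^ k) = unity_root N (\<omega> p) ^ k"
proof -
  have "random_character P N \<omega> (p ^ k) = (\<Prod>r\<in>P. if r = p then unity_root N (\<omega> p) ^ k else 1)"
    unfolding random_character_def using assms
    by (intro prod.cong) (auto simp: multiplicity_prime_power multiplicity_distinct_prime_power)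
  then show ?thesis using assms by simp
qed

lemma multiplicity_less_self:
  assumes "prime (p :: nat)" "n > 0"
  shows "multiplicity p n < n"
proof -
  have "multiplicity p n < 2 ^ multiplicity p n" by simp
  also have "\<dots> \<le> p ^ multiplicity p n"
    using assms by (intro power_mono) (auto dest: prime_ge_2_nat)
  also have "\<dots> \<le> n"
    using assms by (intro dvd_imp_le multiplicity_dvd) auto
  finally show ?thesis .
qed

text \<open>By independence the mean factors over \<open>P\<close>. The hypotheses
  \<open>a \<le> N\<close> and \<open>b \<le> N\<close> force all exponents below \<open>N\<close>,
  so the roots of unity detect equality of exponents and not merely congruence modulo
  \<open>N\<close>; unique factorisation does the rest.\<close>

lemma random_character_orthogonal:
  assumes "finite P" "\<And>p. p \<in> P \<Longrightarrow> prime p" "0 < a" "0 < b" "a \<le> N" "b \<le> N"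
    and "prime_factors a \<subseteq> P" "prime_factors b \<subseteq> P"
  shows "product_mean P N (\<lambda>\<omega>. random_character P N \<omega> a * cnj (random_character P N \<omega> b)) = (if a = b then 1 else 0)"
proof -
  have "product_mean P N (\<lambda>\<omega>. random_character P N \<omega> a * cnj (random_character P N \<omega> b)) = 
    product_mean P N (\<lambda>\<omega>. \<Prod>p\<in>P. unity_root N (\<omega> p) ^ multiplicity p a * cnj (unity_root N (\<omega> p) ^ multiplicity p b))"
    by (simp add: random_character_def prod.distrib)
  also have "\<dots> = (\<Prod>p\<in>P. (\<Sum>w<N. unity_root N w ^ multiplicity p a * cnj (unity_root N w ^ multiplicity p b)) / of_nat N)"
    by (rule product_mean_prod[OF assms(1)])
  also have "\<dots> = (\<Prod>p\<in>P. if multiplicity p a = multiplicity p b then 1 else 0)"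
  proof (rule prod.cong)
    fix p assume "p \<in> P"
    then have "prime p" by (rule assms(2))
    have lt: "multiplicity p a < N" "multiplicity p b < N"
      using multiplicity_less_self[OF \<open>prime p\<close> assms(3)] multiplicity_less_self[OF \<open>prime p\<close> assms(4)]
        assms(5,6) by linarith+
    show "(\<Sum>w<N. unity_root N w ^ multiplicity p a * cnj (unity_root N w ^ multiplicity p b)) / of_nat N
        = (if multiplicity p a = multiplicity p b then 1 else 0)"
      unfolding sum_unity_root_orthogonal[OF lt] using lt by auto
  qed simp
  also have "\<dots> = (if a = b then 1 else 0)"
  proof (cases "\<forall>p\<in>P. multiplicity p a = multiplicity p b")
    case True
    have "multiplicity p a = multiplicity p b" if "prime p" for p
    proof (cases "p \<in> P")
      case False
      then have "p \<notin> prime_factors a" "p \<notin> prime_factors b" using assms(7,8) by blast+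
      then show ?thesis using that by (simp add: prime_factors_multiplicity)
    qed (use True in auto)
    then have "a = b" by (rule multiplicity_eq_nat[OF assms(3,4)])
    then show ?thesis by simp
  next
    case False
    then have "(\<Prod>p\<in>P. if multiplicity p a = multiplicity p b then 1 else 0 :: complex) = 0"
      using assms(1) by (intro prod_zero) auto
    moreover have "a \<noteq> b" using False by auto
    ultimately show ?thesis by simp
  qed
  finally show ?thesis .
qed

section \<open>Orthogonality of Dirichlet characters\<close>

lemma dirichlet_character_mult: "\<psi> \<in> dirichlet_characters q \<Longrightarrow> \<psi> (a * b) = \<psi> a * \<psi> b"
  by (simp add: dirichlet_characters_def)

lemma dirichlet_character_eq_0_iff: "\<psi> \<in> dirichlet_characters q \<Longrightarrow> \<psi> n = 0 \<longleftrightarrow> \<not> coprime n q"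
  by (auto simp: dirichlet_characters_def)

lemma dirichlet_character_1: "\<psi> \<in> dirichlet_characters q \<Longrightarrow> \<psi> (Suc 0) = 1"
  using dirichlet_character_mult[of \<psi> q 1 1] dirichlet_character_eq_0_iff[of \<psi> q 1] by simp

lemma dirichlet_character_power: "\<psi> \<in> dirichlet_characters q \<Longrightarrow> \<psi> (a ^ k) = \<psi> a ^ k"
  by (induction k) (auto simp: dirichlet_character_1 dirichlet_character_mult)

lemma dirichlet_character_cong:
  assumes "\<psi> \<in> dirichlet_characters q" "[a = b] (mod q)"
  shows "\<psi> a = \<psi> b"
proof -
  have "\<psi> (r + k * q) = \<psi> r" for r k
  proof (induction k)
    case (Suc k)
    have "\<psi> (r + Suc k * q) = \<psi> ((r + k * q) + q)"
      by (simp add: algebra_simps)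
    with Suc assms(1) show ?case
      by (simp only: dirichlet_characters_def mem_Collect_eq)
  qed simp
  from this[of "a mod q" "a div q"] this[of "b mod q" "b div q"] show ?thesis
    using assms(2) by (simp add: cong_def)
qed

text \<open>With a primitive root \<open>g\<close> and its discrete logarithm \<open>ind\<close>,
  the map taking a character to its value at \<open>g\<close> is a bijection onto the roots of unity
  of order \<open>q - 1\<close>, with inverse \<open>\<rho>\<close>. The sum over characters is
  thereby a sum over roots of unity, and no separate count of the characters is required.\<close>

lemma sum_dirichlet_characters:
  assumes q: "prime q"
  shows "(\<Sum>\<psi>\<in>dirichlet_characters q. \<psi> a * cnj (\<psi> b)) =
           (if coprime a q \<and> [a = b] (mod q) then of_nat (q - 1) else 0)"
proof -
  have q1: "q > 1" using q prime_gt_1_nat by blast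
  obtain g where g: "residue_primroot q g" using prime_primitive_root_exists[OF q1 q] by auto
  have tot: "totient q = q - 1" using q by (rule totient_prime)
  have cg: "coprime q g" and og: "ord q g = q - 1" using g tot by (auto simp: residue_primroot_def)
  have q0: "q - 1 > 0" using q1 by simp
  have geq: "[g ^ i = g ^ j] (mod q) \<longleftrightarrow> [i = j] (mod (q - 1))" for i j
    using order_divides_expdiff[OF cg] og by simp
  have "\<exists>i<q-1. [n = g ^ i] (mod q)" if "coprime n q" for n
  proof -
    have "n mod q \<in> totatives q"
    proof -
      have cop: "coprime (n mod q) q" using that q1 by simp
      have "n mod q > 0"
      proof (rule Nat.gr0I)
        assume "n mod q = 0"
        then show False using cop q1 by simp
      qed
      then show ?thesis using cop q1 by (simp add: totatives_def less_imp_le)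
    qed
    then have "n mod q \<in> (\<lambda>i. g ^ i mod q) ` {..<q-1}"
      using residue_primroot_is_generator[OF q1 g] tot by (simp add: bij_betw_def)
    then show ?thesis by (auto simp: cong_def)
  qed
  then obtain ind where ind: "\<And>n. coprime n q \<Longrightarrow> ind n < q - 1 \<and> [n = g ^ ind n] (mod q)" by metis
  have indcong: "[ind n = i] (mod (q - 1))" if "coprime n q" "[n = g ^ i] (mod q)" for n i
  proof -
    have "[g ^ ind n = n] (mod q)" using ind[OF that(1)] by (simp add: cong_sym)
    then have "[g ^ ind n = g ^ i] (mod q)" using that(2) by (rule cong_trans)
    then show ?thesis using geq by simp
  qed
  have coc: "coprime n q \<longleftrightarrow> coprime m q" if "[n = m] (mod q)" for n m
    using cong_imp_coprime[OF that] cong_imp_coprime[OF cong_sym[OF that]] by auto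
  define \<rho> where "\<rho> z n = (if coprime n q then z ^ ind n else 0)" for z :: complex and n
  have zpow: "z ^ i = z ^ j" if "z ^ (q - 1) = 1" "[i = j] (mod (q - 1))" for z :: complex and i j
  proof -
    have *: "z ^ i = z ^ (i mod (q - 1))" for i
    proof -
      have "z ^ i = z ^ ((q - 1) * (i div (q - 1)) + i mod (q - 1))" by simp
      also have "\<dots> = z ^ (i mod (q - 1))" unfolding power_add power_mult that(1) by simp
      finally show ?thesis .
    qed
    show ?thesis using that(2) *[of i] *[of j] unfolding cong_def by simp
  qed
  have \<rho>_in: "\<rho> z \<in> dirichlet_characters q" if z: "z ^ (q - 1) = 1" for z
  proof -
    have z0: "z \<noteq> 0" using z q0 by (auto simp: power_0_left)
    have "\<rho> z (n + q) = \<rho> z n" for n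
    proof -
      have c: "[n + q = n] (mod q)" by (simp add: cong_def)
      show ?thesis
      proof (cases "coprime n q")
        case True
        then have c': "coprime (n + q) q" using coc[OF c] by simp
        have "[n + q = g ^ ind n] (mod q)" using c ind[OF True] by (auto intro: cong_trans)
        then have "[ind (n + q) = ind n] (mod (q - 1))" by (rule indcong[OF c'])
        then show ?thesis using True c' zpow[OF z] by (simp add: \<rho>_def)
      next
        case False
        then show ?thesis using coc[OF c] by (simp add: \<rho>_def)
      qed
    qed
    moreover have "\<rho> z (m * n) = \<rho> z m * \<rho> z n" for m n
    proof (cases "coprime m q \<and> coprime n q")
      case True
      then have c: "coprime (m * n) q" by simp
      have "[m * n = g ^ ind m * g ^ ind n] (mod q)" using ind True by (intro cong_mult) auto
      then have "[ind (m * n) = ind m + ind n] (mod (q - 1))"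
        by (intro indcong c) (simp add: power_add)
      then show ?thesis using True c zpow[OF z] by (simp add: \<rho>_def power_add[symmetric])
    qed (auto simp: \<rho>_def)
    moreover have "\<rho> z n \<noteq> 0 \<longleftrightarrow> coprime n q" for n
      using z0 by (simp add: \<rho>_def)
    ultimately show ?thesis by (simp add: dirichlet_characters_def)
  qed
  have cg': "coprime g q" using cg by (simp add: coprime_commute)
  have rep: "\<psi> n = \<rho> (\<psi> g) n" if "\<psi> \<in> dirichlet_characters q" for \<psi> n
  proof (cases "coprime n q")
    case True
    then show ?thesis
      using dirichlet_character_cong[OF that, of n "g ^ ind n"] ind[OF True] dirichlet_character_power[OF that]
      by (simp add: \<rho>_def)
  qed (use dirichlet_character_eq_0_iff[OF that] in \<open>simp add: \<rho>_def\<close>)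
  \<comment> \<open>For \<open>q = 2\<close> the index of \<open>g\<close> is 0 and not 1, so the
    argument runs through the congruence modulo \<open>q - 1\<close>.\<close>
  have \<rho>g: "\<rho> z g = z" if z: "z ^ (q - 1) = 1" for z
    using zpow[OF z indcong[OF cg', of 1]] cg' by (simp add: \<rho>_def)
  have root: "\<psi> g ^ (q - 1) = 1" if "\<psi> \<in> dirichlet_characters q" for \<psi>
  proof -
    have "[g ^ (q - 1) = 1] (mod q)" using geq[of "q - 1" 0] by (simp add: cong_def)
    then have "\<psi> (g ^ (q - 1)) = \<psi> 1" by (rule dirichlet_character_cong[OF that])
    then show ?thesis using dirichlet_character_power[OF that] dirichlet_character_1[OF that] by simp
  qed
  have "(\<Sum>\<psi>\<in>dirichlet_characters q. \<psi> a * cnj (\<psi> b)) = (\<Sum>z\<in>{z. z ^ (q - 1) = 1}. \<rho> z a * cnj (\<rho> z b))"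
  proof (rule sum.reindex_bij_witness[of _ \<rho> "\<lambda>\<psi>. \<psi> g"])
    fix \<psi> assume \<psi>: "\<psi> \<in> dirichlet_characters q"
    show eq: "\<rho> (\<psi> g) = \<psi>" by (rule ext) (rule rep[OF \<psi>, symmetric])
    show "\<rho> (\<psi> g) a * cnj (\<rho> (\<psi> g) b) = \<psi> a * cnj (\<psi> b)" unfolding eq ..
    show "\<psi> g \<in> {z. z ^ (q - 1) = 1}" using root[OF \<psi>] by blast
  next
    fix z :: complex assume "z \<in> {z. z ^ (q - 1) = 1}"
    then have z: "z ^ (q - 1) = 1" by blast
    show "\<rho> z \<in> dirichlet_characters q" by (rule \<rho>_in[OF z])
    show "\<rho> z g = z" by (rule \<rho>g[OF z])
  qed
  also have "\<dots> = (\<Sum>k<q-1. \<rho> (unity_root (q - 1) k) a * cnj (\<rho> (unity_root (q - 1) k) b))"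
    by (rule sum.reindex_bij_betw[OF bij_betw_unity_root[OF q0], symmetric])
  also have "\<dots> = (if coprime a q \<and> [a = b] (mod q) then of_nat (q - 1) else 0)"
  proof (cases "coprime a q \<and> coprime b q")
    case True
    have "[a = b] (mod q) \<longleftrightarrow> [g ^ ind a = g ^ ind b] (mod q)"
      using ind[of a] ind[of b] True unfolding cong_def by simp
    also have "\<dots> \<longleftrightarrow> [ind a = ind b] (mod (q - 1))" by (rule geq)
    also have "\<dots> \<longleftrightarrow> ind a = ind b"
      using ind True by (simp add: cong_def)
    finally show ?thesis using True ind
      by (simp add: \<rho>_def sum_unity_root_orthogonal flip: complex_cnj_power)
  next
    case False
    then have "\<not> (coprime a q \<and> [a = b] (mod q))" using coc by auto
    moreover have "\<rho> z a * cnj (\<rho> z b) = 0" for z using False by (auto simp: \<rho>_def)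
    ultimately show ?thesis by (simp only: if_False sum.neutral_const)
  qed
  finally show ?thesis .
qed

section \<open>Theorems of Chebyshev and Mertens\<close>

lemma sum_mangoldt_dvd:
  assumes "n > 0"
  shows "(\<Sum>d | d dvd n. mangoldt d) = ln (real n)"
  using mangoldt_sum[of n, where ?'a = real] assms by simp

text \<open>Summing \<open>ln k = (\<Sum>d | d dvd k. mangoldt d)\<close> over \<open>k\<close> and
  exchanging sums counts the multiples of \<open>d\<close>. The upper limit \<open>M\<close> is free
  because \<open>n div d = 0\<close> for \<open>d > n\<close>; this lets the formulas for
  \<open>n\<close> and \<open>2 * n\<close> be subtracted over one range.\<close>

lemma ln_fact_mangoldt:
  assumes "n \<le> M"
  shows "ln (fact n) = (\<Sum>d\<in>{1..M}. mangoldt d * real (n div d))"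
proof -
  have "ln (fact n :: real) = (\<Sum>k\<in>{1..n}. ln (real k))"
    unfolding fact_prod of_nat_prod by (subst ln_prod) auto
  also have "\<dots> = (\<Sum>k\<in>{1..n}. \<Sum>d\<in>{1..M}. if d dvd k then mangoldt d else 0)"
  proof (rule sum.cong)
    fix k assume k: "k \<in> {1..n}"
    have "ln (real k) = (\<Sum>d | d dvd k. mangoldt d)"
      using k by (subst sum_mangoldt_dvd) auto
    also have "\<dots> = (\<Sum>d\<in>{d\<in>{1..M}. d dvd k}. mangoldt d)"
      using k assms by (intro sum.cong) (auto dest: dvd_imp_le simp: Suc_le_eq intro!: Nat.gr0I)
    also have "\<dots> = (\<Sum>d\<in>{1..M}. if d dvd k then mangoldt d else 0)"
      by (rule sum.inter_filter) auto
    finally show "ln (real k) = (\<Sum>d\<in>{1..M}. if d dvd k then mangoldt d else 0)" .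
  qed simp
  also have "\<dots> = (\<Sum>d\<in>{1..M}. \<Sum>k\<in>{1..n}. if d dvd k then mangoldt d else 0)"
    by (rule sum.swap)
  also have "\<dots> = (\<Sum>d\<in>{1..M}. mangoldt d * real (n div d))"
  proof (rule sum.cong)
    fix d assume d: "d \<in> {1..M}"
    have "(\<Sum>k\<in>{1..n}. if d dvd k then mangoldt d else 0) = (\<Sum>k\<in>{k\<in>{1..n}. d dvd k}. mangoldt d :: real)"
      by (rule sum.inter_filter[symmetric]) auto
    also have "{k\<in>{1..n}. d dvd k} = (\<lambda>j. d * j) ` {1..n div d}"
      using d by (auto simp: image_iff dvd_def less_eq_div_iff_mult_less_eq mult_ac Suc_le_eq intro!: Nat.gr0I)
    finally show "(\<Sum>k\<in>{1..n}. if d dvd k then mangoldt d else 0) = mangoldt d * real (n div d)"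
      using d by (simp add: card_image inj_on_def)
  qed simp
  finally show ?thesis .
qed

definition chebyshev_psi :: "nat \<Rightarrow> real" where
  "chebyshev_psi n = (\<Sum>d\<in>{1..n}. mangoldt d)"

text \<open>Chebyshev's argument with the central binomial coefficient: its logarithm weights
  \<open>mangoldt d\<close> by \<open>2 * n div d - 2 * (n div d)\<close>, which is never negative
  and is at least 1 for \<open>n < d \<le> 2 * n\<close>, while the coefficient itself is at most
  \<open>4 ^ n\<close>.\<close>

lemma chebyshev_psi_double: "chebyshev_psi (2 * n) \<le> chebyshev_psi n + 2 * real n * ln 2"
proof -
  have "chebyshev_psi (2 * n) - chebyshev_psi n = (\<Sum>d\<in>{1..2*n}. if d \<in> {1..n} then 0 else mangoldt d)"
  proof -
    have "chebyshev_psi n = (\<Sum>d\<in>{1..2*n}. if d \<in> {1..n} then mangoldt d else 0)"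
      unfolding chebyshev_psi_def
      by (rule sum.mono_neutral_cong_left) auto
    moreover have "chebyshev_psi (2 * n) - (\<Sum>d\<in>{1..2*n}. if d \<in> {1..n} then mangoldt d else 0) =
        (\<Sum>d\<in>{1..2*n}. if d \<in> {1..n} then 0 else mangoldt d)"
      unfolding chebyshev_psi_def sum_subtractf[symmetric] by (intro sum.cong) auto
    ultimately show ?thesis by simp
  qed
  also have "\<dots> \<le> (\<Sum>d\<in>{1..2*n}. mangoldt d * (real (2 * n div d) - 2 * real (n div d)))"
  proof (rule sum_mono)
    fix d assume d: "d \<in> {1..2*n}"
    have "2 * (n div d) \<le> 2 * n div d"
      using d by (simp add: less_eq_div_iff_mult_less_eq)
    then have "real (2 * n div d) - 2 * real (n div d) \<ge> 0" by linarith
    moreover have "real (2 * n div d) - 2 * real (n div d) \<ge> 1" if "d > n"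
      using d that by (auto simp: div_le_mono le_div_geq)
    ultimately show "(if d \<in> {1..n} then 0 else mangoldt d) \<le> mangoldt d * (real (2 * n div d) - 2 * real (n div d))"
      using d mangoldt_nonneg[of d] mult_left_mono[of 1 "real (2 * n div d) - 2 * real (n div d)" "mangoldt d"]
      by auto
  qed
  also have "\<dots> = ln (fact (2 * n)) - 2 * ln (fact n)"
    using ln_fact_mangoldt[of n "2 * n"] ln_fact_mangoldt[of "2 * n" "2 * n"]
    by (simp add: algebra_simps sum_subtractf sum_distrib_left)
  also have "\<dots> = ln (real (2 * n choose n))"
    by (subst binomial_fact) (auto simp: ln_div ln_mult)
  also have "\<dots> \<le> ln (2 ^ (2 * n))"
  proof (rule ln_mono)
    have "2 * n choose n \<le> 2 ^ (2 * n)" by (rule binomial_le_pow2)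
    then show "real (2 * n choose n) \<le> 2 ^ (2 * n)" by (metis of_nat_le_iff of_nat_numeral of_nat_power)
  qed auto
  also have "\<dots> = 2 * real n * ln 2" by (simp add: ln_realpow)
  finally show ?thesis by simp
qed

lemma chebyshev_psi_le: "chebyshev_psi n \<le> 4 * real n"
proof (induction n rule: less_induct)
  case (less n)
  consider "n = 0" | "n = 1" | m where "m > 0" "n = 2 * m" | m where "m > 0" "n = 2 * m + 1"
    by (cases "even n"; cases "n \<le> 1") (auto elim!: evenE oddE)
  then show ?case
  proof cases
    case (3 m)
    then have "chebyshev_psi m \<le> 4 * real m" by (intro less.IH) auto
    moreover have "real m * ln 2 \<le> real m * 1" by (intro mult_left_mono) (use ln_2_less_1 in auto)
    ultimately show ?thesis unfolding \<open>n = 2 * m\<close> using chebyshev_psi_double[of m]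
      by (auto simp: algebra_simps)
  next
    \<comment> \<open>The odd case is the tighter one: \<open>4 * m\<close> from the induction
      hypothesis, at most \<open>2 * m\<close> from doubling and at most \<open>2 * m\<close> from
      the last term give \<open>8 * m\<close>, which fits under
      \<open>4 * (2 * m + 1)\<close>.\<close>
    case (4 m)
    then have "chebyshev_psi m \<le> 4 * real m" by (intro less.IH) auto
    moreover have "real m * ln 2 \<le> real m * 1" by (intro mult_left_mono) (use ln_2_less_1 in auto)
    moreover have "mangoldt (2 * m + 1) \<le> ln (real (2 * m + 1))" by (rule mangoldt_le) auto
    moreover have "ln (real (2 * m + 1)) \<le> 2 * real m"
      using ln_le_minus_one[of "real (2 * m + 1)"] by simp
    moreover have "chebyshev_psi n = chebyshev_psi (2 * m) + mangoldt (2 * m + 1)"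
      using 4 by (simp add: chebyshev_psi_def)
    moreover have "real n = 2 * real m + 1" using 4 by simp
    ultimately show ?thesis using chebyshev_psi_double[of m] by (auto simp: algebra_simps)
  qed (auto simp: chebyshev_psi_def)
qed

text \<open>The induction step reduces to \<open>n * ln (1 + 1 / n) \<le> 1\<close>.\<close>

lemma ln_fact_lower: "ln (fact n) \<ge> real n * ln (real n) - real n"
proof (induction n)
  case (Suc n)
  show ?case
  proof (cases "n = 0")
    case False
    have "ln (real (Suc n) / real n) \<le> real (Suc n) / real n - 1"
      using False by (intro ln_le_minus_one) auto
    then have "real n * (ln (real (Suc n)) - ln (real n)) \<le> real n * (real (Suc n) / real n - 1)"
      using False by (intro mult_left_mono) (auto simp: ln_div)
    also have "\<dots> = 1" using False by (simp add: field_simps)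
    finally have "real n * (ln (real (Suc n)) - ln (real n)) \<le> 1" .
    moreover have "ln (fact (Suc n) :: real) = ln (real (Suc n)) + ln (fact n)"
      by (subst fact_Suc) (simp add: ln_mult_pos del: of_nat_Suc)
    ultimately show ?thesis using Suc by (simp add: algebra_simps del: fact_Suc)
  qed auto
qed auto

text \<open>Replacing \<open>n div d\<close> by \<open>n / d\<close> in the formula for
  \<open>ln (fact n)\<close> changes it by at most \<open>chebyshev_psi n \<le> 4 * n\<close>, which
  is the origin of the constant 4. The opposite inequality loses only \<open>n\<close>, through
  \<open>ln_fact_lower\<close>.\<close>

lemma mertens_first:
  assumes "n > 0"
  shows "\<bar>(\<Sum>d\<in>{1..n}. mangoldt d / real d) - ln (real n)\<bar> \<le> 4"
proof -
  define S where "S = (\<Sum>d\<in>{1..n}. mangoldt d / real d)"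
  have "ln (fact n :: real) \<le> ln (real n ^ n)"
    using fact_le_power[of n, where ?'a = real] assms by simp
  then have u: "ln (fact n :: real) \<le> real n * ln (real n)" using assms by (simp add: ln_realpow)
  have l: "ln (fact n :: real) \<ge> real n * ln (real n) - real n" by (rule ln_fact_lower)
  have b: "real n / real d - 1 \<le> real (n div d)" "real (n div d) \<le> real n / real d" for d
    using floor_divide_of_nat_eq[of n d, where ?'a = real] by linarith+
  have "real n * S - chebyshev_psi n = (\<Sum>d\<in>{1..n}. mangoldt d * (real n / real d - 1))"
    by (simp add: S_def chebyshev_psi_def sum_distrib_left algebra_simps sum_subtractf)
  also have "\<dots> \<le> (\<Sum>d\<in>{1..n}. mangoldt d * real (n div d))"
    by (intro sum_mono mult_left_mono b mangoldt_nonneg)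
  finally have 1: "real n * S - chebyshev_psi n \<le> ln (fact n)" by (subst ln_fact_mangoldt[of n n]) auto
  have "(\<Sum>d\<in>{1..n}. mangoldt d * real (n div d)) \<le> (\<Sum>d\<in>{1..n}. mangoldt d * (real n / real d))"
    by (intro sum_mono mult_left_mono b mangoldt_nonneg)
  also have "\<dots> = real n * S" by (simp add: S_def sum_distrib_left algebra_simps)
  finally have 2: "ln (fact n) \<le> real n * S" by (subst ln_fact_mangoldt[of n n]) auto
  have "real n * S \<le> real n * (ln (real n) + 4)" "real n * (ln (real n) - 4) \<le> real n * S"
    using 1 2 u l chebyshev_psi_le[of n] by (simp_all add: algebra_simps)
  then show ?thesis using assms unfolding S_def[symmetric] by (simp add: abs_le_iff)
qed

text \<open>Only prime powers with exponent at least 2 contribute, since \<open>mangoldt p = ln p\<close> for a prime \<open>p\<close>.\<close>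

lemma mangoldt_square_defect_bound:
  "\<exists>C. \<forall>N. (\<Sum>n\<in>{1..N}. mangoldt n * (ln (real n) - mangoldt n) / real n) \<le> C"
proof -
  have sk: "summable (\<lambda>k. real (Suc k) / 2 ^ k)"
    using geometric_deriv_sums[of "1/2 :: real"] by (simp add: sums_iff power_one_over field_simps)
  have sp: "summable (\<lambda>p. 1 / real p powr (3/2))"
    using summable_real_powr_iff[of "-3/2"] by (simp add: powr_minus_divide)
  show ?thesis
  proof (intro exI[of _ "128 * (\<Sum>p. 1 / real p powr (3/2)) * (\<Sum>k. real (Suc k) / 2 ^ k)"] allI)
    fix N :: nat
    define S where "S = {n\<in>{1..N}. primepow n \<and> \<not> prime n}"
    have "(\<Sum>n\<in>{1..N}. mangoldt n * (ln (real n) - mangoldt n) / real n) = 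
       (\<Sum>n\<in>S. mangoldt n * (ln (real n) - mangoldt n) / real n)"
      by (rule sum.mono_neutral_right) (auto simp: S_def mangoldt_def)
    \<comment> \<open>All terms are nonnegative, so the sum may be enlarged to every power
      \<open>p ^ k\<close> with \<open>p, k \<ge> 2\<close>, prime base or not, and then to a sum
      over the pairs, where a number can be counted several times. The gain is a product of two
      convergent series.\<close>
    also have "\<dots> \<le> (\<Sum>n\<in>(\<lambda>(p, k). p ^ k) ` ({2..N} \<times> {2..N}). mangoldt n * (ln (real n) - mangoldt n) / real n)"
    proof (rule sum_mono2)
      show "S \<subseteq> (\<lambda>(p, k). p ^ k) ` ({2..N} \<times> {2..N})"
      proof
        fix n assume "n \<in> S"
        then have n: "n \<le> N" "n \<ge> 1" "primepow n" "\<not> prime n" by (auto simp: S_def)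
        then obtain p k where pk: "prime p" "k > 0" "n = p ^ k" by (auto simp: primepow_def)
        have "k \<noteq> 1" using pk n by auto
        moreover have "p \<ge> 2" using pk by (simp add: prime_ge_2_nat)
        moreover have "k \<le> N"
          using less_exp[of k] power_mono[OF \<open>p \<ge> 2\<close>, of k] n(1) unfolding pk(3) by linarith
        moreover have "p \<le> p ^ k" using \<open>p \<ge> 2\<close> pk by (intro self_le_power) auto
        ultimately show "n \<in> (\<lambda>(p, k). p ^ k) ` ({2..N} \<times> {2..N})"
          using n pk by (intro image_eqI[of _ _ "(p, k)"]) auto
      qed
      fix n assume "n \<in> (\<lambda>(p, k). p ^ k) ` ({2..N} \<times> {2..N}) - S"
      then have "n > 0" by auto
      then show "mangoldt n * (ln (real n) - mangoldt n) / real n \<ge> 0"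
        using mangoldt_le[of n] mangoldt_nonneg[of n] by auto
    qed auto
    also have "\<dots> \<le> (\<Sum>(p, k)\<in>{2..N} \<times> {2..N}. mangoldt (p ^ k) * (ln (real (p ^ k)) - mangoldt (p ^ k)) / real (p ^ k))"
    proof -
      have "mangoldt (p ^ k) * (ln (real (p ^ k)) - mangoldt (p ^ k)) / real (p ^ k) \<ge> 0" if "p \<ge> 2" for p k :: nat
        using mangoldt_le[of "p ^ k"] mangoldt_nonneg[of "p ^ k"] that by auto
      then show ?thesis
        by (intro order_trans[OF sum_image_le]) (auto simp: case_prod_unfold)
    qed
    also have "\<dots> \<le> (\<Sum>(p, k)\<in>{2..N} \<times> {2..N}. (64 / real p powr (3/2)) * (real (Suc (k - 2)) / 2 ^ (k - 2)) * 2)"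
    proof (rule sum_mono, clarify)
      fix p k :: nat assume pk: "p \<in> {2..N}" "k \<in> {2..N}"
      have p2: "p \<ge> 2" using pk by auto
      let ?n = "p ^ k"
      \<comment> \<open>\<open>p\<close> need not be prime here; if \<open>p ^ k\<close> is a prime
        power, its prime divides \<open>p\<close> and so is at most \<open>p\<close>.\<close>
      have "mangoldt ?n \<le> ln (real p)"
      proof (cases "primepow ?n")
        case True
        have ap: "prime (aprimedivisor ?n)" "aprimedivisor ?n dvd ?n"
          using p2 pk by (auto intro!: prime_aprimedivisor' aprimedivisor_dvd')
        then have "aprimedivisor ?n dvd p" by (metis prime_dvd_power)
        then have "aprimedivisor ?n \<le> p" using p2 by (intro dvd_imp_le) auto
        moreover have "aprimedivisor ?n > 0" using ap(1) prime_gt_0_nat by blast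
        ultimately show ?thesis using True by (simp add: mangoldt_def)
      next
        case False
        then show ?thesis using p2 by (simp add: mangoldt_def)
      qed
      moreover have "ln (real ?n) - mangoldt ?n \<le> real k * ln (real p)"
        using mangoldt_nonneg[of ?n] p2 by (simp add: ln_realpow)
      moreover have "ln (real ?n) - mangoldt ?n \<ge> 0" using mangoldt_le[of ?n] p2 by simp
      ultimately have "mangoldt ?n * (ln (real ?n) - mangoldt ?n) \<le> ln (real p) * (real k * ln (real p))"
        using mangoldt_nonneg[of ?n] p2 by (intro mult_mono) auto
      \<comment> \<open>The exponent 1/4 is small enough: two logarithms cost
        \<open>p powr (1/2)\<close>, and division by \<open>p\<^sup>2\<close> leaves the summable
        \<open>p powr (-3/2)\<close>. The factor 16 arises here; the final constant 128 is
        generous.\<close>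
      also have "\<dots> \<le> (4 * real p powr (1/4)) * (real k * (4 * real p powr (1/4)))"
      proof -
        have "ln (real p) \<le> real p powr (1/4) / (1/4)" by (rule ln_powr_bound) (use p2 in auto)
        then show ?thesis using p2 by (intro mult_mono) auto
      qed
      also have "\<dots> = 16 * real k * real p powr (1/2)"
        by (simp add: powr_add[symmetric])
      finally have "mangoldt ?n * (ln (real ?n) - mangoldt ?n) / real ?n \<le> 16 * real k * real p powr (1/2) / real ?n"
        by (intro divide_right_mono) auto
      also have "16 * real k * real p powr (1/2) / real ?n = 16 * real k * real p powr (1/2) / (real p ^ 2 * real p ^ (k - 2))"
      proof -
        have "2 + (k - 2) = k" using pk by (intro le_add_diff_inverse) auto
        then have "real p ^ k = real p ^ (2 + (k - 2))" by (simp only:)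
        also have "\<dots> = real p ^ 2 * real p ^ (k - 2)" by (rule power_add)
        finally show ?thesis by simp
      qed
      also have "16 * real k * real p powr (1/2) / (real p ^ 2 * real p ^ (k - 2)) \<le>
           (16 * real k * real p powr (1/2)) / (real p ^ 2 * 2 ^ (k - 2))"
        using p2 by (intro divide_left_mono mult_left_mono power_mono mult_pos_pos) auto
      also have "\<dots> = 16 / real p powr (3/2) * (real k / 2 ^ (k - 2))"
      proof -
        have "real p ^ 2 = real p powr (1/2) * real p powr (3/2)"
          using p2 by (subst powr_add[symmetric]) simp
        then show ?thesis using p2 by (simp add: field_simps)
      qed
      also have "\<dots> \<le> 16 / real p powr (3/2) * ((2 * real (Suc (k - 2))) / 2 ^ (k - 2))"
        using pk p2 by (intro mult_left_mono divide_right_mono) auto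
      also have "\<dots> \<le> (64 / real p powr (3/2)) * (real (Suc (k - 2)) / 2 ^ (k - 2)) * 2"
        using p2 by (simp add: field_simps)
      finally show "mangoldt ?n * (ln (real ?n) - mangoldt ?n) / real ?n \<le> (64 / real p powr (3/2)) * (real (Suc (k - 2)) / 2 ^ (k - 2)) * 2" .
    qed
    also have "\<dots> = 128 * (\<Sum>p\<in>{2..N}. 1 / real p powr (3/2)) * (\<Sum>k\<in>{2..N}. real (Suc (k - 2)) / 2 ^ (k - 2))"
      by (simp add: sum.cartesian_product[symmetric] sum_product sum_distrib_left mult_ac)
    also have "\<dots> \<le> 128 * (\<Sum>p. 1 / real p powr (3/2)) * (\<Sum>k. real (Suc k) / 2 ^ k)"
    proof (intro mult_mono)
      show "(\<Sum>p\<in>{2..N}. 1 / real p powr (3/2)) \<le> (\<Sum>p. 1 / real p powr (3/2))"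
        by (rule sum_le_suminf[OF sp]) auto
      have "(\<Sum>k\<in>{2..N}. real (Suc (k - 2)) / 2 ^ (k - 2)) = (\<Sum>k\<in>(\<lambda>k. k - 2) ` {2..N}. real (Suc k) / 2 ^ k)"
        by (subst sum.reindex) (auto simp: inj_on_def)
      also have "\<dots> \<le> (\<Sum>k. real (Suc k) / 2 ^ k)"
        by (rule sum_le_suminf[OF sk]) auto
      finally show "(\<Sum>k\<in>{2..N}. real (Suc (k - 2)) / 2 ^ (k - 2)) \<le> (\<Sum>k. real (Suc k) / 2 ^ k)" .
    qed (auto intro!: suminf_nonneg[OF sp] sum_nonneg mult_nonneg_nonneg)
    finally show "(\<Sum>n\<in>{1..N}. mangoldt n * (ln (real n) - mangoldt n) / real n) \<le> 
      128 * (\<Sum>p. 1 / real p powr (3/2)) * (\<Sum>k. real (Suc k) / 2 ^ k)" .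
  qed
qed

section \<open>Equidistribution of prime powers on a logarithmic scale\<close>

text \<open>The summation range is \<open>{1..N}\<close> for the integer part \<open>N\<close> of
  \<open>q powr u\<close>. Of the constant 5, Mertens' theorem takes 4, and the rounding of
  \<open>q powr u\<close> costs at most \<open>ln 2 < 1\<close>.\<close>

lemma mertens_distribution:
  assumes q: "q \<ge> 2" and u: "0 \<le> u" "u \<le> 1"
  shows "\<bar>(\<Sum>n\<in>{n\<in>{1..q}. ln (real n) \<le> u * ln (real q)}. mangoldt n / real n) - u * ln (real q)\<bar> \<le> 5"
proof -
  define x where "x = real q powr u"
  have x1: "x \<ge> 1" using q u by (simp add: x_def ge_one_powr_ge_zero)
  have xq: "x \<le> real q" using q u powr_mono[of u 1 "real q"] by (simp add: x_def)
  have lnx: "ln x = u * ln (real q)" using q by (simp add: x_def ln_powr)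
  define N where "N = nat \<lfloor>x\<rfloor>"
  have N: "real N \<le> x" "x < real N + 1" "N \<ge> 1"
    using x1 by (auto simp: N_def le_nat_iff le_floor_iff)
  have "n \<in> {1..q} \<and> ln (real n) \<le> u * ln (real q) \<longleftrightarrow> n \<in> {1..N}" for n
  proof (cases "n = 0")
    case False
    have "ln (real n) \<le> ln x \<longleftrightarrow> real n \<le> x"
      using False x1 by (intro ln_le_cancel_iff) auto
    also have "\<dots> \<longleftrightarrow> n \<le> N" using N by linarith
    finally show ?thesis using False lnx N(1) xq by auto
  qed auto
  then have "{n\<in>{1..q}. ln (real n) \<le> u * ln (real q)} = {1..N}" by blast
  moreover have "\<bar>(\<Sum>n\<in>{1..N}. mangoldt n / real n) - ln (real N)\<bar> \<le> 4"
    using N by (intro mertens_first) auto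
  moreover have "ln (real N) \<le> ln x" using N by (intro ln_mono) auto
  moreover have "ln x \<le> ln (real N) + 1"
  proof -
    have "ln x \<le> ln (2 * real N)" using N x1 by (intro ln_mono) linarith+
    also have "\<dots> = ln 2 + ln (real N)" using N by (simp add: ln_mult)
    finally show ?thesis using ln_2_less_1 by linarith
  qed
  ultimately show ?thesis using lnx by simp
qed

lemma integral_equidistant_pieces:
  fixes h :: "real \<Rightarrow> real"
  assumes h: "continuous_on {0..1} h" and K: "K > 0" and k: "k \<le> K"
  shows "(\<Sum>i<k. integral {real i / real K..real (Suc i) / real K} h) = integral {0..real k / real K} h"
  using k
proof (induction k)
  case (Suc k)
  have "h integrable_on {0..real (Suc k) / real K}"
    using K Suc.prems by (intro integrable_continuous_real continuous_on_subset[OF h]) (auto simp: divide_simps)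
  then have "integral {0..real k / real K} h + integral {real k / real K..real (Suc k) / real K} h =
      integral {0..real (Suc k) / real K} h"
    using K by (intro Henstock_Kurzweil_Integration.integral_combine) (auto simp: divide_simps)
  then show ?case using Suc by simp
qed auto

lemma integral_approx_piece:
  fixes h :: "real \<Rightarrow> real"
  assumes "continuous_on {a..b} h" "a \<le> b" "\<And>x. x \<in> {a..b} \<Longrightarrow> \<bar>h x - y\<bar> \<le> e"
  shows "\<bar>integral {a..b} h - y * (b - a)\<bar> \<le> e * (b - a)"
proof -
  have i: "h integrable_on {a..b}" using assms by (intro integrable_continuous_real)
  have "integral {a..b} (\<lambda>x. h x - y) = integral {a..b} h - y * (b - a)"
    using assms(2) by (subst Henstock_Kurzweil_Integration.integral_diff[OF i]) (auto simp: mult.commute)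
  moreover have "norm (integral {a..b} (\<lambda>x. h x - y)) \<le> e * (b - a)"
    using assms by (intro integral_bound continuous_intros) auto
  ultimately show ?thesis by simp
qed

text \<open>Riemann sums: on each of \<open>K\<close> pieces of the interval the weights have total mass
  \<open>1 / K + O(1 / ln q)\<close>.\<close>

lemma mertens_equidistribution:
  fixes h :: "real \<Rightarrow> real"
  assumes h: "continuous_on {0..1} h"
  shows "(\<lambda>q. (\<Sum>n\<in>{1..q}. mangoldt n / real n * h (ln (real n) / ln (real q))) / ln (real q)) 
           \<longlonglongrightarrow> integral {0..1} h"
proof (rule LIMSEQ_I)
  fix \<epsilon> :: real assume eps: "\<epsilon> > 0"
  \<comment> \<open>The bound in \<open>main\<close> tends to \<open>2 * e\<close>, so any fixed
    denominator larger than 2 would serve.\<close>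
  define e where "e = \<epsilon> / 9"
  have e: "e > 0" using eps by (simp add: e_def)
  have "compact (h ` {0..1})" using h by (intro compact_continuous_image) auto
  then obtain H where "\<forall>y\<in>h ` {0..1}. norm y \<le> H"
    using compact_imp_bounded bounded_iff by blast
  then have H: "\<bar>h x\<bar> \<le> H" if "x \<in> {0..1}" for x using that by auto
  have H0: "H \<ge> 0" using H[of 0] by auto
  have "uniformly_continuous_on {0..1} h"
    using h by (intro compact_uniformly_continuous) auto
  then obtain d where d: "d > 0" "\<And>x y. x \<in> {0..1} \<Longrightarrow> y \<in> {0..1} \<Longrightarrow> \<bar>x - y\<bar> < d \<Longrightarrow> \<bar>h x - h y\<bar> < e"
    using e unfolding uniformly_continuous_on_def dist_real_def by metis
  obtain K where K: "K > 0" "1 / real K < d"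
    using reals_Archimedean[OF d(1)] by (metis inverse_eq_divide zero_less_Suc)
  define t where "t i = real i / real K" for i :: nat
  have t01: "t i \<in> {0..1}" if "i \<le> K" for i using that K by (auto simp: t_def)
  have tSuc: "t (Suc i) = t i + 1 / real K" for i by (simp add: t_def add_divide_distrib)
  have close: "\<bar>h x - h (t (Suc i))\<bar> \<le> e" if "x \<in> {t i..t (Suc i)}" "i < K" for x i
  proof -
    have "t i \<in> {0..1}" "t (Suc i) \<in> {0..1}" using that t01[of i] t01[of "Suc i"] by auto
    then have "x \<in> {0..1}" using that by auto
    moreover have "\<bar>x - t (Suc i)\<bar> < d" using that K tSuc[of i] by auto
    ultimately show ?thesis using d(2)[of x "t (Suc i)"] \<open>t (Suc i) \<in> {0..1}\<close> by linarith
  qed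
  have int: "\<bar>integral {0..1} h - (\<Sum>i<K. h (t (Suc i)) / real K)\<bar> \<le> e"
  proof -
    have "integral {0..1} h = (\<Sum>i<K. integral {t i..t (Suc i)} h)"
      using integral_equidistant_pieces[OF h K(1) order_refl] K by (simp add: t_def)
    then have "\<bar>integral {0..1} h - (\<Sum>i<K. h (t (Suc i)) / real K)\<bar> = 
        \<bar>\<Sum>i<K. integral {t i..t (Suc i)} h - h (t (Suc i)) / real K\<bar>"
      by (simp add: sum_subtractf)
    also have "\<dots> \<le> (\<Sum>i<K. e / real K)"
    proof (intro order_trans[OF sum_abs] sum_mono)
      fix i assume i: "i \<in> {..<K}"
      have "\<bar>integral {t i..t (Suc i)} h - h (t (Suc i)) * (t (Suc i) - t i)\<bar> \<le> e * (t (Suc i) - t i)"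
      proof (rule integral_approx_piece)
        have "t i \<in> {0..1}" "t (Suc i) \<in> {0..1}" using i t01[of i] t01[of "Suc i"] by auto
        then show "continuous_on {t i..t (Suc i)} h" by (intro continuous_on_subset[OF h]) auto
      qed (use close i tSuc in auto)
      then show "\<bar>integral {t i..t (Suc i)} h - h (t (Suc i)) / real K\<bar> \<le> e / real K"
        by (simp add: tSuc)
    qed
    also have "\<dots> = e" using K by simp
    finally show ?thesis .
  qed
  have main: "\<bar>(\<Sum>n\<in>{1..q}. mangoldt n / real n * h (ln (real n) / ln (real q))) / ln (real q) - integral {0..1} h\<bar>
      \<le> e * (1 + 5 / ln (real q)) + real K * (H * 10) / ln (real q) + e" if q: "q \<ge> 2" for q
  proof -
    define L where "L = ln (real q)"
    have L: "L > 0" using q by (simp add: L_def)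
    define w where "w n = mangoldt n / real n" for n :: nat
    have w: "w n \<ge> 0" for n by (simp add: w_def mangoldt_nonneg)
    define F where "F u = (\<Sum>n\<in>{n\<in>{1..q}. ln (real n) \<le> u * L}. w n)" for u
    have F: "\<bar>F u - u * L\<bar> \<le> 5" if "u \<in> {0..1}" for u
      using mertens_distribution[OF q, of u] that by (simp add: F_def w_def L_def)
    define A where "A i = {n\<in>{1..q}. t i * L < ln (real n) \<and> ln (real n) \<le> t (Suc i) * L}" for i
    have FA: "(\<Sum>n\<in>A i. w n) = F (t (Suc i)) - F (t i)" for i
    proof -
      have "t i * L \<le> t (Suc i) * L" using L tSuc[of i] by (intro mult_right_mono) auto
      then have eq: "{n\<in>{1..q}. ln (real n) \<le> t (Suc i) * L} = {n\<in>{1..q}. ln (real n) \<le> t i * L} \<union> A i"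
        by (auto simp: A_def)
      have "F (t (Suc i)) = F (t i) + (\<Sum>n\<in>A i. w n)"
        unfolding F_def eq by (rule sum.union_disjoint) (auto simp: A_def)
      then show ?thesis by simp
    qed
    have part: "(\<Sum>n\<in>{1..q}. w n * g n) = (\<Sum>i<K. \<Sum>n\<in>A i. w n * g n)" for g :: "nat \<Rightarrow> real"
    proof -
      have "(\<Sum>i<K. \<Sum>n\<in>A i. w n * g n) = (\<Sum>n\<in>(\<Union>i<K. A i). w n * g n)"
      proof (rule sum.UNION_disjoint[symmetric])
        show "\<forall>i\<in>{..<K}. \<forall>j\<in>{..<K}. i \<noteq> j \<longrightarrow> A i \<inter> A j = {}"
        proof (intro ballI impI)
          fix i j :: nat assume "i \<noteq> j"
          have *: "A i \<inter> A j = {}" if "i < j" for i j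
          proof -
            have "t (Suc i) \<le> t j" unfolding t_def using that by (intro divide_right_mono) auto
            then have "t (Suc i) * L \<le> t j * L" using L by (intro mult_right_mono) auto
            then show ?thesis by (auto simp: A_def)
          qed
          show "A i \<inter> A j = {}" using *[of i j] *[of j i] \<open>i \<noteq> j\<close> by (cases "i < j") auto
        qed
      qed (auto simp: A_def)
      also have "\<dots> = (\<Sum>n\<in>{1..q}. w n * g n)"
      proof (rule sum.mono_neutral_left)
        show "\<forall>n\<in>{1..q} - (\<Union>i<K. A i). w n * g n = 0"
        proof
          fix n assume n: "n \<in> {1..q} - (\<Union>i<K. A i)"
          \<comment> \<open>The pieces \<open>A i\<close> are open on the left, so the only point
            they miss is \<open>n = 1\<close>, whose weight is 0.\<close>
          have "n = 1"
          proof (rule ccontr)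
            assume "n \<noteq> 1"
            then have n2: "n \<ge> 2" "n \<le> q" using n by auto
            define x where "x = ln (real n) / L * real K"
            have le: "ln (real n) \<le> L" and pos: "ln (real n) > 0" using n2 by (auto simp: L_def)
            then have x0: "x > 0" using L K by (simp add: x_def)
            have "ln (real n) / L * real K \<le> 1 * real K"
              using le L by (intro mult_right_mono) auto
            then have x: "x > 0" "x \<le> real K" using x0 by (auto simp: x_def)
            define i where "i = nat (\<lceil>x\<rceil> - 1)"
            have i: "real i < x" "x \<le> real (Suc i)" "i < K"
              using x unfolding i_def by linarith+
            have "n \<in> A i"
              using i n2 L K unfolding A_def t_def x_def by (auto simp: field_simps)
            then show False using n i by auto
          qed
          then show "w n * g n = 0" by (simp add: w_def)
        qed
      qed (auto simp: A_def)
      finally show ?thesis by simp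
    qed
    have 1: "\<bar>(\<Sum>n\<in>{1..q}. w n * h (ln (real n) / L)) - (\<Sum>i<K. h (t (Suc i)) * (F (t (Suc i)) - F (t i)))\<bar> \<le> e * (L + 5)"
    proof -
      have "(\<Sum>n\<in>{1..q}. w n * h (ln (real n) / L)) - (\<Sum>i<K. h (t (Suc i)) * (F (t (Suc i)) - F (t i))) = 
         (\<Sum>i<K. \<Sum>n\<in>A i. w n * (h (ln (real n) / L) - h (t (Suc i))))"
        unfolding part FA[symmetric] by (simp add: sum_subtractf right_diff_distrib sum_distrib_left sum_distrib_right mult_ac)
      also have "\<bar>\<dots>\<bar> \<le> (\<Sum>i<K. \<Sum>n\<in>A i. w n * e)"
      proof (intro order_trans[OF sum_abs] sum_mono)
        fix i n assume i: "i \<in> {..<K}" and n: "n \<in> A i"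
        have "ln (real n) / L \<in> {t i..t (Suc i)}" using n L by (auto simp: A_def field_simps)
        then have "\<bar>h (ln (real n) / L) - h (t (Suc i))\<bar> \<le> e" using i by (intro close) auto
        then show "\<bar>w n * (h (ln (real n) / L) - h (t (Suc i)))\<bar> \<le> w n * e"
          using w[of n] by (simp add: abs_mult mult_left_mono)
      qed
      also have "\<dots> = (\<Sum>n\<in>{1..q}. w n * e)" by (rule part[symmetric])
      \<comment> \<open>The total mass is \<open>L\<close> up to a bounded error, so the oscillation
        of \<open>h\<close> on the pieces costs about \<open>e\<close> after division by
        \<open>L\<close>.\<close>
      also have "\<dots> = e * F 1"
      proof -
        have "{n\<in>{1..q}. ln (real n) \<le> 1 * L} = {1..q}" by (auto simp: L_def)
        then show ?thesis by (simp add: F_def sum_distrib_left mult.commute)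
      qed
      also have "\<dots> \<le> e * (L + 5)" using F[of 1] e by (intro mult_left_mono) auto
      finally show ?thesis .
    qed
    \<comment> \<open>Each endpoint of a piece contributes an error of at most 5. The number
      \<open>K\<close> of pieces does not depend on \<open>q\<close>, so the total disappears on
      division by \<open>L\<close>.\<close>
    have 2: "\<bar>(\<Sum>i<K. h (t (Suc i)) * (F (t (Suc i)) - F (t i))) - L * (\<Sum>i<K. h (t (Suc i)) / real K)\<bar> \<le> real K * (H * 10)"
    proof -
      have "(\<Sum>i<K. h (t (Suc i)) * (F (t (Suc i)) - F (t i))) - L * (\<Sum>i<K. h (t (Suc i)) / real K) = 
        (\<Sum>i<K. h (t (Suc i)) * ((F (t (Suc i)) - t (Suc i) * L) - (F (t i) - t i * L)))"
        by (simp add: sum_distrib_left sum_subtractf[symmetric] tSuc algebra_simps)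
      also have "\<bar>\<dots>\<bar> \<le> (\<Sum>i<K. H * 10)"
      proof (intro order_trans[OF sum_abs] sum_mono)
        fix i assume i: "i \<in> {..<K}"
        have "\<bar>(F (t (Suc i)) - t (Suc i) * L) - (F (t i) - t i * L)\<bar> \<le> 10"
          using F[OF t01[of i]] F[OF t01[of "Suc i"]] i by auto
        then show "\<bar>h (t (Suc i)) * ((F (t (Suc i)) - t (Suc i) * L) - (F (t i) - t i * L))\<bar> \<le> H * 10"
          unfolding abs_mult using H[OF t01[of "Suc i"]] i H0 by (intro mult_mono) auto
      qed
      finally show ?thesis by simp
    qed
    define S where "S = (\<Sum>n\<in>{1..q}. w n * h (ln (real n) / L))"
    define R where "R = (\<Sum>i<K. h (t (Suc i)) / real K)"
    have "\<bar>S - L * R\<bar> \<le> e * (L + 5) + real K * (H * 10)" using 1 2 unfolding S_def R_def by linarith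
    then have "\<bar>S / L - R\<bar> \<le> (e * (L + 5) + real K * (H * 10)) / L"
      using L by (simp add: field_simps abs_le_iff)
    also have "\<dots> = e * (1 + 5 / L) + real K * (H * 10) / L" using L by (simp add: field_simps)
    finally have "\<bar>S / L - integral {0..1} h\<bar> \<le> e * (1 + 5 / L) + real K * (H * 10) / L + e"
      using int unfolding R_def by linarith
    then show ?thesis by (simp add: S_def w_def L_def)
  qed
  have "((\<lambda>q. e * (1 + 5 / ln (real q)) + real K * (H * 10) / ln (real q) + e) \<longlongrightarrow> e * (1 + 0) + 0 + e) sequentially"
  proof (intro tendsto_intros)
    have L: "filterlim (\<lambda>q. ln (real q)) at_top sequentially"
      by (rule filterlim_compose[OF ln_at_top filterlim_real_sequentially])
    show "(\<lambda>q. 5 / ln (real q)) \<longlonglongrightarrow> 0" "(\<lambda>q. real K * (H * 10) / ln (real q)) \<longlonglongrightarrow> 0"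
      by (rule tendsto_divide_0[OF tendsto_const filterlim_at_top_imp_at_infinity[OF L]])+
  qed
  then have "eventually (\<lambda>q. e * (1 + 5 / ln (real q)) + real K * (H * 10) / ln (real q) + e < \<epsilon>) sequentially"
    by (rule order_tendstoD(2)) (use eps in \<open>simp add: e_def\<close>)
  then have "eventually (\<lambda>q. \<bar>(\<Sum>n\<in>{1..q}. mangoldt n / real n * h (ln (real n) / ln (real q))) / ln (real q) - integral {0..1} h\<bar> < \<epsilon>) sequentially"
    using eventually_ge_at_top[of 2]
  proof eventually_elim
    case (elim q)
    then show ?case using main[of q] by linarith
  qed
  then show "\<exists>no. \<forall>n\<ge>no. norm ((\<Sum>k\<in>{1..n}. mangoldt k / real k * h (ln (real k) / ln (real n))) / ln (real n) - integral {0..1} h) < \<epsilon>"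
    unfolding eventually_sequentially by simp
qed

section \<open>Dirichlet convolution powers and off-diagonal terms\<close>

primrec conv_power :: "(nat \<Rightarrow> real) \<Rightarrow> nat \<Rightarrow> nat \<Rightarrow> real" where
  "conv_power c 0 a = (if a = 1 then 1 else 0)"
| "conv_power c (Suc j) a = (\<Sum>d | d dvd a. c d * conv_power c j (a div d))"

lemma conv_power_1: "a > 0 \<Longrightarrow> conv_power c (Suc 0) a = c a"
proof -
  assume a: "a > 0"
  have "conv_power c (Suc 0) a = (\<Sum>d | d dvd a. if d = a then c a else 0)"
    unfolding conv_power.simps using a by (intro sum.cong) (auto elim!: dvdE)
  also have "\<dots> = c a" using a by (simp add: finite_divisors_nat)
  finally show ?thesis .
qed

lemma conv_power_eq_0:
  assumes c: "\<And>n. real n > X \<Longrightarrow> c n = 0" and X: "X \<ge> 1"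
  shows "a > 0 \<Longrightarrow> real a > X ^ j \<Longrightarrow> conv_power c j a = 0"
proof (induction j arbitrary: a)
  case (Suc j)
  have "c d * conv_power c j (a div d) = 0" if d: "d dvd a" for d
  proof (cases "real d > X")
    case False
    obtain e where e: "a = d * e" using d by (auto elim!: dvdE)
    have pos: "d > 0" "e > 0" using e Suc.prems by auto
    have "real e > X ^ j"
    proof (rule ccontr)
      assume "\<not> real e > X ^ j"
      then have "real d * real e \<le> X * X ^ j" using False X by (intro mult_mono) auto
      then show False using Suc.prems e by simp
    qed
    then have "conv_power c j e = 0" using pos by (intro Suc.IH) auto
    then show ?thesis using e pos by simp
  qed (simp add: c)
  then show ?case unfolding conv_power.simps by (intro sum.neutral) auto
qed auto

text \<open>A prime dividing a product divides one of the factors. Its purpose is to make the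
  coprimality condition in the orthogonality relation automatic, so that the congruence kernel and
  the equality kernel agree on the diagonal.\<close>

lemma conv_power_not_coprime:
  assumes c: "\<And>n. q dvd n \<Longrightarrow> c n = 0" and q: "prime q"
  shows "a > 0 \<Longrightarrow> q dvd a \<Longrightarrow> conv_power c j a = 0"
proof (induction j arbitrary: a)
  case (Suc j)
  have "c d * conv_power c j (a div d) = 0" if d: "d dvd a" for d
  proof (cases "q dvd d")
    case False
    obtain e where e: "a = d * e" using d by (auto elim!: dvdE)
    have pos: "d > 0" "e > 0" using e Suc.prems by auto
    have "q dvd e" using Suc.prems(2) False q e by (simp add: prime_dvd_mult_iff)
    then have "conv_power c j e = 0" using pos by (intro Suc.IH) auto
    then show ?thesis using e pos by simp
  qed (simp add: c)
  then show ?case unfolding conv_power.simps by (intro sum.neutral) auto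
qed (use q in auto)

text \<open>At each step the divisor sum of \<open>mangoldt\<close> equals \<open>ln a\<close>, so a
  convolution costs one logarithm and no divisor function enters.\<close>

lemma conv_power_bound:
  assumes c: "\<And>n. n > 0 \<Longrightarrow> \<bar>c n\<bar> \<le> B * mangoldt n / sqrt (real n)" and B: "B \<ge> 0"
  shows "a > 0 \<Longrightarrow> \<bar>conv_power c j a\<bar> \<le> B ^ j * ln (real a) ^ j / sqrt (real a)"
proof (induction j arbitrary: a)
  case (Suc j)
  have "\<bar>conv_power c (Suc j) a\<bar> \<le> (\<Sum>d | d dvd a. mangoldt d * (B ^ Suc j * ln (real a) ^ j / sqrt (real a)))"
    unfolding conv_power.simps
  proof (intro order_trans[OF sum_abs] sum_mono)
    fix d assume "d \<in> {d. d dvd a}"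
    then obtain e where e: "a = d * e" by (auto elim!: dvdE)
    have pos: "d > 0" "e > 0" using e Suc.prems by auto
    have le: "e \<le> a" using e pos by simp
    have "\<bar>c d * conv_power c j (a div d)\<bar> = \<bar>c d\<bar> * \<bar>conv_power c j e\<bar>"
      using e pos by (simp add: abs_mult)
    also have "\<dots> \<le> (B * mangoldt d / sqrt (real d)) * (B ^ j * ln (real e) ^ j / sqrt (real e))"
      using B pos by (intro mult_mono c Suc.IH) (auto intro!: mult_nonneg_nonneg divide_nonneg_nonneg mangoldt_nonneg)
    also have "\<dots> = B ^ Suc j * mangoldt d * ln (real e) ^ j / sqrt (real a)"
      using e by (simp add: real_sqrt_mult)
    also have "\<dots> \<le> B ^ Suc j * mangoldt d * ln (real a) ^ j / sqrt (real a)"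
      using B pos le by (intro divide_right_mono mult_left_mono power_mono)
        (auto intro!: mult_nonneg_nonneg mangoldt_nonneg)
    finally show "\<bar>c d * conv_power c j (a div d)\<bar> \<le> mangoldt d * (B ^ Suc j * ln (real a) ^ j / sqrt (real a))"
      by (simp add: mult_ac)
  qed
  also have "\<dots> = ln (real a) * (B ^ Suc j * ln (real a) ^ j / sqrt (real a))"
    using Suc.prems by (simp only: sum_distrib_right[symmetric] sum_mangoldt_dvd)
  finally show ?case by (simp add: mult_ac)
qed auto

text \<open>Cutting the sums off at \<open>M\<close> loses nothing: a product
  \<open>n * a > M \<ge> X ^ Suc j\<close> has \<open>n > X\<close> or \<open>a > X ^ j\<close>, and
  one of the two coefficients vanishes. The identity is therefore exact for finite sums.\<close>

lemma sum_power_conv_power: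
  fixes \<rho> :: "nat \<Rightarrow> complex"
  assumes c: "\<And>n. real n > X \<Longrightarrow> c n = 0" and X: "X \<ge> 1"
    and \<rho>: "\<rho> 1 = 1" "\<And>a b. a > 0 \<Longrightarrow> b > 0 \<Longrightarrow> \<rho> (a * b) = \<rho> a * \<rho> b"
    and M: "X ^ j \<le> real M"
  shows "(\<Sum>n\<in>{1..M}. of_real (c n) * \<rho> n) ^ j = (\<Sum>a\<in>{1..M}. of_real (conv_power c j a) * \<rho> a)"
  using M
proof (induction j)
  case 0
  then have "M \<ge> 1" by simp
  have "(\<Sum>a\<in>{1..M}. of_real (conv_power c 0 a) * \<rho> a) = (\<Sum>a\<in>{1..M}. if a = 1 then 1 else 0)"
    using \<rho>(1) by (intro sum.cong) auto
  then show ?case using \<open>M \<ge> 1\<close> by simp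
next
  case (Suc j)
  have Xj: "X ^ j \<le> X ^ Suc j" using X by (intro power_increasing) auto
  have IH: "(\<Sum>n\<in>{1..M}. of_real (c n) * \<rho> n) ^ j = (\<Sum>a\<in>{1..M}. of_real (conv_power c j a) * \<rho> a)"
    using Suc Xj by simp
  define g where "g = (\<lambda>(n, a). of_real (c n) * \<rho> n * (of_real (conv_power c j a) * \<rho> a))"
  have "(\<Sum>n\<in>{1..M}. of_real (c n) * \<rho> n) ^ Suc j = (\<Sum>x\<in>{1..M}\<times>{1..M}. g x)"
    unfolding power_Suc IH sum_product g_def by (simp only: sum.cartesian_product)
  also have "\<dots> = (\<Sum>x\<in>{x\<in>{1..M}\<times>{1..M}. fst x * snd x \<le> M}. g x)"
  proof (rule sum.mono_neutral_right)
    show "\<forall>x\<in>{1..M} \<times> {1..M} - {x \<in> {1..M} \<times> {1..M}. fst x * snd x \<le> M}. g x = 0"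
    proof
      fix x assume "x \<in> {1..M} \<times> {1..M} - {x \<in> {1..M} \<times> {1..M}. fst x * snd x \<le> M}"
      then obtain n a where x: "x = (n, a)" and na: "n > 0" "a > 0" "M < n * a" by auto
      show "g x = 0"
      proof (cases "real n > X")
        case False
        have "real a > X ^ j"
        proof (rule ccontr)
          assume "\<not> real a > X ^ j"
          then have "real n * real a \<le> X * X ^ j" using False X by (intro mult_mono) auto
          then have "real (n * a) \<le> real M" using Suc.prems by simp
          then have "n * a \<le> M" by (simp only: of_nat_le_iff)
          then show False using na by simp
        qed
        then have "conv_power c j a = 0" using na by (intro conv_power_eq_0[OF c X]) auto
        then show ?thesis by (simp add: g_def x)
      qed (simp add: g_def c x)
    qed
  qed auto
  also have "\<dots> = (\<Sum>(e, d)\<in>(SIGMA e:{1..M}. {d. d dvd e}). of_real (c d * conv_power c j (e div d)) * \<rho> e)"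
  proof (rule sum.reindex_bij_witness[of _ "\<lambda>(e, d). (d, e div d)" "\<lambda>(n, a). (n * a, n)"])
    fix x assume "x \<in> {x\<in>{1..M}\<times>{1..M}. fst x * snd x \<le> M}"
    then obtain n a where x: "x = (n, a)" "n > 0" "a > 0" "n * a \<le> M" by auto
    then show "(case case x of (n, a) \<Rightarrow> (n * a, n) of (e, d) \<Rightarrow> (d, e div d)) = x"
      "(case x of (n, a) \<Rightarrow> (n * a, n)) \<in> (SIGMA e:{1..M}. {d. d dvd e})"
      "(case case x of (n, a) \<Rightarrow> (n * a, n) of (e, d) \<Rightarrow> of_real (c d * conv_power c j (e div d)) * \<rho> e) = g x"
      by (simp_all add: g_def \<rho>(2))
  next
    fix y assume "y \<in> (SIGMA e:{1..M}. {d. d dvd e})"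
    then obtain e d where y: "y = (e, d)" "e > 0" "e \<le> M" "d dvd e" by auto
    then obtain k where k: "e = d * k" by (auto elim!: dvdE)
    have pos: "d > 0" "k > 0" using k y by auto
    have "d \<le> d * k" "k \<le> d * k" using pos by auto
    then have "d \<le> M" "k \<le> M" using y k by linarith+
    then show "(case case y of (e, d) \<Rightarrow> (d, e div d) of (n, a) \<Rightarrow> (n * a, n)) = y"
      "(case y of (e, d) \<Rightarrow> (d, e div d)) \<in> {x\<in>{1..M}\<times>{1..M}. fst x * snd x \<le> M}"
      using y pos k by simp_all
  qed
  also have "\<dots> = (\<Sum>e\<in>{1..M}. of_real (conv_power c (Suc j) e) * \<rho> e)"
    by (subst sum.Sigma[symmetric]) (auto simp: finite_divisors_nat sum_distrib_right)
  finally show ?case .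
qed

text \<open>The coefficients that arise from expanding the \<open>m\<close>-th power of \<open>S + cnj S\<close> for a character
  sum \<open>S\<close>; averaging over characters replaces \<open>\<rho> a * cnj (\<rho> b)\<close> by a kernel \<open>K a b\<close>.\<close>

definition moment_form :: "(nat \<Rightarrow> real) \<Rightarrow> nat \<Rightarrow> nat \<Rightarrow> (nat \<Rightarrow> nat \<Rightarrow> complex) \<Rightarrow> complex" where
  "moment_form c M m K = (\<Sum>j\<le>m. of_nat (m choose j) * (\<Sum>a\<in>{1..M}. \<Sum>b\<in>{1..M}.
      of_real (conv_power c j a * conv_power c (m - j) b) * K a b))"

lemma moment_form_eq:
  fixes \<rho> :: "nat \<Rightarrow> complex"
  assumes c: "\<And>n. real n > X \<Longrightarrow> c n = 0" and X: "X \<ge> 1"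
    and \<rho>: "\<rho> 1 = 1" "\<And>a b. a > 0 \<Longrightarrow> b > 0 \<Longrightarrow> \<rho> (a * b) = \<rho> a * \<rho> b"
    and M: "X ^ m \<le> real M"
  shows "(\<Sum>n\<in>{1..M}. of_real (c n) * (\<rho> n + cnj (\<rho> n))) ^ m = moment_form c M m (\<lambda>a b. \<rho> a * cnj (\<rho> b))"
proof -
  define S where "S = (\<Sum>n\<in>{1..M}. of_real (c n) * \<rho> n)"
  have "(\<Sum>n\<in>{1..M}. of_real (c n) * (\<rho> n + cnj (\<rho> n))) = S + cnj S"
    by (simp add: S_def sum.distrib distrib_left)
  then have "(\<Sum>n\<in>{1..M}. of_real (c n) * (\<rho> n + cnj (\<rho> n))) ^ m = 
      (\<Sum>j\<le>m. of_nat (m choose j) * S ^ j * cnj S ^ (m - j))"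
    by (simp add: binomial_ring)
  also have "\<dots> = moment_form c M m (\<lambda>a b. \<rho> a * cnj (\<rho> b))"
    unfolding moment_form_def
  proof (rule sum.cong[OF refl])
    fix j assume "j \<in> {..m}"
    then have j: "X ^ j \<le> X ^ m" "X ^ (m - j) \<le> X ^ m" using X by (auto intro!: power_increasing)
    have 1: "S ^ j = (\<Sum>a\<in>{1..M}. of_real (conv_power c j a) * \<rho> a)"
      unfolding S_def using j M by (intro sum_power_conv_power[OF c X \<rho>]) auto
    have "S ^ (m - j) = (\<Sum>a\<in>{1..M}. of_real (conv_power c (m - j) a) * \<rho> a)"
      unfolding S_def using j M by (intro sum_power_conv_power[OF c X \<rho>]) auto
    then have 2: "cnj S ^ (m - j) = (\<Sum>a\<in>{1..M}. of_real (conv_power c (m - j) a) * cnj (\<rho> a))"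
      by (simp flip: complex_cnj_power)
    show "of_nat (m choose j) * S ^ j * cnj S ^ (m - j) = of_nat (m choose j) * (\<Sum>a\<in>{1..M}. \<Sum>b\<in>{1..M}.
      of_real (conv_power c j a * conv_power c (m - j) b) * (\<rho> a * cnj (\<rho> b)))"
      unfolding 1 2 mult.assoc sum_product by (simp add: mult_ac)
  qed
  finally show ?thesis .
qed

lemma moment_form_sum:
  "(\<Sum>x\<in>A. moment_form c M m (K x)) = moment_form c M m (\<lambda>a b. \<Sum>x\<in>A. K x a b)"
proof -
  have "(\<Sum>x\<in>A. moment_form c M m (K x)) = (\<Sum>j\<le>m. \<Sum>x\<in>A. of_nat (m choose j) * (\<Sum>a\<in>{1..M}. \<Sum>b\<in>{1..M}.
      of_real (conv_power c j a * conv_power c (m - j) b) * K x a b))"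
    unfolding moment_form_def by (rule sum.swap)
  also have "\<dots> = (\<Sum>j\<le>m. of_nat (m choose j) * (\<Sum>a\<in>{1..M}. \<Sum>b\<in>{1..M}.
      of_real (conv_power c j a * conv_power c (m - j) b) * (\<Sum>x\<in>A. K x a b)))"
  proof (rule sum.cong[OF refl])
    fix j
    have "(\<Sum>x\<in>A. \<Sum>a\<in>{1..M}. \<Sum>b\<in>{1..M}. of_real (conv_power c j a * conv_power c (m - j) b) * K x a b) =
       (\<Sum>a\<in>{1..M}. \<Sum>b\<in>{1..M}. \<Sum>x\<in>A. of_real (conv_power c j a * conv_power c (m - j) b) * K x a b)"
      by (subst sum.swap, rule sum.cong[OF refl], rule sum.swap)
    then show "(\<Sum>x\<in>A. of_nat (m choose j) * (\<Sum>a\<in>{1..M}. \<Sum>b\<in>{1..M}.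
        of_real (conv_power c j a * conv_power c (m - j) b) * K x a b)) = 
      of_nat (m choose j) * (\<Sum>a\<in>{1..M}. \<Sum>b\<in>{1..M}.
        of_real (conv_power c j a * conv_power c (m - j) b) * (\<Sum>x\<in>A. K x a b))"
      by (simp only: sum_distrib_left[symmetric])
  qed
  finally show ?thesis by (simp add: moment_form_def)
qed

lemma moment_form_cmult: "moment_form c M m (\<lambda>a b. K a b * z) = moment_form c M m K * z"
  by (simp add: moment_form_def sum_distrib_left mult_ac)

lemma moment_form_diff: "moment_form c M m K - moment_form c M m K' = moment_form c M m (\<lambda>a b. K a b - K' a b)"
  by (simp add: moment_form_def sum_subtractf right_diff_distrib)

lemma moment_form_cong:
  "(\<And>a b. a \<in> {1..M} \<Longrightarrow> b \<in> {1..M} \<Longrightarrow> K a b = K' a b) \<Longrightarrow> moment_form c M m K = moment_form c M m K'"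
  unfolding moment_form_def by (intro sum.cong arg_cong2[where f = "(*)"]) auto

text \<open>Such an \<open>a\<close> is \<open>b + k * q\<close> with
  \<open>1 \<le> k \<le> M\<close>, and \<open>1 / a \<le> 1 / (k * q)\<close> splits the double sum
  into two harmonic sums and the factor \<open>1 / q\<close>.\<close>

lemma sum_inverse_congruent_above:
  assumes q: "q > 0"
  shows "(\<Sum>b\<in>{1..M}. \<Sum>a\<in>{a\<in>{1..M}. a > b \<and> [a = b] (mod q)}. 1 / (real a * real b)) \<le> (harm M)\<^sup>2 / real q"
proof -
  have "(\<Sum>a\<in>{a\<in>{1..M}. a > b \<and> [a = b] (mod q)}. 1 / (real a * real b)) \<le> 1 / real b * harm M / real q" if b: "b \<in> {1..M}" for b
  proof -
    have "(\<Sum>a\<in>{a\<in>{1..M}. a > b \<and> [a = b] (mod q)}. 1 / (real a * real b)) \<le> 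
        (\<Sum>a\<in>(\<lambda>k. b + k * q) ` {1..M}. 1 / (real a * real b))"
    proof (rule sum_mono2)
      show "{a\<in>{1..M}. a > b \<and> [a = b] (mod q)} \<subseteq> (\<lambda>k. b + k * q) ` {1..M}"
      proof
        fix a assume a: "a \<in> {a\<in>{1..M}. a > b \<and> [a = b] (mod q)}"
        then have "q dvd a - b" using cong_altdef_nat[of b a q] by auto
        then obtain k where k: "a - b = q * k" by (auto elim!: dvdE)
        have "k > 0" using a k by (cases k) auto
        moreover have "k \<le> q * k" using q by simp
        moreover have "q * k \<le> M" using a k by auto
        ultimately have "k \<in> {1..M}" unfolding atLeastAtMost_iff by linarith
        moreover have "a = b + k * q" using a k by (auto simp: mult.commute)
        ultimately show "a \<in> (\<lambda>k. b + k * q) ` {1..M}" by (intro image_eqI[of _ _ k]) auto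
      qed
    qed auto
    also have "\<dots> = (\<Sum>k\<in>{1..M}. 1 / (real (b + k * q) * real b))"
      using q by (subst sum.reindex) (auto simp: inj_on_def)
    also have "\<dots> \<le> (\<Sum>k\<in>{1..M}. 1 / real b * (1 / real k) / real q)"
    proof (rule sum_mono)
      fix k assume k: "k \<in> {1..M}"
      have "1 / (real (b + k * q) * real b) \<le> 1 / (real k * real q * real b)"
        using k b q by (intro divide_left_mono mult_right_mono mult_pos_pos) (auto intro: add_pos_nonneg)
      then show "1 / (real (b + k * q) * real b) \<le> 1 / real b * (1 / real k) / real q"
        by (simp add: mult_ac)
    qed
    also have "\<dots> = 1 / real b * harm M / real q"
      by (simp add: harm_def sum_distrib_left sum_distrib_right divide_inverse mult_ac)
    finally show ?thesis .
  qed
  then have "(\<Sum>b\<in>{1..M}. \<Sum>a\<in>{a\<in>{1..M}. a > b \<and> [a = b] (mod q)}. 1 / (real a * real b)) \<le> 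
     (\<Sum>b\<in>{1..M}. 1 / real b * harm M / real q)" by (rule sum_mono)
  also have "\<dots> = (harm M)\<^sup>2 / real q"
    by (simp add: harm_def power2_eq_square sum_distrib_left sum_distrib_right divide_inverse mult_ac)
  finally show ?thesis .
qed

lemma sum_inverse_congruent_offdiag:
  assumes q: "q > 0"
  shows "(\<Sum>a\<in>{1..M}. \<Sum>b\<in>{1..M}. if a \<noteq> b \<and> [a = b] (mod q) then 1 / (real a * real b) else 0) \<le> 2 * (harm M)\<^sup>2 / real q"
proof -
  define g where "g a b = (if a > b \<and> [a = b] (mod q) then 1 / (real a * real b) else 0)" for a b :: nat
  have "(\<Sum>a\<in>{1..M}. \<Sum>b\<in>{1..M}. if a \<noteq> b \<and> [a = b] (mod q) then 1 / (real a * real b) else 0) =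
     (\<Sum>a\<in>{1..M}. \<Sum>b\<in>{1..M}. g a b + g b a)"
    by (intro sum.cong refl) (auto simp: g_def cong_sym_eq)
  also have "\<dots> = (\<Sum>a\<in>{1..M}. \<Sum>b\<in>{1..M}. g a b) + (\<Sum>a\<in>{1..M}. \<Sum>b\<in>{1..M}. g b a)"
    by (simp add: sum.distrib)
  also have "(\<Sum>a\<in>{1..M}. \<Sum>b\<in>{1..M}. g a b) = (\<Sum>a\<in>{1..M}. \<Sum>b\<in>{1..M}. g b a)"
    by (rule sum.swap)
  also have "(\<Sum>b\<in>{1..M}. \<Sum>a\<in>{1..M}. g a b) = 
      (\<Sum>b\<in>{1..M}. \<Sum>a\<in>{a\<in>{1..M}. a > b \<and> [a = b] (mod q)}. 1 / (real a * real b))"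
    unfolding g_def by (intro sum.cong refl sum.inter_filter[symmetric]) auto
  also have "\<dots> \<le> (harm M)\<^sup>2 / real q" by (rule sum_inverse_congruent_above[OF q])
  finally show ?thesis by simp
qed

text \<open>On the support of the coefficients \<open>a * b \<le> X ^ m\<close>, so that \<open>1 / sqrt (a * b)\<close> is at most
  \<open>sqrt (X ^ m) / (a * b)\<close>, which is summable up to logarithms.\<close>

lemma moment_form_offdiag_bound:
  assumes c: "\<And>n. real n > X \<Longrightarrow> c n = 0" and X: "X \<ge> 1"
    and cb: "\<And>n. n > 0 \<Longrightarrow> \<bar>c n\<bar> \<le> B * mangoldt n / sqrt (real n)" and B: "B \<ge> 0"
    and cq: "\<And>n. q dvd n \<Longrightarrow> c n = 0" and q: "prime q"
  shows "norm (moment_form c M m (\<lambda>a b. if coprime a q \<and> [a = b] (mod q) then 1 else 0) - 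
       moment_form c M m (\<lambda>a b. if a = b then 1 else 0)) \<le> 
     2 ^ m * (B * ln (real M)) ^ m * sqrt (X ^ m) * (2 * (harm M)\<^sup>2 / real q)"
proof -
  have q0: "q > 0" using q prime_gt_0_nat by blast
  define C where "C = conv_power c"
  define D where "D = (B * ln (real M)) ^ m * sqrt (X ^ m)"
  define g where "g a b = (if a \<noteq> b \<and> [a = b] (mod q) then 1 / (real a * real b) else 0)" for a b
  have D: "D \<ge> 0"
    using B X by (cases "M = 0") (auto simp: D_def intro!: mult_nonneg_nonneg)
  have bd: "norm (of_real (C j a * C (m - j) b) * ((if coprime a q \<and> [a = b] (mod q) then 1 else 0) - (if a = b then 1 else 0 :: complex))) \<le> D * g a b"
    if j: "j \<le> m" and ab: "a \<in> {1..M}" "b \<in> {1..M}" for j a b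
  proof (cases "a = b")
    \<comment> \<open>The kernels differ at a diagonal point only when \<open>q\<close> divides
      \<open>a\<close>, and there the coefficient is 0.\<close>
    case True
    have "C j a = 0" if "\<not> coprime a q"
    proof -
      have "q dvd a" using that q by (metis prime_imp_coprime coprime_commute)
      then show ?thesis using ab unfolding C_def by (intro conv_power_not_coprime[OF cq q]) auto
    qed
    then show ?thesis using True D by (auto simp: g_def)
  next
    case False
    show ?thesis
    proof (cases "[a = b] (mod q) \<and> C j a \<noteq> 0 \<and> C (m - j) b \<noteq> 0")
      case True
      have pos: "a > 0" "b > 0" "M > 0" using ab by auto
      have "real a \<le> X ^ j" "real b \<le> X ^ (m - j)"
        using True conv_power_eq_0[where a = a and j = j, OF c X] conv_power_eq_0[where a = b and j = "m - j", OF c X] pos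
        unfolding C_def by (meson not_le)+
      then have "real a * real b \<le> X ^ j * X ^ (m - j)" using X by (intro mult_mono) auto
      also have "\<dots> = X ^ m" using j by (simp flip: power_add)
      finally have abX: "sqrt (real a * real b) \<le> sqrt (X ^ m)" by simp
      have lnM: "ln (real a) \<le> ln (real M)" "ln (real b) \<le> ln (real M)" using ab by auto
      have ln0: "0 \<le> ln (real a)" "0 \<le> ln (real b)" using ab by auto
      have "\<bar>C j a * C (m - j) b\<bar> \<le> (B ^ j * ln (real a) ^ j / sqrt (real a)) * (B ^ (m - j) * ln (real b) ^ (m - j) / sqrt (real b))"
        unfolding abs_mult C_def using pos B ln0
        by (intro mult_mono conv_power_bound[OF cb B]) (auto intro!: divide_nonneg_nonneg mult_nonneg_nonneg)
      also have "\<dots> \<le> (B ^ j * ln (real M) ^ j / sqrt (real a)) * (B ^ (m - j) * ln (real M) ^ (m - j) / sqrt (real b))"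
        using B ln0 lnM
        by (intro mult_mono divide_right_mono mult_left_mono power_mono) (auto intro!: divide_nonneg_nonneg mult_nonneg_nonneg)
      also have "\<dots> = (B ^ j * B ^ (m - j)) * (ln (real M) ^ j * ln (real M) ^ (m - j)) / sqrt (real a * real b)"
        by (simp add: real_sqrt_mult)
      also have "\<dots> = (B * ln (real M)) ^ m / sqrt (real a * real b)"
        using j by (simp add: power_mult_distrib flip: power_add)
      also have "\<dots> = (B * ln (real M)) ^ m * sqrt (real a * real b) / (real a * real b)"
        using pos by (simp add: field_simps)
      also have "\<dots> \<le> (B * ln (real M)) ^ m * sqrt (X ^ m) / (real a * real b)"
        using B pos abX by (intro divide_right_mono mult_left_mono) auto
      finally have "\<bar>C j a * C (m - j) b\<bar> \<le> D * g a b"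
        using True False by (simp add: D_def g_def)
      then show ?thesis using False D by (auto simp: g_def norm_mult abs_mult split: if_splits)
    next
      case False': False
      then show ?thesis using False D by (auto simp: g_def)
    qed
  qed
  have "norm (moment_form c M m (\<lambda>a b. if coprime a q \<and> [a = b] (mod q) then 1 else 0) - 
       moment_form c M m (\<lambda>a b. if a = b then 1 else 0)) \<le> 
    (\<Sum>j\<le>m. real (m choose j) * (\<Sum>a\<in>{1..M}. \<Sum>b\<in>{1..M}. D * g a b))"
    unfolding moment_form_diff unfolding moment_form_def C_def[symmetric]
  proof (intro order_trans[OF norm_sum] sum_mono)
    fix j assume j: "j \<in> {..m}"
    have "norm (\<Sum>a = 1..M. \<Sum>b = 1..M. complex_of_real (C j a * C (m - j) b) *
        ((if coprime a q \<and> [a = b] (mod q) then 1 else 0) - (if a = b then 1 else 0))) \<le> (\<Sum>a\<in>{1..M}. \<Sum>b\<in>{1..M}. D * g a b)"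
      using j by (intro order_trans[OF norm_sum] sum_mono bd) auto
    then show "norm (of_nat (m choose j) * (\<Sum>a = 1..M. \<Sum>b = 1..M. complex_of_real (C j a * C (m - j) b) *
        ((if coprime a q \<and> [a = b] (mod q) then 1 else 0) - (if a = b then 1 else 0)))) \<le> 
        real (m choose j) * (\<Sum>a\<in>{1..M}. \<Sum>b\<in>{1..M}. D * g a b)"
      unfolding norm_mult norm_of_nat by (intro mult_left_mono) auto
  qed
  also have "\<dots> = 2 ^ m * (D * (\<Sum>a\<in>{1..M}. \<Sum>b\<in>{1..M}. g a b))"
    by (simp add: sum_distrib_left[symmetric] sum_distrib_right[symmetric] choose_row_sum flip: of_nat_sum)
  also have "\<dots> \<le> 2 ^ m * (D * (2 * (harm M)\<^sup>2 / real q))"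
    unfolding g_def using D by (intro mult_left_mono sum_inverse_congruent_offdiag q0) auto
  finally show ?thesis by (simp add: D_def mult_ac)
qed

section \<open>The diagonal form for the first two moments\<close>

lemma moment_form_1_diag:
  assumes "c 1 = 0"
  shows "moment_form c M 1 (\<lambda>a b. if a = b then 1 else 0) = 0"
proof -
  have *: "conv_power c 0 a * conv_power c (Suc 0) a = 0" if "a \<in> {1..M}" for a
    using that assms conv_power_1[of a c] by auto
  have "(\<Sum>b\<in>{1..M}. of_real (conv_power c j a * conv_power c (1 - j) b) * (if a = b then 1 else 0 :: complex)) = 0"
    if "j \<le> 1" "a \<in> {1..M}" for j a
  proof -
    have "(\<Sum>b\<in>{1..M}. of_real (conv_power c j a * conv_power c (1 - j) b) * (if a = b then 1 else 0 :: complex)) =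
      (\<Sum>b\<in>{1..M}. if a = b then of_real (conv_power c j a * conv_power c (1 - j) a) else 0)"
      by (intro sum.cong) auto
    also have "\<dots> = of_real (conv_power c j a * conv_power c (1 - j) a)" using that by simp
    also have "conv_power c j a * conv_power c (1 - j) a = 0"
      using *[OF that(2)] that(1) by (cases j) (auto simp: mult.commute)
    finally show ?thesis by simp
  qed
  then show ?thesis unfolding moment_form_def by simp
qed

text \<open>Only \<open>j = 1\<close> contributes, with binomial coefficient 2: for
  \<open>j = 0\<close> and \<open>j = 2\<close> one factor is supported at 1, where the other takes
  the value \<open>(c 1)\<^sup>2 = 0\<close>. This is how the variance of the random model is
  obtained.\<close>

lemma moment_form_2_diag:
  assumes "c 1 = 0"
  shows "moment_form c M 2 (\<lambda>a b. if a = b then 1 else 0) = of_real (2 * (\<Sum>n\<in>{1..M}. (c n)\<^sup>2))"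
proof -
  have d: "(\<Sum>a\<in>{1..M}. \<Sum>b\<in>{1..M}. of_real (conv_power c j a * conv_power c k b) * (if a = b then 1 else 0 :: complex)) =
     of_real (\<Sum>a\<in>{1..M}. conv_power c j a * conv_power c k a)" for j k
  proof -
    have "(\<Sum>b\<in>{1..M}. of_real (conv_power c j a * conv_power c k b) * (if a = b then 1 else 0 :: complex)) =
        of_real (conv_power c j a * conv_power c k a)" if "a \<in> {1..M}" for a
    proof -
      have "(\<Sum>b\<in>{1..M}. of_real (conv_power c j a * conv_power c k b) * (if a = b then 1 else 0 :: complex)) =
        (\<Sum>b\<in>{1..M}. if a = b then of_real (conv_power c j a * conv_power c k a) else 0)"
        by (intro sum.cong) auto
      then show ?thesis using that by simp
    qed
    then show ?thesis by (simp add: of_real_sum)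
  qed
  have z: "conv_power c 0 a * conv_power c 2 a = 0" for a
  proof (cases "a = 1")
    case True
    have "{d. d dvd (1::nat)} = {1}" by auto
    then show ?thesis using True assms by (simp add: numeral_2_eq_2)
  qed simp
  have "{..2::nat} = {0, 1, 2}" by auto
  then have "moment_form c M 2 (\<lambda>a b. if a = b then 1 else 0) = 
    of_real (\<Sum>a\<in>{1..M}. conv_power c 0 a * conv_power c 2 a) + 
    2 * of_real (\<Sum>a\<in>{1..M}. conv_power c 1 a * conv_power c 1 a) + 
    of_real (\<Sum>a\<in>{1..M}. conv_power c 2 a * conv_power c 0 a)"
    unfolding moment_form_def d by (simp del: conv_power.simps)
  also have "(\<Sum>a\<in>{1..M}. conv_power c 1 a * conv_power c 1 a) = (\<Sum>a\<in>{1..M}. (c a)\<^sup>2)"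
    using conv_power_1[of _ c] by (intro sum.cong) (auto simp: power2_eq_square simp del: conv_power.simps)
  finally show ?thesis using z by (simp add: mult.commute del: conv_power.simps)
qed

section \<open>Local factors of the random model\<close>

text \<open>The part of the model statistic that depends on the coordinate of \<open>p\<close>
  alone, evaluated at \<open>w\<close>; adding the complex conjugate produces
  \<open>2 * Re\<close>.\<close>

definition local_sum :: "(nat \<Rightarrow> real) \<Rightarrow> nat \<Rightarrow> nat \<Rightarrow> nat \<Rightarrow> nat \<Rightarrow> real" where
  "local_sum c M N p w = 2 * (\<Sum>n\<in>{n\<in>{n\<in>{1..M}. primepow n}. aprimedivisor n = p}.
      c n * Re (unity_root N w ^ multiplicity p n))"

lemma primepow_cases:
  fixes n :: nat
  assumes "primepow n"
  obtains p k where "prime p" "k > 0" "n = p ^ k" "aprimedivisor n = p" "multiplicity p n = k"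
proof -
  obtain p k where "prime p" "k > 0" "n = p ^ k" using assms by (auto simp: primepow_def)
  then show ?thesis by (intro that[of p k]) (auto simp: aprimedivisor_prime_power)
qed

text \<open>Because \<open>c\<close> lives on prime powers, each term involves a single coordinate
  of \<open>\<omega>\<close>. Grouping the terms by their prime therefore exhibits a sum of
  independent variables.\<close>

lemma random_character_sum_eq:
  fixes M :: nat
  assumes c: "\<And>n. \<not> primepow n \<Longrightarrow> c n = 0"
  defines "P \<equiv> {p. prime p \<and> p \<le> M}"
  shows "(\<Sum>n\<in>{1..M}. of_real (c n) * (random_character P N \<omega> n + cnj (random_character P N \<omega> n))) =
     of_real (\<Sum>p\<in>P. local_sum c M N p (\<omega> p))"
proof -
  define S where "S = {n\<in>{1..M}. primepow n}"
  have fin: "finite P" by (simp add: P_def)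
  have "(\<Sum>n\<in>{1..M}. of_real (c n) * (random_character P N \<omega> n + cnj (random_character P N \<omega> n))) =
     of_real (\<Sum>n\<in>{1..M}. 2 * (c n * Re (random_character P N \<omega> n)))"
    by (simp add: complex_add_cnj mult_ac)
  also have "(\<Sum>n\<in>{1..M}. 2 * (c n * Re (random_character P N \<omega> n))) = (\<Sum>n\<in>S. 2 * (c n * Re (random_character P N \<omega> n)))"
    by (rule sum.mono_neutral_right) (auto simp: S_def c)
  also have "\<dots> = (\<Sum>p\<in>P. \<Sum>n\<in>{n\<in>S. aprimedivisor n = p}. 2 * (c n * Re (random_character P N \<omega> n)))"
  proof (rule sum.group[symmetric])
    show "aprimedivisor ` S \<subseteq> P"
    proof
      fix p assume "p \<in> aprimedivisor ` S"
      then obtain n where n: "n \<in> S" "p = aprimedivisor n" by auto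
      then obtain r k where "prime r" "k > 0" "n = r ^ k" "aprimedivisor n = r"
        using primepow_cases[of n] by (auto simp: S_def)
      moreover have "r \<le> r ^ k" using \<open>prime r\<close> \<open>k > 0\<close> by (intro self_le_power) (auto dest: prime_gt_0_nat)
      ultimately show "p \<in> P" using n by (auto simp: P_def S_def)
    qed
  qed (auto simp: S_def fin)
  also have "\<dots> = (\<Sum>p\<in>P. local_sum c M N p (\<omega> p))"
    unfolding local_sum_def S_def sum_distrib_left
  proof (intro sum.cong refl)
    fix p n assume p: "p \<in> P" and n: "n \<in> {n \<in> {n \<in> {1..M}. primepow n}. aprimedivisor n = p}"
    obtain r k where "prime r" "k > 0" "n = r ^ k" "aprimedivisor n = r" "multiplicity r n = k"
      using n primepow_cases[of n] by auto
    moreover have "random_character P N \<omega> (p ^ k) = unity_root N (\<omega> p) ^ k"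
      using p by (intro random_character_prime_power fin) (auto simp: P_def)
    ultimately show "2 * (c n * Re (random_character P N \<omega> n)) = 2 * (c n * Re (unity_root N (\<omega> p) ^ multiplicity p n))"
      using n by simp
  qed
  finally show ?thesis .
qed

text \<open>The local variables are centred: only exponents strictly between 0 and \<open>N\<close>
  occur, and the corresponding power sums over the roots of unity vanish.\<close>

lemma sum_local_sum_eq_0:
  assumes "M < N"
  shows "(\<Sum>w<N. local_sum c M N p w) = 0"
proof -
  have "(\<Sum>w<N. \<Sum>n\<in>{n\<in>{n\<in>{1..M}. primepow n}. aprimedivisor n = p}. c n * Re (unity_root N w ^ multiplicity p n)) =
     (\<Sum>n\<in>{n\<in>{n\<in>{1..M}. primepow n}. aprimedivisor n = p}. c n * Re (\<Sum>w<N. unity_root N w ^ multiplicity p n))"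
    unfolding Re_sum sum_distrib_left by (rule sum.swap)
  also have "\<dots> = 0"
  proof (rule sum.neutral, intro ballI)
    fix n assume n: "n \<in> {n\<in>{n\<in>{1..M}. primepow n}. aprimedivisor n = p}"
    obtain r k where r: "prime r" "k > 0" "n = r ^ k" "aprimedivisor n = r" "multiplicity r n = k"
      using n primepow_cases[of n] by auto
    have "n > 0" using n by auto
    then have "k < n" using multiplicity_less_self[OF r(1), of n] r(5) by simp
    then have "(\<Sum>w<N. unity_root N w ^ k) = 0" using r n assms by (intro sum_unity_root) auto
    then show "c n * Re (\<Sum>w<N. unity_root N w ^ multiplicity p n) = 0" using r n by simp
  qed
  finally show ?thesis unfolding local_sum_def sum_distrib_left[symmetric] by simp
qed

text \<open>The powers of \<open>p\<close> form a geometric series with ratio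
  \<open>r = 1 / sqrt p\<close>, of size at most \<open>4 * r\<close>, while
  \<open>ln p \<le> 2 / r\<close>. The factors \<open>r\<close> cancel, which makes the bound
  uniform in \<open>p\<close>; with the leading 2 the constant is \<open>2 * 2 * 4\<close>.\<close>

lemma abs_local_sum_le:
  assumes cb: "\<And>n. n > 0 \<Longrightarrow> \<bar>c n\<bar> \<le> B * mangoldt n / sqrt (real n)" and B: "B \<ge> 0" and p: "prime p"
  shows "\<bar>local_sum c M N p w\<bar> \<le> 16 * B"
proof -
  define S where "S = {n\<in>{n\<in>{1..M}. primepow n}. aprimedivisor n = p}"
  define r where "r = 1 / sqrt (real p)"
  have p2: "p \<ge> 2" using p by (rule prime_ge_2_nat)
  have "sqrt 2 \<le> sqrt (real p)" using p2 by simp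
  \<comment> \<open>The worst case is \<open>p = 2\<close>; a ratio below 3/4 bounds the geometric
    series by 4.\<close>
  moreover have "sqrt 2 > 4 / (3::real)" by (rule real_less_rsqrt) (simp add: power2_eq_square)
  ultimately have sp: "sqrt (real p) > 4 / 3" by linarith
  have r: "0 < r" "r < 3 / 4" using sp p2 by (auto simp: r_def field_simps)
  have "\<bar>local_sum c M N p w\<bar> \<le> 2 * (\<Sum>n\<in>S. B * mangoldt n / sqrt (real n))"
    unfolding local_sum_def S_def[symmetric] abs_mult
  proof (simp only: abs_numeral, intro mult_left_mono order_trans[OF sum_abs] sum_mono)
    fix n assume "n \<in> S"
    then have "n > 0" by (auto simp: S_def)
    have "\<bar>Re (unity_root N w ^ multiplicity p n)\<bar> \<le> norm (unity_root N w ^ multiplicity p n)" by (rule abs_Re_le_cmod)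
    then have "\<bar>Re (unity_root N w ^ multiplicity p n)\<bar> \<le> 1" by (simp add: norm_power)
    then have "\<bar>c n * Re (unity_root N w ^ multiplicity p n)\<bar> \<le> \<bar>c n\<bar> * 1"
      unfolding abs_mult by (intro mult_left_mono) auto
    also have "\<dots> \<le> B * mangoldt n / sqrt (real n)" using cb[OF \<open>n > 0\<close>] by simp
    finally show "\<bar>c n * Re (unity_root N w ^ multiplicity p n)\<bar> \<le> B * mangoldt n / sqrt (real n)" .
  qed auto
  also have "(\<Sum>n\<in>S. B * mangoldt n / sqrt (real n)) \<le> (\<Sum>n\<in>(\<lambda>k. p ^ k) ` {1..M}. B * mangoldt n / sqrt (real n))"
  proof (rule sum_mono2)
    show "S \<subseteq> (\<lambda>k. p ^ k) ` {1..M}"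
    proof
      fix n assume n: "n \<in> S"
      then have "primepow n" by (simp add: S_def)
      then obtain r k where rk: "k > 0" "n = r ^ k" "aprimedivisor n = r" "multiplicity r n = k"
        by (rule primepow_cases)
      have "aprimedivisor n = p" using n by (simp add: S_def)
      then have "r = p" using rk(3) by metis
      note k = rk(1,2,4)[unfolded \<open>r = p\<close>]
      have "n > 0" using n by (auto simp: S_def)
      then have "k < n" using multiplicity_less_self[OF p, of n] k(3) by simp
      moreover have "n \<le> M" using n by (simp add: S_def)
      ultimately show "n \<in> (\<lambda>k. p ^ k) ` {1..M}" using k by (intro image_eqI[of _ _ k]) auto
    qed
  qed (use B in \<open>auto intro!: mult_nonneg_nonneg divide_nonneg_nonneg mangoldt_nonneg\<close>)
  also have "\<dots> = (\<Sum>k\<in>{1..M}. B * mangoldt (p ^ k) / sqrt (real (p ^ k)))"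
    using p2 by (subst sum.reindex) (auto simp: inj_on_def power_inject_exp)
  also have "\<dots> = (\<Sum>k\<in>{1..M}. B * ln (real p) * r ^ k)"
  proof (intro sum.cong refl)
    fix k assume "k \<in> {1..M}"
    then have "mangoldt (p ^ k) = ln (real p)" using mangoldt_primepow'[OF p, of k, where ?'a = real] by simp
    then show "B * mangoldt (p ^ k) / sqrt (real (p ^ k)) = B * ln (real p) * r ^ k"
      by (simp add: r_def real_sqrt_power power_one_over field_simps)
  qed
  also have "\<dots> = B * ln (real p) * (\<Sum>k\<in>{1..M}. r ^ k)" by (simp add: sum_distrib_left)
  also have "\<dots> \<le> B * (2 / r) * (4 * r)"
  proof (intro mult_mono)
    have "ln (real p) = 2 * ln (sqrt (real p))" using p2 by (simp add: ln_sqrt)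
    also have "ln (sqrt (real p)) \<le> sqrt (real p)" using p2 ln_le_minus_one[of "sqrt (real p)"] by simp
    finally show "ln (real p) \<le> 2 / r" by (simp add: r_def)
    have "(\<Sum>k\<in>{1..M}. r ^ k) = r * (\<Sum>k<M. r ^ k)"
      unfolding sum_distrib_left
      by (rule sum.reindex_bij_witness[of _ Suc "\<lambda>k. k - 1"]) (auto simp flip: power_Suc)
    also have "(\<Sum>k<M. r ^ k) \<le> (\<Sum>k. r ^ k)"
      using r by (intro sum_le_suminf summable_geometric) auto
    also have "(\<Sum>k. r ^ k) = 1 / (1 - r)" using r by (intro suminf_geometric) auto
    also have "\<dots> \<le> 4" using r by (simp add: divide_simps)
    finally show "(\<Sum>k\<in>{1..M}. r ^ k) \<le> 4 * r" using r by (simp add: mult.commute)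
  qed (use B r p2 in \<open>auto intro!: sum_nonneg\<close>)
  also have "\<dots> = 8 * B" using r by simp
  finally show ?thesis by simp
qed

text \<open>There is no error term: the expansion only involves \<open>a, b \<le> M \<le> N\<close>,
  all of whose prime factors lie in \<open>P\<close>, so orthogonality applies to every
  pair.\<close>

lemma random_character_moment:
  fixes M N :: nat
  assumes c: "\<And>n. real n > X \<Longrightarrow> c n = 0" and X: "X \<ge> 1"
    and cp: "\<And>n. \<not> primepow n \<Longrightarrow> c n = 0"
    and M: "X ^ m \<le> real M" "M \<le> N" "N > 0"
  defines "P \<equiv> {p. prime p \<and> p \<le> M}"
  shows "of_real (product_mean P N (\<lambda>\<omega>. (\<Sum>p\<in>P. local_sum c M N p (\<omega> p)) ^ m)) =
           moment_form c M m (\<lambda>a b. if a = b then 1 else 0)"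
proof -
  let ?\<rho> = "\<lambda>\<omega>. random_character P N \<omega>"
  have fin: "finite P" by (simp add: P_def)
  have "of_real (product_mean P N (\<lambda>\<omega>. (\<Sum>p\<in>P. local_sum c M N p (\<omega> p)) ^ m)) =
    (\<Sum>\<omega>\<in>PiE P (\<lambda>_. {..<N}). of_real (\<Sum>p\<in>P. local_sum c M N p (\<omega> p)) ^ m :: complex) / of_nat N ^ card P"
    by (simp add: product_mean_def)
  also have "(\<Sum>\<omega>\<in>PiE P (\<lambda>_. {..<N}). of_real (\<Sum>p\<in>P. local_sum c M N p (\<omega> p)) ^ m :: complex) = 
      (\<Sum>\<omega>\<in>PiE P (\<lambda>_. {..<N}). moment_form c M m (\<lambda>a b. ?\<rho> \<omega> a * cnj (?\<rho> \<omega> b)))"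
  proof (rule sum.cong[OF refl])
    fix \<omega>
    have "(of_real (\<Sum>p\<in>P. local_sum c M N p (\<omega> p)) :: complex) = 
        (\<Sum>n\<in>{1..M}. of_real (c n) * (?\<rho> \<omega> n + cnj (?\<rho> \<omega> n)))"
      unfolding P_def by (rule random_character_sum_eq[OF cp, symmetric])
    also have "\<dots> ^ m = moment_form c M m (\<lambda>a b. ?\<rho> \<omega> a * cnj (?\<rho> \<omega> b))"
    proof (rule moment_form_eq[OF c X _ _ M(1)])
      show "?\<rho> \<omega> (a * b) = ?\<rho> \<omega> a * ?\<rho> \<omega> b" if "a > 0" "b > 0" for a b
        using that by (intro random_character_mult) (auto simp: P_def)
    qed simp_all
    finally show "(of_real (\<Sum>p\<in>P. local_sum c M N p (\<omega> p)) :: complex) ^ m = 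
      moment_form c M m (\<lambda>a b. ?\<rho> \<omega> a * cnj (?\<rho> \<omega> b))" .
  qed
  also have "\<dots> / of_nat N ^ card P = moment_form c M m (\<lambda>a b. product_mean P N (\<lambda>\<omega>. ?\<rho> \<omega> a * cnj (?\<rho> \<omega> b)))"
    unfolding moment_form_sum product_mean_def divide_inverse by (rule moment_form_cmult[symmetric])
  also have "\<dots> = moment_form c M m (\<lambda>a b. if a = b then 1 else 0)"
  proof (rule moment_form_cong)
    fix a b assume ab: "a \<in> {1..M}" "b \<in> {1..M}"
    have "prime_factors n \<subseteq> P" if "n \<in> {1..M}" for n
      using that by (auto simp: P_def in_prime_factors_iff dest!: dvd_imp_le)
    then show "product_mean P N (\<lambda>\<omega>. ?\<rho> \<omega> a * cnj (?\<rho> \<omega> b)) = (if a = b then 1 else 0)"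
      using ab M by (intro random_character_orthogonal fin) (auto simp: P_def)
  qed
  finally show ?thesis .
qed

section \<open>Fourier transforms of admissible functions\<close>

lemma integrable_decaying:
  assumes "\<delta> > (0::real)"
  shows "integrable lebesgue (\<lambda>x::real. (1 + \<bar>x\<bar>) powr (- 1 - \<delta>))"
proof -
  define k where "k x = indicator {1..} x * x powr (- 1 - \<delta>)" for x :: real
  have "(\<lambda>x. x powr (- 1 - \<delta>)) integrable_on {1..}"
    by (rule has_integral_integrable[OF has_integral_powr_to_inf]) (use assms in auto)
  then have "(\<lambda>x. x powr (- 1 - \<delta>)) absolutely_integrable_on {1..}"
    by (rule nonnegative_absolutely_integrable_1) auto
  then have k: "integrable lebesgue k" by (simp add: set_integrable_def k_def[abs_def])
  \<comment> \<open>The majorant consists of two affine images of a power function cut off to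
    \<open>{1..}\<close>, one for each sign of \<open>x\<close>.\<close>
  have i: "integrable lebesgue (\<lambda>x. k (1 + 1 * x) + k (1 + (-1) * x))"
    by (intro Bochner_Integration.integrable_add lebesgue_integrable_real_affine k) auto
  have m: "(\<lambda>x::real. (1 + \<bar>x\<bar>) powr (- 1 - \<delta>)) \<in> borel_measurable lebesgue"
    by (intro measurable_completion) simp
  show ?thesis
  proof (rule Bochner_Integration.integrable_bound[OF i m], rule AE_I2)
    fix x :: real
    show "norm ((1 + \<bar>x\<bar>) powr (- 1 - \<delta>)) \<le> norm (k (1 + 1 * x) + k (1 + (-1) * x))"
      by (cases "x \<ge> 0") (auto simp: k_def indicator_def)
  qed
qed

lemma admissible_integrable:
  assumes "admissible f"
  shows "integrable lebesgue f"
proof -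
  obtain \<delta> C where d: "\<delta> > 0" "\<And>r. \<bar>f r\<bar> \<le> C * (1 + \<bar>r\<bar>) powr (- 1 - \<delta>)"
    using assms unfolding admissible_def by blast
  have i: "integrable lebesgue (\<lambda>x. C * (1 + \<bar>x\<bar>) powr (- 1 - \<delta>))"
    by (intro Bochner_Integration.integrable_mult_right integrable_decaying d)
  have m: "f \<in> borel_measurable lebesgue" using assms by (simp add: admissible_def)
  show ?thesis
  proof (rule Bochner_Integration.integrable_bound[OF i m], rule AE_I2)
    fix x show "norm (f x) \<le> norm (C * (1 + \<bar>x\<bar>) powr (- 1 - \<delta>))" using d(2)[of x] by simp
  qed
qed

lemma norm_fourier_kernel: "norm (exp (- 2 * of_real pi * \<i> * of_real x * of_real u)) = 1"
  by (simp add: norm_exp_eq_Re)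

lemma fourier_kernel_measurable:
  assumes "f \<in> borel_measurable lebesgue"
  shows "(\<lambda>x. complex_of_real (f x) * exp (- 2 * of_real pi * \<i> * of_real x * of_real u)) \<in> borel_measurable lebesgue"
proof -
  have "(\<lambda>x::real. exp (- 2 * of_real pi * \<i> * of_real x * of_real u)) \<in> borel_measurable borel"
    by (intro borel_measurable_continuous_onI continuous_intros)
  then have "(\<lambda>x::real. exp (- 2 * of_real pi * \<i> * of_real x * of_real u)) \<in> borel_measurable lebesgue"
    by (intro measurable_completion) simp
  moreover have "(\<lambda>x. complex_of_real (f x)) \<in> borel_measurable lebesgue"
    by (rule measurable_compose[OF assms]) (intro borel_measurable_continuous_onI continuous_intros)
  ultimately show ?thesis by (intro borel_measurable_times)
qed

lemma fourier_transform_bound: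
  assumes "admissible f"
  shows "norm (fourier_transform f u) \<le> (LINT x|lebesgue. \<bar>f x\<bar>)"
proof -
  have "norm (fourier_transform f u) \<le> 
      (LINT x|lebesgue. norm (complex_of_real (f x) * exp (- 2 * of_real pi * \<i> * of_real x * of_real u)))"
    unfolding fourier_transform_def by (rule integral_norm_bound)
  then show ?thesis unfolding norm_mult norm_fourier_kernel by simp
qed

lemma continuous_on_fourier_transform:
  assumes "admissible f"
  shows "continuous_on UNIV (fourier_transform f)"
proof (intro continuous_at_imp_continuous_on ballI continuous_at_sequentiallyI)
  fix a :: real and u :: "nat \<Rightarrow> real" assume u: "u \<longlonglongrightarrow> a"
  have m: "f \<in> borel_measurable lebesgue" using assms by (simp add: admissible_def)
  show "(\<lambda>n. fourier_transform f (u n)) \<longlonglongrightarrow> fourier_transform f a"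
    unfolding fourier_transform_def
  proof (rule integral_dominated_convergence[where w = "\<lambda>x. \<bar>f x\<bar>"])
    show "integrable lebesgue (\<lambda>x. \<bar>f x\<bar>)"
      using admissible_integrable[OF assms] by (rule integrable_abs)
    show "AE x in lebesgue. (\<lambda>n. complex_of_real (f x) * exp (- 2 * of_real pi * \<i> * of_real x * of_real (u n)))
        \<longlonglongrightarrow> complex_of_real (f x) * exp (- 2 * of_real pi * \<i> * of_real x * of_real a)"
      by (intro AE_I2 tendsto_intros u)
    show "AE x in lebesgue. norm (complex_of_real (f x) * exp (- 2 * of_real pi * \<i> * of_real x * of_real (u n))) \<le> \<bar>f x\<bar>" for n
      unfolding norm_mult norm_fourier_kernel by simp
  qed (rule fourier_kernel_measurable[OF m])+
qed

lemma fourier_transform_uminus: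
  assumes "admissible f"
  shows "fourier_transform f (- u) = fourier_transform f u"
proof -
  have "fourier_transform f (- u) = cnj (fourier_transform f u)"
    unfolding fourier_transform_def Bochner_Integration.integral_cnj[symmetric]
    by (simp add: exp_cnj)
  also have "\<dots> = fourier_transform f u"
    using fourier_transform_even_real[of f u] assms by (simp add: admissible_def Reals_cnj_iff)
  finally show ?thesis .
qed

lemma fourier_transform_eq_of_real:
  assumes "admissible f"
  shows "fourier_transform f u = of_real (Re (fourier_transform f u))"
  using fourier_transform_even_real[of f u] assms by (simp add: admissible_def)

lemma fourier_transform_eq_0:
  assumes "fun_support (fourier_transform f) \<subseteq> {-\<alpha>..\<alpha>}" "\<bar>u\<bar> > \<alpha>"
  shows "fourier_transform f u = 0"
proof (rule ccontr)
  assume "fourier_transform f u \<noteq> 0"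
  then have "u \<in> fun_support (fourier_transform f)"
    unfolding fun_support_def using closure_subset[of "{u. fourier_transform f u \<noteq> 0}"] by blast
  then have "u \<in> {-\<alpha>..\<alpha>}" using assms(1) by (rule subsetD[rotated])
  then show False using assms(2) by auto
qed

lemma sigma_osc_square:
  assumes "admissible f"
  shows "(sigma_osc f)\<^sup>2 = 2 * integral {0..1} (\<lambda>u. u * (Re (fourier_transform f u))\<^sup>2)"
proof -
  define G where "G u = \<bar>u\<bar> * (Re (fourier_transform f u))\<^sup>2" for u
  have cont: "continuous_on S G" for S
    unfolding G_def
    by (intro continuous_intros continuous_on_subset[OF continuous_on_fourier_transform[OF assms]]) auto
  have "(LINT u:{-1..1}|lebesgue. G u) = integral {-1..1} G"
    by (intro set_lebesgue_integral_eq_integral absolutely_integrable_continuous_real cont)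
  also have "\<dots> = integral {-1..0} G + integral {0..1} G"
    by (intro Henstock_Kurzweil_Integration.integral_combine[symmetric] integrable_continuous_real cont) auto
  also have "integral {-1..0} G = integral {0..1} G"
  proof -
    have "integral {-1..-0} (\<lambda>u. G (- u)) = integral {0..1} G"
      by (rule Henstock_Kurzweil_Integration.integral_reflect_real)
    moreover have "(\<lambda>u. G (- u)) = G"
      by (simp add: G_def fourier_transform_uminus[OF assms] fun_eq_iff)
    ultimately show ?thesis by simp
  qed
  also have "integral {0..1} G = integral {0..1} (\<lambda>u. u * (Re (fourier_transform f u))\<^sup>2)"
    by (rule Henstock_Kurzweil_Integration.integral_cong) (simp add: G_def)
  finally have "(LINT u:{-1..1}|lebesgue. G u) = 2 * integral {0..1} (\<lambda>u. u * (Re (fourier_transform f u))\<^sup>2)"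
    by simp
  moreover have "(LINT u:{-1..1}|lebesgue. G u) \<ge> 0"
    unfolding set_lebesgue_integral_def by (intro Bochner_Integration.integral_nonneg) (auto simp: G_def)
  ultimately show ?thesis unfolding sigma_osc_def G_def by simp
qed

text \<open>Replacing \<open>(mangoldt n)\<^sup>2\<close> by \<open>mangoldt n * ln n\<close>
  changes the sum by a bounded amount, which is lost on division by \<open>(ln q)\<^sup>2\<close>.
  The extra factor \<open>ln n / ln q\<close> is the variable \<open>u\<close> of the
  equidistribution theorem: this is where the weight \<open>\<bar>u\<bar>\<close> in the variance
  comes from. Evenness of the transform accounts for the factor 2 and the interval
  \<open>{-1..1}\<close>.\<close>

lemma variance_tendsto:
  assumes "admissible f"
  shows "(\<lambda>q. 2 / (ln (real q))\<^sup>2 * (\<Sum>n\<in>{1..q}. (mangoldt n / sqrt (real n) * Re (fourier_transform f (ln (real n) / ln (real q))))\<^sup>2))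
     \<longlonglongrightarrow> (sigma_osc f)\<^sup>2"
proof -
  define g where "g u = Re (fourier_transform f u)" for u
  define B where "B = (LINT x|lebesgue. \<bar>f x\<bar>)"
  have gB: "\<bar>g u\<bar> \<le> B" for u
    unfolding g_def B_def using abs_Re_le_cmod fourier_transform_bound[OF assms] by (rule order_trans)
  define h where "h u = u * (g u)\<^sup>2" for u
  define T where "T q = (\<Sum>n\<in>{1..q}. mangoldt n / real n * h (ln (real n) / ln (real q))) / ln (real q)" for q
  define V where "V q = (\<Sum>n\<in>{1..q}. (mangoldt n / sqrt (real n) * g (ln (real n) / ln (real q)))\<^sup>2)" for q
  have "continuous_on {0..1} h"
    unfolding h_def g_def
    by (intro continuous_intros continuous_on_subset[OF continuous_on_fourier_transform[OF assms]]) auto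
  then have T: "T \<longlonglongrightarrow> integral {0..1} h"
    unfolding T_def by (rule mertens_equidistribution)
  obtain C where C: "\<And>N. (\<Sum>n\<in>{1..N}. mangoldt n * (ln (real n) - mangoldt n) / real n) \<le> C"
    using mangoldt_square_defect_bound by blast
  have diff: "\<bar>2 / (ln (real q))\<^sup>2 * V q - 2 * T q\<bar> \<le> 2 * B\<^sup>2 * C / (ln (real q))\<^sup>2" if q: "q \<ge> 2" for q
  proof -
    define L where "L = ln (real q)"
    have L: "L > 0" using q by (simp add: L_def)
    have TL: "T q = (\<Sum>n\<in>{1..q}. mangoldt n * ln (real n) / real n * (g (ln (real n) / L))\<^sup>2) / L\<^sup>2"
      by (simp add: T_def h_def L_def[symmetric] power2_eq_square sum_divide_distrib mult_ac)
    have V: "V q = (\<Sum>n\<in>{1..q}. mangoldt n * mangoldt n / real n * (g (ln (real n) / L))\<^sup>2)"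
      unfolding V_def L_def[symmetric]
      by (intro sum.cong refl) (simp add: power_mult_distrib power_divide power2_eq_square[of "mangoldt _"])
    have "T q * L\<^sup>2 - V q = (\<Sum>n\<in>{1..q}. mangoldt n * (ln (real n) - mangoldt n) / real n * (g (ln (real n) / L))\<^sup>2)"
      using L unfolding TL V by (simp add: sum_subtractf[symmetric]) (intro sum.cong, auto simp: field_simps)
    moreover have "\<bar>\<Sum>n\<in>{1..q}. mangoldt n * (ln (real n) - mangoldt n) / real n * (g (ln (real n) / L))\<^sup>2\<bar> \<le> 
        (\<Sum>n\<in>{1..q}. mangoldt n * (ln (real n) - mangoldt n) / real n * B\<^sup>2)"
    proof (intro order_trans[OF sum_abs] sum_mono)
      fix n assume "n \<in> {1..q}"
      then have "mangoldt n * (ln (real n) - mangoldt n) / real n \<ge> 0"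
        using mangoldt_le[of n] mangoldt_nonneg[of n] by auto
      moreover have "(g (ln (real n) / L))\<^sup>2 \<le> B\<^sup>2"
        using gB[of "ln (real n) / L"] by (simp add: abs_le_square_iff[symmetric])
      ultimately show "\<bar>mangoldt n * (ln (real n) - mangoldt n) / real n * (g (ln (real n) / L))\<^sup>2\<bar> \<le> 
          mangoldt n * (ln (real n) - mangoldt n) / real n * B\<^sup>2"
        by (simp only: abs_mult abs_of_nonneg abs_power2) (rule mult_left_mono)
    qed
    moreover have "(\<Sum>n\<in>{1..q}. mangoldt n * (ln (real n) - mangoldt n) / real n * B\<^sup>2) \<le> C * B\<^sup>2"
      unfolding sum_distrib_right[symmetric] by (intro mult_right_mono C) auto
    ultimately have "\<bar>T q * L\<^sup>2 - V q\<bar> \<le> C * B\<^sup>2" by linarith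
    then have "\<bar>2 / L\<^sup>2 * (T q * L\<^sup>2 - V q)\<bar> \<le> 2 / L\<^sup>2 * (C * B\<^sup>2)"
      unfolding abs_mult by (simp add: mult_left_mono divide_right_mono)
    moreover have "2 / L\<^sup>2 * (T q * L\<^sup>2 - V q) = 2 * T q - 2 / L\<^sup>2 * V q"
      using L by (simp add: field_simps)
    ultimately have "\<bar>2 * T q - 2 / L\<^sup>2 * V q\<bar> \<le> 2 / L\<^sup>2 * (C * B\<^sup>2)" by (simp only:)
    moreover have "2 / L\<^sup>2 * (C * B\<^sup>2) = 2 * B\<^sup>2 * C / L\<^sup>2" by simp
    ultimately show ?thesis unfolding L_def[symmetric] by linarith
  qed
  have z: "(\<lambda>q. 2 * B\<^sup>2 * C / (ln (real q))\<^sup>2) \<longlonglongrightarrow> 0"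
    by real_asymp
  have "(\<lambda>q. 2 / (ln (real q))\<^sup>2 * V q - 2 * T q) \<longlonglongrightarrow> 0"
  proof (rule Lim_null_comparison[OF _ z])
    show "\<forall>\<^sub>F q in sequentially. norm (2 / (ln (real q))\<^sup>2 * V q - 2 * T q) \<le> 2 * B\<^sup>2 * C / (ln (real q))\<^sup>2"
      using eventually_ge_at_top[of 2] by eventually_elim (use diff in simp)
  qed
  then have "(\<lambda>q. (2 / (ln (real q))\<^sup>2 * V q - 2 * T q) + 2 * T q) \<longlonglongrightarrow> 0 + 2 * integral {0..1} h"
    by (intro tendsto_intros T)
  then show ?thesis unfolding sigma_osc_square[OF assms] by (simp add: V_def g_def h_def[abs_def])
qed

lemma log_power_times_negative_power_tendsto_0:
  assumes "d > (0::real)"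
  shows "(\<lambda>q::nat. (1 + 2 * ln (real q)) ^ k * real q powr (- d)) \<longlonglongrightarrow> 0"
  using assms by real_asymp

section \<open>The oscillatory part of the linear statistic\<close>

lemma harm_le_ln_plus_1: "n > 0 \<Longrightarrow> harm n \<le> ln (real n) + 1"
proof -
  assume "n > 0"
  then obtain k where k: "n = Suc k" by (cases n) auto
  have "harm (Suc k) - ln (real (Suc k)) \<le> harm (Suc 0) - ln (real (Suc 0))"
    using decseq_harm_diff_ln by (rule decseqD) simp
  then show ?thesis by (simp add: k harm_expand)
qed

text \<open>Characters modulo \<open>q\<close> vanish at multiples of \<open>q\<close>, but the
  random model does not. Building the zero into the coefficients leaves \<open>W_osc\<close>
  unchanged and lets both sides share the same coefficients.\<close>

definition osc_coeff :: "(real \<Rightarrow> real) \<Rightarrow> nat \<Rightarrow> nat \<Rightarrow> real" where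
  "osc_coeff f q n = (if q dvd n then 0
     else mangoldt n / sqrt (real n) * Re (fourier_transform f (ln (real n) / ln (real q))))"

lemma osc_coeff_eq_0:
  assumes supp: "fun_support (fourier_transform f) \<subseteq> {-\<alpha>..\<alpha>}" and q: "q \<ge> 2" and n: "real n > real q powr \<alpha>"
  shows "osc_coeff f q n = 0"
proof -
  have L: "ln (real q) > 0" using q by simp
  have "ln (real q powr \<alpha>) < ln (real n)"
  proof -
    have "0 < real q powr \<alpha>" using q by simp
    moreover from this n have "0 < real n" by (rule less_trans)
    ultimately show ?thesis using n by (simp only: ln_less_cancel_iff)
  qed
  then have "\<alpha> < ln (real n) / ln (real q)" using L q by (simp add: ln_powr field_simps)
  then have "fourier_transform f (ln (real n) / ln (real q)) = 0"
    by (intro fourier_transform_eq_0[OF supp]) linarith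
  then show ?thesis by (simp add: osc_coeff_def)
qed

lemma abs_osc_coeff_le:
  assumes "admissible f"
  shows "\<bar>osc_coeff f q n\<bar> \<le> (LINT x|lebesgue. \<bar>f x\<bar>) * mangoldt n / sqrt (real n)"
proof -
  have "\<bar>Re (fourier_transform f (ln (real n) / ln (real q)))\<bar> \<le> (LINT x|lebesgue. \<bar>f x\<bar>)"
    using abs_Re_le_cmod fourier_transform_bound[OF assms] by (rule order_trans)
  then have "mangoldt n / sqrt (real n) * \<bar>Re (fourier_transform f (ln (real n) / ln (real q)))\<bar> \<le>
      mangoldt n / sqrt (real n) * (LINT x|lebesgue. \<bar>f x\<bar>)"
    by (intro mult_left_mono) (auto intro!: divide_nonneg_nonneg mangoldt_nonneg)
  moreover have "0 \<le> (LINT x|lebesgue. \<bar>f x\<bar>)" by (intro Bochner_Integration.integral_nonneg) auto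
  ultimately show ?thesis
    by (auto simp: osc_coeff_def abs_mult mult.commute intro!: mult_nonneg_nonneg divide_nonneg_nonneg mangoldt_nonneg)
qed

lemma powr_le_square: "q \<ge> (1::nat) \<Longrightarrow> a \<le> 2 \<Longrightarrow> real q powr a \<le> real (q\<^sup>2)"
  using powr_mono[of a 2 "real q"] by simp

text \<open>The support of the transform makes the series finite. The natural cutoff would be
  \<open>q powr \<alpha>\<close>; \<open>q\<^sup>2\<close> is an integer that also bounds
  \<open>(q powr \<alpha>) ^ m\<close> when \<open>m * \<alpha> \<le> 2\<close>, as the expansion of
  the power requires.\<close>

lemma W_osc_eq:
  assumes f: "admissible f" and supp: "fun_support (fourier_transform f) \<subseteq> {-\<alpha>..\<alpha>}" "\<alpha> \<le> 2"
    and q: "prime q" and \<psi>: "\<psi> \<in> dirichlet_characters q"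
  shows "W_osc f q \<psi> = of_real (- 1 / ln (real q)) * (\<Sum>n\<in>{1..q\<^sup>2}. of_real (osc_coeff f q n) * (\<psi> n + cnj (\<psi> n)))"
proof -
  have q2: "q \<ge> 2" using q by (rule prime_ge_2_nat)
  let ?t = "\<lambda>n. mangoldt n / of_real (sqrt (real n)) *
          fourier_transform f (ln (real n) / ln (real q)) * (\<psi> n + cnj (\<psi> n))"
  have eq: "?t n = of_real (osc_coeff f q n) * (\<psi> n + cnj (\<psi> n))" for n
  proof (cases "q dvd n")
    case True
    then have "\<not> coprime n q" using q by (metis coprime_absorb_right not_prime_unit)
    then have "\<psi> n = 0" using dirichlet_character_eq_0_iff[OF \<psi>] by simp
    then show ?thesis by simp
  next
    case False
    have "mangoldt n = complex_of_real (mangoldt n)" by simp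
    then show ?thesis using False fourier_transform_eq_of_real[OF f, of "ln (real n) / ln (real q)"]
      by (simp add: osc_coeff_def)
  qed
  have "infsum ?t {1..} = infsum ?t {1..q\<^sup>2}"
  proof (rule infsum_cong_neutral)
    fix n assume "n \<in> {1..} - {1..q\<^sup>2}"
    then have "real (q\<^sup>2) < real n" by (simp only: of_nat_less_iff) auto
    then have "real q powr \<alpha> < real n" using powr_le_square[of q \<alpha>] q2 supp(2) by linarith
    then show "?t n = 0" unfolding eq using osc_coeff_eq_0[OF supp(1) q2] by simp
  qed auto
  also have "\<dots> = (\<Sum>n\<in>{1..q\<^sup>2}. ?t n)" by (rule infsum_finite) simp
  finally show ?thesis unfolding W_osc_def eq by simp
qed

text \<open>For \<open>n \<le> X\<close> one has \<open>1 / sqrt n \<le> sqrt X / n\<close>, so a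
  harmonic sum suffices; the logarithm lost is harmless. The constant 4 combines
  \<open>ln n \<le> 2 * ln q\<close> with the two conjugate terms.\<close>

lemma W_osc_trivial_bound:
  assumes f: "admissible f" and supp: "fun_support (fourier_transform f) \<subseteq> {-\<alpha>..\<alpha>}" "\<alpha> \<le> 2"
    and q: "prime q"
  shows "norm (W_osc f q (trivial_character q)) \<le> 
    4 * (LINT x|lebesgue. \<bar>f x\<bar>) * sqrt (real q powr \<alpha>) * (1 + 2 * ln (real q))"
proof -
  define B where "B = (LINT x|lebesgue. \<bar>f x\<bar>)"
  define L where "L = ln (real q)"
  define c where "c = osc_coeff f q"
  have q2: "q \<ge> 2" using q by (rule prime_ge_2_nat)
  have L: "L > 0" using q2 by (simp add: L_def)
  have B: "B \<ge> 0" unfolding B_def by (intro Bochner_Integration.integral_nonneg) auto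
  have lnq2: "ln (real (q\<^sup>2)) = 2 * L" using q2 by (simp add: L_def ln_realpow)
  have t: "norm (of_real (c n) * (trivial_character q n + cnj (trivial_character q n))) \<le> 
      4 * B * L * sqrt (real q powr \<alpha>) * (1 / real n)" if n: "n \<in> {1..q\<^sup>2}" for n
  proof (cases "real n > real q powr \<alpha>")
    case True
    then show ?thesis using osc_coeff_eq_0[OF supp(1) q2 True] B L by (simp add: c_def)
  next
    case False
    have n0: "n > 0" using n by simp
    have "norm (of_real (c n) * (trivial_character q n + cnj (trivial_character q n))) \<le> \<bar>c n\<bar> * 2"
      unfolding norm_mult by (intro mult_mono) (auto simp: trivial_character_def)
    also have "\<dots> \<le> (B * (2 * L) / sqrt (real n)) * 2"
    proof (intro mult_right_mono)
      have "ln (real n) \<le> ln (real (q\<^sup>2))" using n by (intro ln_mono) (auto simp del: of_nat_power)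
      then have "mangoldt n \<le> 2 * L" using mangoldt_le[OF n0] lnq2 by linarith
      then have "B * mangoldt n / sqrt (real n) \<le> B * (2 * L) / sqrt (real n)"
        using B by (intro divide_right_mono mult_left_mono) auto
      then show "\<bar>c n\<bar> \<le> B * (2 * L) / sqrt (real n)"
        using abs_osc_coeff_le[OF f, of q n] unfolding B_def c_def by linarith
    qed auto
    also have "\<dots> = 4 * B * L * sqrt (real n) * (1 / real n)"
      using n0 by (simp add: field_simps)
    also have "\<dots> \<le> 4 * B * L * sqrt (real q powr \<alpha>) * (1 / real n)"
      using False B L by (intro mult_right_mono mult_left_mono) auto
    finally show ?thesis .
  qed
  have "norm (W_osc f q (trivial_character q)) \<le> 1 / L * (\<Sum>n\<in>{1..q\<^sup>2}. 4 * B * L * sqrt (real q powr \<alpha>) * (1 / real n))"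
    unfolding W_osc_eq[OF f supp q trivial_character_in] norm_mult norm_of_real c_def[symmetric] L_def[symmetric]
    using L by (intro mult_mono order_trans[OF norm_sum] sum_mono t) (auto intro!: sum_nonneg)
  also have "\<dots> = 4 * B * sqrt (real q powr \<alpha>) * harm (q\<^sup>2)"
    unfolding sum_distrib_left[symmetric] using L by (simp add: harm_def divide_inverse)
  also have "\<dots> \<le> 4 * B * sqrt (real q powr \<alpha>) * (1 + 2 * L)"
    using B q2 harm_le_ln_plus_1[of "q\<^sup>2"] lnq2 by (intro mult_left_mono) (auto simp del: of_nat_power)
  finally show ?thesis by (simp add: B_def L_def)
qed

section \<open>From the character average to the random model\<close>

lemma character_average_W_osc:
  assumes f: "admissible f" and supp: "fun_support (fourier_transform f) \<subseteq> {-\<alpha>..\<alpha>}" 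
    and m: "m > 0" "real m * \<alpha> \<le> 2" and \<alpha>: "\<alpha> > 0" and q: "prime q"
  shows "character_average q (\<lambda>\<psi>. W_osc f q \<psi> ^ m) = 
      of_nat (q - 1) / (of_nat q - 2) * (of_real ((- 1 / ln (real q)) ^ m) *
        moment_form (osc_coeff f q) (q\<^sup>2) m (\<lambda>a b. if coprime a q \<and> [a = b] (mod q) then 1 else 0))
      - W_osc f q (trivial_character q) ^ m / (of_nat q - 2)"
proof -
  have q2: "q \<ge> 2" using q by (rule prime_ge_2_nat)
  have "1 * \<alpha> \<le> real m * \<alpha>" using m \<alpha> by (intro mult_right_mono) auto
  then have \<alpha>2: "\<alpha> \<le> 2" using m by linarith
  define c where "c = osc_coeff f q"
  define s where "s = - 1 / ln (real q)"
  have X: "real q powr \<alpha> \<ge> 1" using q2 \<alpha> by (intro ge_one_powr_ge_zero) auto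
  have M: "(real q powr \<alpha>) ^ m \<le> real (q\<^sup>2)"
    using powr_le_square[of q "real m * \<alpha>"] q2 m by (simp add: powr_power mult.commute)
  have fin: "finite (dirichlet_characters q)" using q2 by (intro finite_dirichlet_characters) auto
  have "(\<Sum>\<psi>\<in>dirichlet_characters q. W_osc f q \<psi> ^ m) = 
    (\<Sum>\<psi>\<in>dirichlet_characters q. of_real (s ^ m) * moment_form c (q\<^sup>2) m (\<lambda>a b. \<psi> a * cnj (\<psi> b)))"
  proof (rule sum.cong[OF refl])
    fix \<psi> assume \<psi>: "\<psi> \<in> dirichlet_characters q"
    have "(\<Sum>n\<in>{1..q\<^sup>2}. of_real (c n) * (\<psi> n + cnj (\<psi> n))) ^ m = moment_form c (q\<^sup>2) m (\<lambda>a b. \<psi> a * cnj (\<psi> b))"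
    proof (rule moment_form_eq[OF _ X _ _ M])
      show "c n = 0" if "real q powr \<alpha> < real n" for n
        unfolding c_def by (rule osc_coeff_eq_0[OF supp q2 that])
      show "\<psi> 1 = 1" using dirichlet_character_1[OF \<psi>] by simp
      show "\<psi> (a * b) = \<psi> a * \<psi> b" for a b by (rule dirichlet_character_mult[OF \<psi>])
    qed
    then show "W_osc f q \<psi> ^ m = of_real (s ^ m) * moment_form c (q\<^sup>2) m (\<lambda>a b. \<psi> a * cnj (\<psi> b))"
      unfolding W_osc_eq[OF f supp \<alpha>2 q \<psi>] c_def[symmetric] s_def[symmetric] power_mult_distrib by simp
  qed
  also have "\<dots> = of_real (s ^ m) * moment_form c (q\<^sup>2) m (\<lambda>a b. \<Sum>\<psi>\<in>dirichlet_characters q. \<psi> a * cnj (\<psi> b))"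
    unfolding sum_distrib_left[symmetric] moment_form_sum ..
  also have "(\<lambda>a b. \<Sum>\<psi>\<in>dirichlet_characters q. \<psi> a * cnj (\<psi> b)) = 
      (\<lambda>a b. (if coprime a q \<and> [a = b] (mod q) then 1 else 0) * of_nat (q - 1))"
    unfolding sum_dirichlet_characters[OF q] by (intro ext) simp
  finally have all: "(\<Sum>\<psi>\<in>dirichlet_characters q. W_osc f q \<psi> ^ m) = 
     of_nat (q - 1) * (of_real (s ^ m) * moment_form c (q\<^sup>2) m (\<lambda>a b. if coprime a q \<and> [a = b] (mod q) then 1 else 0))"
    unfolding moment_form_cmult by (simp only: mult_ac)
  \<comment> \<open>Orthogonality needs the full group, so the trivial character is included first
    and its contribution subtracted here.\<close>
  have "(\<Sum>\<psi>\<in>dirichlet_characters q - {trivial_character q}. W_osc f q \<psi> ^ m) = 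
     (\<Sum>\<psi>\<in>dirichlet_characters q. W_osc f q \<psi> ^ m) - W_osc f q (trivial_character q) ^ m"
    using fin trivial_character_in by (simp add: sum_diff1)
  then show ?thesis
    unfolding character_average_def all c_def s_def by (simp add: diff_divide_distrib)
qed

lemma random_model_moment:
  assumes f: "admissible f" and supp: "fun_support (fourier_transform f) \<subseteq> {-\<alpha>..\<alpha>}" 
    and m: "real m * \<alpha> \<le> 2" and \<alpha>: "\<alpha> > 0" and q: "prime q"
  shows "of_real (product_mean {p. prime p \<and> p \<le> q\<^sup>2} (Suc (q\<^sup>2)) 
            (\<lambda>\<omega>. (\<Sum>p\<in>{p. prime p \<and> p \<le> q\<^sup>2}. s * local_sum (osc_coeff f q) (q\<^sup>2) (Suc (q\<^sup>2)) p (\<omega> p)) ^ m)) =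
         of_real (s ^ m) * moment_form (osc_coeff f q) (q\<^sup>2) m (\<lambda>a b. if a = b then 1 else 0)"
proof -
  have q2: "q \<ge> 2" using q by (rule prime_ge_2_nat)
  define c where "c = osc_coeff f q"
  have X: "real q powr \<alpha> \<ge> 1" using q2 \<alpha> by (intro ge_one_powr_ge_zero) auto
  have M: "(real q powr \<alpha>) ^ m \<le> real (q\<^sup>2)"
    using powr_le_square[of q "real m * \<alpha>"] q2 m by (simp add: powr_power mult.commute)
  have "of_real (product_mean {p. prime p \<and> p \<le> q\<^sup>2} (Suc (q\<^sup>2)) 
            (\<lambda>\<omega>. (\<Sum>p\<in>{p. prime p \<and> p \<le> q\<^sup>2}. local_sum c (q\<^sup>2) (Suc (q\<^sup>2)) p (\<omega> p)) ^ m)) =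
       moment_form c (q\<^sup>2) m (\<lambda>a b. if a = b then 1 else 0)"
  proof (rule random_character_moment[OF _ X _ M])
    show "c n = 0" if "real q powr \<alpha> < real n" for n
      unfolding c_def by (rule osc_coeff_eq_0[OF supp q2 that])
    show "c n = 0" if "\<not> primepow n" for n
      using that by (simp add: c_def osc_coeff_def mangoldt_def)
  qed auto
  moreover have "product_mean P N (\<lambda>\<omega>. (\<Sum>p\<in>P. s * l p (\<omega> p)) ^ m) = s ^ m * product_mean P N (\<lambda>\<omega>. (\<Sum>p\<in>P. l p (\<omega> p)) ^ m)"
    for P :: "nat set" and N and l :: "nat \<Rightarrow> nat \<Rightarrow> real"
    unfolding product_mean_def sum_distrib_left[symmetric] power_mult_distrib by simp
  ultimately show ?thesis unfolding c_def[symmetric] of_real_mult by simp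
qed

text \<open>For \<open>m \<ge> 2\<close> the hypothesis forces \<open>\<alpha> < 1\<close>. Then the
  second moment is within reach of the exact expansion, and its coefficients vanish beyond
  \<open>q\<close>, which is the range covered by \<open>variance_tendsto\<close>. For
  \<open>m = 1\<close> neither need hold, but the diagonal form is 0 because
  \<open>c 1 = 0\<close>.\<close>

lemma random_model_tendsto:
  assumes f: "admissible f" and supp: "fun_support (fourier_transform f) \<subseteq> {-\<alpha>..\<alpha>}" 
    and m: "m > 0" "real m * \<alpha> < 2" and \<alpha>: "\<alpha> > 0" 
  defines "F \<equiv> inf sequentially (principal {q. prime q \<and> odd q})"
  shows "((\<lambda>q. of_real ((- 1 / ln (real q)) ^ m) * moment_form (osc_coeff f q) (q\<^sup>2) m (\<lambda>a b. if a = b then 1 else 0)) \<longlongrightarrow>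
     of_real (if even m then fact m / (2 ^ (m div 2) * fact (m div 2)) * sigma_osc f ^ m else 0)) F"
proof (cases "m = 1")
  case True
  have "osc_coeff f q 1 = 0" for q by (simp add: osc_coeff_def)
  then have "moment_form (osc_coeff f q) (q\<^sup>2) 1 (\<lambda>a b. if a = b then 1 else 0) = 0" for q
    by (rule moment_form_1_diag)
  then show ?thesis using True by simp
next
  case False
  then have m2: "m \<ge> 2" using m by simp
  have "2 * \<alpha> \<le> real m * \<alpha>" using m2 \<alpha> by (intro mult_right_mono) auto
  then have \<alpha>1: "\<alpha> < 1" using m by linarith
  define P where "P q = {p. prime p \<and> p \<le> q\<^sup>2}" for q :: nat
  define N where "N q = Suc (q\<^sup>2)" for q :: nat
  define c where "c q = osc_coeff f q" for q
  define s where "s q = - 1 / ln (real q)" for q :: nat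
  define Y where "Y q p w = s q * local_sum (c q) (q\<^sup>2) (N q) p w" for q p w
  define B where "B = (LINT x|lebesgue. \<bar>f x\<bar>)"
  have B: "B \<ge> 0" unfolding B_def by (intro Bochner_Integration.integral_nonneg) auto
  have evq: "eventually (\<lambda>q. prime q) F"
    unfolding F_def eventually_inf_principal by simp
  have model: "of_real (product_mean (P q) (N q) (\<lambda>\<omega>. (\<Sum>p\<in>P q. Y q p (\<omega> p)) ^ k)) = 
      of_real (s q ^ k) * moment_form (c q) (q\<^sup>2) k (\<lambda>a b. if a = b then 1 else 0)"
    if "prime q" "k \<le> m" for q k
  proof -
    have "real k * \<alpha> \<le> real m * \<alpha>" using that \<alpha> by (intro mult_right_mono) auto
    then have "real k * \<alpha> \<le> 2" using m by linarith
    then show ?thesis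
      unfolding P_def N_def Y_def c_def by (rule random_model_moment[OF f supp _ \<alpha> that(1)])
  qed
  have lim: "((\<lambda>q. product_mean (P q) (N q) (\<lambda>\<omega>. (\<Sum>p\<in>P q. Y q p (\<omega> p)) ^ m)) \<longlongrightarrow>
    (if even m then fact m / (2 ^ (m div 2) * fact (m div 2)) * ((sigma_osc f)\<^sup>2) ^ (m div 2) else 0)) F"
  proof (rule moments_tendsto_gaussian)
    show "((\<lambda>q. 16 * B / ln (real q)) \<longlongrightarrow> 0) F"
    proof -
      have "(\<lambda>q. 16 * B / ln (real q)) \<longlonglongrightarrow> 0" by real_asymp
      then show ?thesis unfolding F_def by (rule tendsto_mono[OF inf_le1])
    qed
    show "\<forall>\<^sub>F q in F. finite (P q) \<and> 0 < N q \<and> 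
      (\<forall>p\<in>P q. (\<forall>w<N q. \<bar>Y q p w\<bar> \<le> 16 * B / ln (real q)) \<and> (\<Sum>w<N q. Y q p w) = 0)"
      using evq
    proof eventually_elim
      case (elim q)
      have q2: "q \<ge> 2" using elim by (rule prime_ge_2_nat)
      have "\<bar>Y q p w\<bar> \<le> 16 * B / ln (real q)" if "p \<in> P q" for p w
      proof -
        have "\<bar>local_sum (c q) (q\<^sup>2) (N q) p w\<bar> \<le> 16 * B"
          using that abs_osc_coeff_le[OF f] B unfolding B_def c_def P_def by (intro abs_local_sum_le) auto
        then have "1 / ln (real q) * \<bar>local_sum (c q) (q\<^sup>2) (N q) p w\<bar> \<le> 1 / ln (real q) * (16 * B)"
          using q2 by (intro mult_left_mono) auto
        then show ?thesis using q2 by (simp add: Y_def s_def abs_mult)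
      qed
      moreover have "(\<Sum>w<N q. Y q p w) = 0" for p
        unfolding Y_def sum_distrib_left[symmetric] by (subst sum_local_sum_eq_0) (simp_all add: N_def)
      moreover have "finite (P q)" by (simp add: P_def)
      moreover have "N q > 0" by (simp add: N_def)
      ultimately show ?case by blast
    qed
    show "((\<lambda>q. product_mean (P q) (N q) (\<lambda>\<omega>. (\<Sum>p\<in>P q. Y q p (\<omega> p))\<^sup>2)) \<longlongrightarrow> (sigma_osc f)\<^sup>2) F"
    proof (rule Lim_transform_eventually)
      show "((\<lambda>q. 2 / (ln (real q))\<^sup>2 * (\<Sum>n\<in>{1..q}. (mangoldt n / sqrt (real n) * Re (fourier_transform f (ln (real n) / ln (real q))))\<^sup>2)) \<longlongrightarrow> (sigma_osc f)\<^sup>2) F"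
        using variance_tendsto[OF f] unfolding F_def by (rule tendsto_mono[OF inf_le1])
      show "\<forall>\<^sub>F q in F. 2 / (ln (real q))\<^sup>2 * (\<Sum>n\<in>{1..q}. (mangoldt n / sqrt (real n) * Re (fourier_transform f (ln (real n) / ln (real q))))\<^sup>2) = 
          product_mean (P q) (N q) (\<lambda>\<omega>. (\<Sum>p\<in>P q. Y q p (\<omega> p))\<^sup>2)"
        using evq
      proof eventually_elim
        case (elim q)
        have q2: "q \<ge> 2" using elim by (rule prime_ge_2_nat)
        have qa: "real q powr \<alpha> < real q" using powr_less_mono[of \<alpha> 1 "real q"] \<alpha>1 q2 by simp
        have "(\<Sum>n\<in>{1..q}. (mangoldt n / sqrt (real n) * Re (fourier_transform f (ln (real n) / ln (real q))))\<^sup>2) = 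
           (\<Sum>n\<in>{1..q}. (c q n)\<^sup>2)"
        proof (rule sum.cong[OF refl])
          fix n assume n: "n \<in> {1..q}"
          show "(mangoldt n / sqrt (real n) * Re (fourier_transform f (ln (real n) / ln (real q))))\<^sup>2 = (c q n)\<^sup>2"
          proof (cases "q dvd n")
            \<comment> \<open>The only multiple of \<open>q\<close> in the range is \<open>q\<close>
              itself, at which \<open>osc_coeff\<close> is 0 by definition; the true term also
              vanishes, since the support lies strictly inside \<open>{-1..1}\<close>.\<close>
            case True
            then have "n = q" using n dvd_imp_le[of q n] by auto
            moreover have "fourier_transform f 1 = 0" using \<alpha>1 by (intro fourier_transform_eq_0[OF supp]) auto
            ultimately show ?thesis using q2 by (simp add: c_def osc_coeff_def)
          qed (simp add: c_def osc_coeff_def)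
        qed
        also have "\<dots> = (\<Sum>n\<in>{1..q\<^sup>2}. (c q n)\<^sup>2)"
        proof (rule sum.mono_neutral_left)
          have "q \<le> q\<^sup>2" using q2 by (simp add: power2_eq_square)
          then show "{1..q} \<subseteq> {1..q\<^sup>2}" by auto
          show "\<forall>n\<in>{1..q\<^sup>2} - {1..q}. (c q n)\<^sup>2 = 0"
          proof
            fix n assume "n \<in> {1..q\<^sup>2} - {1..q}"
            then have "real q powr \<alpha> < real n" using qa by auto
            then show "(c q n)\<^sup>2 = 0" using osc_coeff_eq_0[OF supp q2] by (simp add: c_def)
          qed
        qed auto
        finally have sum_eq: "(\<Sum>n\<in>{1..q}. (mangoldt n / sqrt (real n) * Re (fourier_transform f (ln (real n) / ln (real q))))\<^sup>2) = 
           (\<Sum>n\<in>{1..q\<^sup>2}. (c q n)\<^sup>2)" .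
        have "c q 1 = 0" by (simp add: c_def osc_coeff_def)
        then have "of_real (product_mean (P q) (N q) (\<lambda>\<omega>. (\<Sum>p\<in>P q. Y q p (\<omega> p))\<^sup>2)) = 
            (of_real ((s q)\<^sup>2 * (2 * (\<Sum>n\<in>{1..q\<^sup>2}. (c q n)\<^sup>2))) :: complex)"
          unfolding model[OF elim m2] by (subst moment_form_2_diag) (simp_all only: of_real_mult)
        then have "product_mean (P q) (N q) (\<lambda>\<omega>. (\<Sum>p\<in>P q. Y q p (\<omega> p))\<^sup>2) = (s q)\<^sup>2 * (2 * (\<Sum>n\<in>{1..q\<^sup>2}. (c q n)\<^sup>2))"
          by (simp only: of_real_eq_iff)
        then show ?case unfolding sum_eq by (simp add: s_def power_divide)
      qed
    qed
  qed
  have "(if even m then fact m / (2 ^ (m div 2) * fact (m div 2)) * ((sigma_osc f)\<^sup>2) ^ (m div 2) else 0) = 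
     (if even m then fact m / (2 ^ (m div 2) * fact (m div 2)) * sigma_osc f ^ m else 0)"
    by (auto simp flip: power_mult)
  then have "((\<lambda>q. of_real (product_mean (P q) (N q) (\<lambda>\<omega>. (\<Sum>p\<in>P q. Y q p (\<omega> p)) ^ m)) :: complex) \<longlongrightarrow> 
     of_real (if even m then fact m / (2 ^ (m div 2) * fact (m div 2)) * sigma_osc f ^ m else 0)) F"
    using lim by (intro tendsto_of_real) simp
  then show ?thesis
  proof (rule Lim_transform_eventually)
    show "\<forall>\<^sub>F q in F. of_real (product_mean (P q) (N q) (\<lambda>\<omega>. (\<Sum>p\<in>P q. Y q p (\<omega> p)) ^ m)) = 
      of_real ((- 1 / ln (real q)) ^ m) * moment_form (osc_coeff f q) (q\<^sup>2) m (\<lambda>a b. if a = b then 1 else 0)"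
      using evq by eventually_elim (use model in \<open>simp add: c_def s_def\<close>)
  qed
qed

theorem theorem5p1:
  fixes f :: "real \<Rightarrow> real" and \<alpha> :: real and m :: nat
  assumes "admissible f"
    and "\<alpha> > 0"
    and "fun_support (fourier_transform f) \<subseteq> {-\<alpha>..\<alpha>}"
    and "m > 0"
    and "real m < 2 / \<alpha>"
  shows "((\<lambda>q. character_average q (\<lambda>\<psi>. W_osc f q \<psi> ^ m)) \<longlongrightarrow>
           complex_of_real
             (if even m then fact m / (2 ^ (m div 2) * fact (m div 2)) * sigma_osc f ^ m else 0))
         (inf sequentially (principal {q. prime q \<and> odd q}))"
proof -
  define F where "F = inf sequentially (principal {q::nat. prime q \<and> odd q})"
  define B where "B = (LINT x|lebesgue. \<bar>f x\<bar>)"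
  have B: "B \<ge> 0" unfolding B_def by (intro Bochner_Integration.integral_nonneg) auto
  have m\<alpha>: "real m * \<alpha> < 2" using assms(2,5) by (simp add: field_simps)
  have "1 * \<alpha> \<le> real m * \<alpha>" using assms(2,4) by (intro mult_right_mono) auto
  then have \<alpha>2: "\<alpha> \<le> 2" using m\<alpha> by linarith
  \<comment> \<open>With \<open>X = q powr \<alpha>\<close>, both error terms carry the factor
    \<open>sqrt (X ^ m) / q = q powr (- d)\<close>. The hypothesis on \<open>m\<close> says exactly
    that \<open>d > 0\<close>.\<close>
  define d where "d = 1 - real m * \<alpha> / 2"
  have d: "d > 0" using m\<alpha> by (simp add: d_def)
  have evq: "eventually (\<lambda>q. prime q \<and> q \<ge> 3) F"
    unfolding F_def eventually_inf_principal
  proof (rule always_eventually, intro allI impI)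
    fix q :: nat assume "q \<in> {q. prime q \<and> odd q}"
    then have "prime q" "odd q" by auto
    moreover have "q \<noteq> 2" using \<open>odd q\<close> by auto
    ultimately show "prime q \<and> 3 \<le> q" using prime_ge_2_nat[of q] by auto
  qed
  have tendsto_F: "(g \<longlongrightarrow> l) F" if "g \<longlonglongrightarrow> l" for g :: "nat \<Rightarrow> 'a::topological_space" and l
    using that unfolding F_def by (rule tendsto_mono[OF inf_le1])
  define s where "s q = - 1 / ln (real q)" for q :: nat
  define MC where "MC q = moment_form (osc_coeff f q) (q\<^sup>2) m (\<lambda>a b. if coprime a q \<and> [a = b] (mod q) then 1 else 0)" for q
  define MD where "MD q = moment_form (osc_coeff f q) (q\<^sup>2) m (\<lambda>a b. if a = b then 1 else 0)" for q
  define l where "l = complex_of_real (if even m then fact m / (2 ^ (m div 2) * fact (m div 2)) * sigma_osc f ^ m else 0)"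
  have sqrtX: "sqrt ((real q powr \<alpha>) ^ m) / real q = real q powr (- d)" if "q \<ge> 2" for q :: nat
  proof -
    have "sqrt ((real q powr \<alpha>) ^ m) = real q powr (real m * \<alpha> / 2)"
      using that by (simp add: powr_power powr_half_sqrt[symmetric] powr_powr mult.commute)
    also have "\<dots> / real q = real q powr (real m * \<alpha> / 2 - 1)"
      using that by (simp add: powr_diff)
    finally show ?thesis by (simp add: d_def)
  qed
  have "((\<lambda>q. of_real (s q ^ m) * MD q) \<longlongrightarrow> l) F"
    unfolding s_def MD_def l_def F_def by (rule random_model_tendsto[OF assms(1,3,4) m\<alpha> assms(2)])
  moreover have "((\<lambda>q. of_real (s q ^ m) * MC q - of_real (s q ^ m) * MD q) \<longlongrightarrow> 0) F"
  proof (rule Lim_null_comparison)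
    show "\<forall>\<^sub>F q in F. norm (of_real (s q ^ m) * MC q - of_real (s q ^ m) * MD q) \<le>
        2 * (4 * B) ^ m * ((1 + 2 * ln (real q)) ^ 2 * real q powr (- d))"
      using evq
    proof eventually_elim
      case (elim q)
      then have q: "prime q" "q \<ge> 2" by auto
      define L where "L = ln (real q)"
      have L: "L > 0" using q by (simp add: L_def)
      have lnq2: "ln (real (q\<^sup>2)) = 2 * L" using q by (simp add: L_def ln_realpow)
      have "harm (q\<^sup>2) \<le> 1 + 2 * L" using harm_le_ln_plus_1[of "q\<^sup>2"] lnq2 q by simp
      then have h: "(harm (q\<^sup>2))\<^sup>2 \<le> (1 + 2 * L)\<^sup>2" by (intro power_mono harm_nonneg)
      have "norm (MC q - MD q) \<le> 2 ^ m * (B * ln (real (q\<^sup>2))) ^ m * sqrt ((real q powr \<alpha>) ^ m) * (2 * (harm (q\<^sup>2))\<^sup>2 / real q)"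
        unfolding MC_def MD_def
      proof (rule moment_form_offdiag_bound)
        show "osc_coeff f q n = 0" if "real n > real q powr \<alpha>" for n
          by (rule osc_coeff_eq_0[OF assms(3) q(2) that])
        show "real q powr \<alpha> \<ge> 1" using q assms(2) by (intro ge_one_powr_ge_zero) auto
        show "\<bar>osc_coeff f q n\<bar> \<le> B * mangoldt n / sqrt (real n)" for n
          unfolding B_def by (rule abs_osc_coeff_le[OF assms(1)])
        show "osc_coeff f q n = 0" if "q dvd n" for n using that by (simp add: osc_coeff_def)
      qed (use B q in auto)
      also have "\<dots> \<le> 2 ^ m * (B * (2 * L)) ^ m * sqrt ((real q powr \<alpha>) ^ m) * (2 * (1 + 2 * L)\<^sup>2 / real q)"
        unfolding lnq2 using B L h by (intro mult_left_mono divide_right_mono mult_nonneg_nonneg) auto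
      also have "\<dots> = 2 * (4 * B) ^ m * L ^ m * (1 + 2 * L)\<^sup>2 * (sqrt ((real q powr \<alpha>) ^ m) / real q)"
      proof -
        have "2 ^ m * (B * (2 * L)) ^ m = (2 * (B * (2 * L))) ^ m" by (rule power_mult_distrib[symmetric])
        also have "2 * (B * (2 * L)) = 4 * B * L" by simp
        also have "(4 * B * L) ^ m = (4 * B) ^ m * L ^ m" by (rule power_mult_distrib)
        finally have eq: "2 ^ m * (B * (2 * L)) ^ m = (4 * B) ^ m * L ^ m" .
        show ?thesis unfolding eq by simp
      qed
      also have "\<dots> = L ^ m * (2 * (4 * B) ^ m * ((1 + 2 * L)\<^sup>2 * real q powr (- d)))"
        unfolding sqrtX[OF q(2)] by simp
      finally have b: "norm (MC q - MD q) \<le> L ^ m * (2 * (4 * B) ^ m * ((1 + 2 * L)\<^sup>2 * real q powr (- d)))" .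
      \<comment> \<open>The normalisation cancels the \<open>m\<close> logarithms carried by the
        coefficients, so only the two from the harmonic sums remain. In \<open>4 ^ m\<close>, one
        factor \<open>2 ^ m\<close> comes from the binomial coefficients and the other from
        \<open>ln (q\<^sup>2) = 2 * L\<close>.\<close>
      have "\<bar>s q ^ m\<bar> = (1 / L) ^ m" using L by (simp add: s_def L_def[symmetric] power_abs)
      then have "norm (of_real (s q ^ m) * MC q - of_real (s q ^ m) * MD q) = (1 / L) ^ m * norm (MC q - MD q)"
        by (simp only: right_diff_distrib[symmetric] norm_mult norm_of_real)
      also have "\<dots> \<le> (1 / L) ^ m * (L ^ m * (2 * (4 * B) ^ m * ((1 + 2 * L)\<^sup>2 * real q powr (- d))))"
        using b L by (intro mult_left_mono) auto
      also have "\<dots> = 2 * (4 * B) ^ m * ((1 + 2 * L)\<^sup>2 * real q powr (- d))"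
        using L by (simp add: power_one_over)
      finally show ?case by (simp add: L_def)
    qed
    show "((\<lambda>q. 2 * (4 * B) ^ m * ((1 + 2 * ln (real q)) ^ 2 * real q powr (- d))) \<longlongrightarrow> 0) F"
      by (intro tendsto_F tendsto_mult_right_zero log_power_times_negative_power_tendsto_0 d)
  qed
  ultimately have "((\<lambda>q. of_real (s q ^ m) * MD q + (of_real (s q ^ m) * MC q - of_real (s q ^ m) * MD q)) \<longlongrightarrow> l + 0) F"
    by (rule tendsto_add)
  then have main: "((\<lambda>q. of_real (s q ^ m) * MC q) \<longlongrightarrow> l) F" by simp
  have "(\<lambda>q. (real q - 1) / (real q - 2)) \<longlonglongrightarrow> 1" by real_asymp
  then have "((\<lambda>q. of_real ((real q - 1) / (real q - 2)) :: complex) \<longlongrightarrow> of_real 1) F"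
    by (intro tendsto_of_real tendsto_F)
  then have factor: "((\<lambda>q. of_real ((real q - 1) / (real q - 2)) * (of_real (s q ^ m) * MC q)) \<longlongrightarrow> of_real 1 * l) F"
    using main by (rule tendsto_mult)
  have trivial: "((\<lambda>q. W_osc f q (trivial_character q) ^ m / (of_nat q - 2)) \<longlongrightarrow> 0) F"
  proof (rule Lim_null_comparison)
    show "\<forall>\<^sub>F q in F. norm (W_osc f q (trivial_character q) ^ m / (of_nat q - 2)) \<le>
        3 * (4 * B) ^ m * ((1 + 2 * ln (real q)) ^ m * real q powr (- d))"
      using evq
    proof eventually_elim
      case (elim q)
      then have q: "prime q" "q \<ge> 2" "q \<ge> 3" by auto
      have L: "ln (real q) > 0" using q by simp
      have "norm (W_osc f q (trivial_character q)) \<le> 4 * B * sqrt (real q powr \<alpha>) * (1 + 2 * ln (real q))"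
        unfolding B_def by (rule W_osc_trivial_bound[OF assms(1,3) \<alpha>2 q(1)])
      then have "norm (W_osc f q (trivial_character q)) ^ m \<le> (4 * B * sqrt (real q powr \<alpha>) * (1 + 2 * ln (real q))) ^ m"
        by (intro power_mono) auto
      also have "\<dots> = (4 * B) ^ m * (1 + 2 * ln (real q)) ^ m * sqrt ((real q powr \<alpha>) ^ m)"
        by (simp add: power_mult_distrib real_sqrt_power)
      finally have b: "norm (W_osc f q (trivial_character q)) ^ m \<le> (4 * B) ^ m * (1 + 2 * ln (real q)) ^ m * sqrt ((real q powr \<alpha>) ^ m)" .
      have nq: "norm (of_nat q - 2 :: complex) = real q - 2"
      proof -
        have "(of_nat q - 2 :: complex) = of_real (real q - 2)" by simp
        then show ?thesis using q by (simp only: norm_of_real)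
      qed
      have "norm (W_osc f q (trivial_character q) ^ m / (of_nat q - 2)) = norm (W_osc f q (trivial_character q)) ^ m / (real q - 2)"
        by (simp add: norm_divide norm_power nq)
      \<comment> \<open>\<open>q - 2 \<ge> q / 3\<close> holds because an odd prime is at least
        3.\<close>
      also have "\<dots> \<le> ((4 * B) ^ m * (1 + 2 * ln (real q)) ^ m * sqrt ((real q powr \<alpha>) ^ m)) / (real q / 3)"
        using b q B L by (intro frac_le mult_nonneg_nonneg) auto
      also have "\<dots> = 3 * (4 * B) ^ m * (1 + 2 * ln (real q)) ^ m * (sqrt ((real q powr \<alpha>) ^ m) / real q)"
        by simp
      finally show ?case unfolding sqrtX[OF q(2)] by (simp add: mult.assoc)
    qed
    show "((\<lambda>q. 3 * (4 * B) ^ m * ((1 + 2 * ln (real q)) ^ m * real q powr (- d))) \<longlongrightarrow> 0) F"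
      by (intro tendsto_F tendsto_mult_right_zero log_power_times_negative_power_tendsto_0 d)
  qed
  have "((\<lambda>q. of_real ((real q - 1) / (real q - 2)) * (of_real (s q ^ m) * MC q) -
      W_osc f q (trivial_character q) ^ m / (of_nat q - 2)) \<longlongrightarrow> of_real 1 * l - 0) F"
    by (rule tendsto_diff[OF factor trivial])
  then have "((\<lambda>q. of_real ((real q - 1) / (real q - 2)) * (of_real (s q ^ m) * MC q) -
      W_osc f q (trivial_character q) ^ m / (of_nat q - 2)) \<longlongrightarrow> l) F" by simp
  then have "((\<lambda>q. character_average q (\<lambda>\<psi>. W_osc f q \<psi> ^ m)) \<longlongrightarrow> l) F"
  proof (rule Lim_transform_eventually)
    show "\<forall>\<^sub>F q in F. of_real ((real q - 1) / (real q - 2)) * (of_real (s q ^ m) * MC q) -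
      W_osc f q (trivial_character q) ^ m / (of_nat q - 2) = character_average q (\<lambda>\<psi>. W_osc f q \<psi> ^ m)"
      using evq
    proof eventually_elim
      case (elim q)
      then have q: "prime q" "q \<ge> 1" by auto
      have "(of_nat (q - 1) / (of_nat q - 2) :: complex) = of_real ((real q - 1) / (real q - 2))"
        using q by (simp add: of_nat_diff)
      then show ?case
        using character_average_W_osc[OF assms(1,3,4) less_imp_le[OF m\<alpha>] assms(2) q(1)]
        by (simp only: s_def MC_def)
    qed
  qed
  then show ?thesis unfolding l_def F_def .
qed

end
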